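(* Let $M$ be a smooth manifold, $\mathcal J$ a skew-symmetric generalized complex structure on $M$ with holomorphic bundle $L(E,\alpha)$, and $D$ a linear connection on $M$. Suppose that $E$ is involutive, that $D_{\Gamma(E)}\Gamma(E)\subset\Gamma(E)$, that $R^D_{E,E}E=0$ (for the complex linear extensions of $D$ and its curvature $R^D$), and that $$(D_Z\alpha)(X,Y)+\alpha(T^D_ZX,Y)+\alpha(X,T^D_ZY)=0,\qquad\forall X,Y,Z\in\Gamma(E),$$ where $T^D$ is the torsion of $D$. Then the almost complex structure $J^{\mathcal J,D}$ on $T^*M$ is integrable if and only if $\mathcal J$ is Courant integrable.
   Context: Let $\mathbb TM=TM\oplus T^*M$ with the metric $g_{\mathrm{can}}(X+\xi,Y+\eta)=\frac12(\xi(Y)+\eta(X))$. A skew-symmetric generalized complex structure on $M$ is a smooth field $\mathcal J$ of $g_{\mathrm{can}}$-skew-symmetric endomorphisms of $\mathbb TM$ with $\mathcal J^2=-\mathrm{Id}$ (no integrability assumed). Its holomorphic bundle is its $i$-eigenbundle $L\subset\mathbb T^{\mathbb C}M$; it has the form $$L(E,\alpha)=\{X+\xi\in E\oplus(T^{\mathbb C}M)^*:\ \xi|_E=i_X\alpha\},$$ where $E\subset T^{\mathbb C}M$ is the projection of $L$ to $T^{\mathbb C}M$, assumed to be a complex subbundle (constant rank), $E+\bar E=T^{\mathbb C}M$, $\alpha\in\Gamma(\Lambda^2E^* )$, and $\mathrm{Im}(\alpha|_\Delta)$ is non-degenerate on $\Delta\subset TM$, $\Delta^{\mathbb C}=E\cap\bar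 E$. $\mathcal J$ is Courant integrable if $\Gamma(L)$ is closed under the (complex bilinear extension of the) Courant bracket $[X+\xi,Y+\eta]=[X,Y]+L_X\eta-L_Y\xi+\frac12d(\xi(Y)-\eta(X))$. The connection $D$, acting on $\pi:T^*M\to M$, induces a decomposition $T(T^*M)=H^D\oplus T^{\mathrm{vert}}(T^*M)\cong\pi^*(TM)\oplus\pi^*(T^*M)=\pi^*(\mathbb TM)$ into horizontal and vertical bundles; $J^{\mathcal J,D}:=\pi^*(\mathcal J)$ under this identification. Conventions: $R^D_{X,Y}=-D_XD_Y+D_YD_X+D_{[X,Y]}$, $T^D_XY=D_XY-D_YX-[X,Y]$. *)

theory Defs
  imports "HOL-Analysis.Analysis"
begin

section \<open>Smooth maps between Euclidean spaces\<close>

text \<open>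
  The set \<open>S\<close> is meant to be open. Since the domain is finite-dimensional, controlling all
  directional derivatives of a differentiable map controls its total derivative.
\<close>

primrec Ck_on :: "nat \<Rightarrow> 'a::euclidean_space set \<Rightarrow> ('a \<Rightarrow> 'b::real_normed_vector) \<Rightarrow> bool" where
  "Ck_on 0 S f \<longleftrightarrow> continuous_on S f"
| "Ck_on (Suc k) S f \<longleftrightarrow>
     (\<forall>x\<in>S. f differentiable (at x)) \<and> (\<forall>v. Ck_on k S (\<lambda>x. frechet_derivative f (at x) v))"

definition smooth_on :: "'a::euclidean_space set \<Rightarrow> ('a \<Rightarrow> 'b::real_normed_vector) \<Rightarrow> bool" where
  "smooth_on S f \<longleftrightarrow> (\<forall>k. Ck_on k S f)"


section \<open>Smooth manifolds\<close>

text \<open>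
  A manifold is a whole type \<open>'m\<close> with an atlas of charts into a Euclidean space \<open>'v\<close>. The atlas
  determines the topology and the smooth structure. As part of the data, every point \<open>p\<close> has a
  preferred chart \<open>chart_at M p\<close> around it, and the tangent space at \<open>p\<close> is realised as the model
  space \<open>'v\<close>, a vector of \<open>'v\<close> being read as the coefficients with respect to the coordinate frame
  of \<open>chart_at M p\<close>. The cotangent space at \<open>p\<close> is realised as \<open>'v\<close> too, through the dual frame,
  so that the evaluation \<open>\<xi>(X)\<close> is the inner product \<open>\<xi> \<bullet> X\<close> of coefficients. The preferred charts
  may vary with \<open>p\<close> in an arbitrary way; smoothness of a field is always tested after passing to
  the coefficients with respect to a fixed chart.
\<close>

type_synonym ('m, 'v) chart = "'m set \<times> ('m \<Rightarrow> 'v)"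

abbreviation chart_dom :: "('m, 'v) chart \<Rightarrow> 'm set" where
  "chart_dom c \<equiv> fst c"

abbreviation chart_map :: "('m, 'v) chart \<Rightarrow> 'm \<Rightarrow> 'v" where
  "chart_map c \<equiv> snd c"

definition chart_inv :: "('m, 'v) chart \<Rightarrow> 'v \<Rightarrow> 'm" where
  "chart_inv c = inv_into (chart_dom c) (chart_map c)"

record ('m, 'v) charted_space =
  atlas :: "('m, 'v) chart set"
  chart_at :: "'m \<Rightarrow> ('m, 'v) chart"

definition mfd_topology :: "('m, 'v::euclidean_space) charted_space \<Rightarrow> 'm topology" where
  "mfd_topology M = topology (\<lambda>W. \<forall>c\<in>atlas M. open (chart_map c ` (W \<inter> chart_dom c)))"

definition smooth_manifold :: "('m, 'v::euclidean_space) charted_space \<Rightarrow> bool" where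
  "smooth_manifold M \<longleftrightarrow>
     (\<forall>c\<in>atlas M. inj_on (chart_map c) (chart_dom c) \<and> open (chart_map c ` chart_dom c)) \<and>
     (\<forall>c\<in>atlas M. \<forall>c'\<in>atlas M.
        open (chart_map c ` (chart_dom c \<inter> chart_dom c')) \<and>
        smooth_on (chart_map c ` (chart_dom c \<inter> chart_dom c')) (chart_map c' \<circ> chart_inv c)) \<and>
     (\<forall>p. chart_at M p \<in> atlas M \<and> p \<in> chart_dom (chart_at M p)) \<and>
     Hausdorff_space (mfd_topology M) \<and> second_countable (mfd_topology M)"

definition smooth_fun_on ::
  "('m, 'v::euclidean_space) charted_space \<Rightarrow> 'm set \<Rightarrow> ('m \<Rightarrow> 'b::real_normed_vector) \<Rightarrow> bool" where
  "smooth_fun_on M W f \<longleftrightarrow>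
     (\<forall>c\<in>atlas M. smooth_on (chart_map c ` (W \<inter> chart_dom c)) (f \<circ> chart_inv c))"

definition mfd_deriv ::
  "('m, 'v::euclidean_space) charted_space \<Rightarrow> ('k, 'w::euclidean_space) charted_space \<Rightarrow>
   ('m \<Rightarrow> 'k) \<Rightarrow> 'm \<Rightarrow> 'v \<Rightarrow> 'w" where
  "mfd_deriv M N f p =
     frechet_derivative (chart_map (chart_at N (f p)) \<circ> f \<circ> chart_inv (chart_at M p))
       (at (chart_map (chart_at M p) p))"

definition dfun ::
  "('m, 'v::euclidean_space) charted_space \<Rightarrow> ('m \<Rightarrow> 'b::real_normed_vector) \<Rightarrow> 'm \<Rightarrow> 'v \<Rightarrow> 'b" where
  "dfun M f p = frechet_derivative (f \<circ> chart_inv (chart_at M p)) (at (chart_map (chart_at M p) p))"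


subsection \<open>Vector fields and one-forms\<close>

text \<open>
  \<open>chart_change c c' p\<close> is the Jacobian at \<open>p\<close> of the coordinates of \<open>c'\<close> with respect to those
  of \<open>c\<close>. The functions \<open>tan_coord M c p\<close>, \<open>cot_coord M c p\<close> and \<open>gen_coord M c p\<close> turn an
  element of the tangent space, the cotangent space and their direct sum at \<open>p\<close> into its
  coefficients with respect to the chart \<open>c\<close>.
\<close>

definition chart_change ::
  "('m, 'v::euclidean_space) chart \<Rightarrow> ('m, 'v) chart \<Rightarrow> 'm \<Rightarrow> 'v \<Rightarrow> 'v" where
  "chart_change c c' p = frechet_derivative (chart_map c' \<circ> chart_inv c) (at (chart_map c p))"

definition tan_coord ::
  "('m, 'v::euclidean_space) charted_space \<Rightarrow> ('m, 'v) chart \<Rightarrow> 'm \<Rightarrow> 'v \<Rightarrow> 'v" where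
  "tan_coord M c p = chart_change (chart_at M p) c p"

definition cot_coord ::
  "('m, 'v::euclidean_space) charted_space \<Rightarrow> ('m, 'v) chart \<Rightarrow> 'm \<Rightarrow> 'v \<Rightarrow> 'v" where
  "cot_coord M c p = adjoint (chart_change c (chart_at M p) p)"

definition gen_coord ::
  "('m, 'v::euclidean_space) charted_space \<Rightarrow> ('m, 'v) chart \<Rightarrow> 'm \<Rightarrow> 'v \<times> 'v \<Rightarrow> 'v \<times> 'v" where
  "gen_coord M c p = map_prod (tan_coord M c p) (cot_coord M c p)"

text \<open>
  Smoothness of sections, and of fields of endomorphisms, of a bundle whose fibre coordinates are
  given by \<open>\<kappa>\<close> (one of the three functions above).
\<close>

definition section_rep ::
  "(('m, 'v::euclidean_space) chart \<Rightarrow> 'm \<Rightarrow> 'f \<Rightarrow> 'f) \<Rightarrow> ('m, 'v) chart \<Rightarrow> ('m \<Rightarrow> 'f) \<Rightarrow> 'v \<Rightarrow> 'f" where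
  "section_rep \<kappa> c s x = \<kappa> c (chart_inv c x) (s (chart_inv c x))"

definition smooth_section_on ::
  "('m, 'v::euclidean_space) charted_space \<Rightarrow> (('m, 'v) chart \<Rightarrow> 'm \<Rightarrow> 'f \<Rightarrow> 'f) \<Rightarrow>
   'm set \<Rightarrow> ('m \<Rightarrow> 'f::euclidean_space) \<Rightarrow> bool" where
  "smooth_section_on M \<kappa> W s \<longleftrightarrow>
     (\<forall>c\<in>atlas M. smooth_on (chart_map c ` (W \<inter> chart_dom c)) (section_rep \<kappa> c s))"

definition smooth_endo ::
  "('m, 'v::euclidean_space) charted_space \<Rightarrow> (('m, 'v) chart \<Rightarrow> 'm \<Rightarrow> 'f \<Rightarrow> 'f) \<Rightarrow>
   ('m \<Rightarrow> 'f::euclidean_space \<Rightarrow> 'f) \<Rightarrow> bool" where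
  "smooth_endo M \<kappa> A \<longleftrightarrow>
     (\<forall>c\<in>atlas M. \<forall>w. smooth_on (chart_map c ` chart_dom c)
        (section_rep \<kappa> c (\<lambda>p. A p (inv (\<kappa> c p) w))))"

definition vector_fields :: "('m, 'v::euclidean_space) charted_space \<Rightarrow> ('m \<Rightarrow> 'v) set" where
  "vector_fields M = {X. smooth_section_on M (tan_coord M) UNIV X}"

definition one_forms :: "('m, 'v::euclidean_space) charted_space \<Rightarrow> ('m \<Rightarrow> 'v) set" where
  "one_forms M = {\<xi>. smooth_section_on M (cot_coord M) UNIV \<xi>}"

text \<open>
  In the coordinates of \<open>chart_at M p\<close>, the brackets and Lie derivatives at \<open>p\<close> are
  \<open>[X,Y]\<^sup>k = X\<^sup>j \<partial>\<^sub>j Y\<^sup>k - Y\<^sup>j \<partial>\<^sub>j X\<^sup>k\<close> and \<open>(L\<^sub>X \<eta>)\<^sub>i = X\<^sup>j \<partial>\<^sub>j \<eta>\<^sub>i + \<eta>\<^sub>j \<partial>\<^sub>i X\<^sup>j\<close>.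
\<close>

definition lie_bracket ::
  "('m, 'v::euclidean_space) charted_space \<Rightarrow> ('m \<Rightarrow> 'v) \<Rightarrow> ('m \<Rightarrow> 'v) \<Rightarrow> 'm \<Rightarrow> 'v" where
  "lie_bracket M X Y p =
     (let c = chart_at M p; x = chart_map c p in
        frechet_derivative (section_rep (tan_coord M) c Y) (at x) (X p)
        - frechet_derivative (section_rep (tan_coord M) c X) (at x) (Y p))"

definition lie_deriv_form ::
  "('m, 'v::euclidean_space) charted_space \<Rightarrow> ('m \<Rightarrow> 'v) \<Rightarrow> ('m \<Rightarrow> 'v) \<Rightarrow> 'm \<Rightarrow> 'v" where
  "lie_deriv_form M X \<eta> p =
     (let c = chart_at M p; x = chart_map c p in
        frechet_derivative (section_rep (cot_coord M) c \<eta>) (at x) (X p)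
        + adjoint (frechet_derivative (section_rep (tan_coord M) c X) (at x)) (\<eta> p))"

definition dform :: "('m, 'v::euclidean_space) charted_space \<Rightarrow> ('m \<Rightarrow> real) \<Rightarrow> 'm \<Rightarrow> 'v" where
  "dform M f p = (\<Sum>b\<in>Basis. dfun M f p b *\<^sub>R b)"


subsection \<open>Almost complex structures\<close>

definition almost_complex_structure ::
  "('m, 'v::euclidean_space) charted_space \<Rightarrow> ('m \<Rightarrow> 'v \<Rightarrow> 'v) \<Rightarrow> bool" where
  "almost_complex_structure M J \<longleftrightarrow>
     (\<forall>p. linear (J p) \<and> (\<forall>w. J p (J p w) = - w)) \<and> smooth_endo M (tan_coord M) J"

definition nijenhuis ::
  "('m, 'v::euclidean_space) charted_space \<Rightarrow> ('m \<Rightarrow> 'v \<Rightarrow> 'v) \<Rightarrow>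
   ('m \<Rightarrow> 'v) \<Rightarrow> ('m \<Rightarrow> 'v) \<Rightarrow> 'm \<Rightarrow> 'v" where
  "nijenhuis M J A B p =
     lie_bracket M (\<lambda>q. J q (A q)) (\<lambda>q. J q (B q)) p
     - J p (lie_bracket M (\<lambda>q. J q (A q)) B p)
     - J p (lie_bracket M A (\<lambda>q. J q (B q)) p)
     - lie_bracket M A B p"

definition integrable_almost_complex_structure ::
  "('m, 'v::euclidean_space) charted_space \<Rightarrow> ('m \<Rightarrow> 'v \<Rightarrow> 'v) \<Rightarrow> bool" where
  "integrable_almost_complex_structure M J \<longleftrightarrow>
     almost_complex_structure M J \<and>
     (\<forall>A\<in>vector_fields M. \<forall>B\<in>vector_fields M. \<forall>p. nijenhuis M J A B p = 0)"


subsection \<open>Linear connections\<close>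

definition linear_connection ::
  "('m, 'v::euclidean_space) charted_space \<Rightarrow>
   (('m \<Rightarrow> 'v) \<Rightarrow> ('m \<Rightarrow> 'v) \<Rightarrow> 'm \<Rightarrow> 'v) \<Rightarrow> bool" where
  "linear_connection M D \<longleftrightarrow>
     (\<forall>X\<in>vector_fields M. \<forall>Y\<in>vector_fields M. D X Y \<in> vector_fields M) \<and>
     (\<forall>X\<in>vector_fields M. \<forall>X'\<in>vector_fields M. \<forall>Y\<in>vector_fields M. \<forall>p.
        D (\<lambda>q. X q + X' q) Y p = D X Y p + D X' Y p) \<and>
     (\<forall>X\<in>vector_fields M. \<forall>Y\<in>vector_fields M. \<forall>Y'\<in>vector_fields M. \<forall>p.
        D X (\<lambda>q. Y q + Y' q) p = D X Y p + D X Y' p) \<and>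
     (\<forall>f::'m \<Rightarrow> real. smooth_fun_on M UNIV f \<longrightarrow>
        (\<forall>X\<in>vector_fields M. \<forall>Y\<in>vector_fields M. \<forall>p.
           D (\<lambda>q. f q *\<^sub>R X q) Y p = f p *\<^sub>R D X Y p \<and>
           D X (\<lambda>q. f q *\<^sub>R Y q) p = dfun M f p (X p) *\<^sub>R Y p + f p *\<^sub>R D X Y p))"


section \<open>The cotangent bundle\<close>

text \<open>
  A covector \<open>\<gamma>\<close> at \<open>p\<close> is the pair \<open>(p, \<gamma>)\<close>, and a chart \<open>c\<close> of \<open>M\<close> induces the chart whose fibre
  coordinates are the coefficients of \<open>\<gamma>\<close> with respect to \<open>c\<close>. The topology is the one determined
  by these charts, not the product topology.
\<close>

definition cot_chart ::
  "('m, 'v::euclidean_space) charted_space \<Rightarrow> ('m, 'v) chart \<Rightarrow> ('m \<times> 'v, 'v \<times> 'v) chart" where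
  "cot_chart M c = (chart_dom c \<times> UNIV, \<lambda>(p, \<gamma>). (chart_map c p, cot_coord M c p \<gamma>))"

definition cotangent_bundle ::
  "('m, 'v::euclidean_space) charted_space \<Rightarrow> ('m \<times> 'v, 'v \<times> 'v) charted_space" where
  "cotangent_bundle M =
     \<lparr>atlas = cot_chart M ` atlas M, chart_at = (\<lambda>(p, \<gamma>). cot_chart M (chart_at M p))\<rparr>"

text \<open>
  The connection acts on one-forms by \<open>(D\<^sub>X \<omega>)(Z) = X(\<omega>(Z)) - \<omega>(D\<^sub>X Z)\<close>. A vector tangent to the
  cotangent bundle at \<open>(p, \<gamma>)\<close> is horizontal if it is the image of \<open>X p\<close> under the differential of a
  section \<open>\<omega>\<close> with \<open>\<omega> p = \<gamma>\<close> and \<open>D\<^sub>X \<omega> = 0\<close> at \<open>p\<close>.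
\<close>

definition dual_connection ::
  "('m, 'v::euclidean_space) charted_space \<Rightarrow> (('m \<Rightarrow> 'v) \<Rightarrow> ('m \<Rightarrow> 'v) \<Rightarrow> 'm \<Rightarrow> 'v) \<Rightarrow>
   ('m \<Rightarrow> 'v) \<Rightarrow> ('m \<Rightarrow> 'v) \<Rightarrow> ('m \<Rightarrow> 'v) \<Rightarrow> 'm \<Rightarrow> real" where
  "dual_connection M D X \<omega> Z p = dfun M (\<lambda>q. \<omega> q \<bullet> Z q) p (X p) - \<omega> p \<bullet> D X Z p"

definition horizontal_space ::
  "('m, 'v::euclidean_space) charted_space \<Rightarrow> (('m \<Rightarrow> 'v) \<Rightarrow> ('m \<Rightarrow> 'v) \<Rightarrow> 'm \<Rightarrow> 'v) \<Rightarrow>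
   'm \<times> 'v \<Rightarrow> ('v \<times> 'v) set" where
  "horizontal_space M D u =
     {mfd_deriv M (cotangent_bundle M) (\<lambda>q. (q, \<omega> q)) (fst u) (X (fst u)) | \<omega> X.
        \<omega> \<in> one_forms M \<and> X \<in> vector_fields M \<and> \<omega> (fst u) = snd u \<and>
        (\<forall>Z\<in>vector_fields M. dual_connection M D X \<omega> Z (fst u) = 0)}"

definition horizontal_lift ::
  "('m, 'v::euclidean_space) charted_space \<Rightarrow> (('m \<Rightarrow> 'v) \<Rightarrow> ('m \<Rightarrow> 'v) \<Rightarrow> 'm \<Rightarrow> 'v) \<Rightarrow>
   'm \<times> 'v \<Rightarrow> 'v \<Rightarrow> 'v \<times> 'v" where
  "horizontal_lift M D u X =
     (THE w. w \<in> horizontal_space M D u \<and> mfd_deriv (cotangent_bundle M) M fst u w = X)"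

definition vertical_lift ::
  "('m, 'v::euclidean_space) charted_space \<Rightarrow> 'm \<times> 'v \<Rightarrow> 'v \<Rightarrow> 'v \<times> 'v" where
  "vertical_lift M u \<xi> =
     vector_derivative
       (\<lambda>t. chart_map (chart_at (cotangent_bundle M) u) (fst u, snd u + t *\<^sub>R \<xi>)) (at 0)"

text \<open>
  \<open>gen_lift M D u\<close> is the isomorphism from the fibre of \<open>\<pi>\<^sup>*(TM \<oplus> T\<^sup>*M)\<close> to the tangent space of
  \<open>T\<^sup>*M\<close> at \<open>u\<close>, and \<open>cotangent_acs M J D\<close> is the endomorphism field that it transports \<open>\<pi>\<^sup>*J\<close> to.
\<close>

definition gen_lift ::
  "('m, 'v::euclidean_space) charted_space \<Rightarrow> (('m \<Rightarrow> 'v) \<Rightarrow> ('m \<Rightarrow> 'v) \<Rightarrow> 'm \<Rightarrow> 'v) \<Rightarrow>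
   'm \<times> 'v \<Rightarrow> 'v \<times> 'v \<Rightarrow> 'v \<times> 'v" where
  "gen_lift M D u z = horizontal_lift M D u (fst z) + vertical_lift M u (snd z)"

definition cotangent_acs ::
  "('m, 'v::euclidean_space) charted_space \<Rightarrow> ('m \<Rightarrow> 'v \<times> 'v \<Rightarrow> 'v \<times> 'v) \<Rightarrow>
   (('m \<Rightarrow> 'v) \<Rightarrow> ('m \<Rightarrow> 'v) \<Rightarrow> 'm \<Rightarrow> 'v) \<Rightarrow> 'm \<times> 'v \<Rightarrow> 'v \<times> 'v \<Rightarrow> 'v \<times> 'v" where
  "cotangent_acs M J D u w = gen_lift M D u (J (fst u) (inv (gen_lift M D u) w))"


section \<open>Generalized complex structures\<close>

definition g_can :: "'v::euclidean_space \<times> 'v \<Rightarrow> 'v \<times> 'v \<Rightarrow> real" where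
  "g_can u v = (snd u \<bullet> fst v + snd v \<bullet> fst u) / 2"

definition skew_gen_complex_structure ::
  "('m, 'v::euclidean_space) charted_space \<Rightarrow> ('m \<Rightarrow> 'v \<times> 'v \<Rightarrow> 'v \<times> 'v) \<Rightarrow> bool" where
  "skew_gen_complex_structure M J \<longleftrightarrow>
     (\<forall>p. linear (J p) \<and> (\<forall>u. J p (J p u) = - u) \<and>
          (\<forall>u v. g_can (J p u) v = - g_can u (J p v))) \<and>
     smooth_endo M (gen_coord M) J"

definition courant_bracket ::
  "('m, 'v::euclidean_space) charted_space \<Rightarrow> ('m \<Rightarrow> 'v \<times> 'v) \<Rightarrow> ('m \<Rightarrow> 'v \<times> 'v) \<Rightarrow> 'm \<Rightarrow> 'v \<times> 'v" where
  "courant_bracket M u v p =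
     (let X = (\<lambda>q. fst (u q)); \<xi> = (\<lambda>q. snd (u q)); Y = (\<lambda>q. fst (v q)); \<eta> = (\<lambda>q. snd (v q)) in
        (lie_bracket M X Y p,
         lie_deriv_form M X \<eta> p - lie_deriv_form M Y \<xi> p
         + (1 / 2) *\<^sub>R dform M (\<lambda>q. \<xi> q \<bullet> Y q - \<eta> q \<bullet> X q) p))"


subsection \<open>Complexification\<close>

text \<open>
  For a manifold modelled on \<open>real ^ 'n\<close>, the complexified tangent and cotangent spaces are
  \<open>complex ^ 'n\<close>, and \<open>ceval \<xi> X\<close> is the complex bilinear extension of the evaluation \<open>\<xi>(X)\<close> (no
  conjugation).
\<close>

definition Re_vec :: "complex ^ 'n \<Rightarrow> real ^ 'n" where
  "Re_vec z = (\<chi> i. Re (z $ i))"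

definition Im_vec :: "complex ^ 'n \<Rightarrow> real ^ 'n" where
  "Im_vec z = (\<chi> i. Im (z $ i))"

definition Complex_vec :: "real ^ 'n \<Rightarrow> real ^ 'n \<Rightarrow> complex ^ 'n" where
  "Complex_vec a b = (\<chi> i. Complex (a $ i) (b $ i))"

definition cnj_vec :: "complex ^ 'n \<Rightarrow> complex ^ 'n" where
  "cnj_vec z = (\<chi> i. cnj (z $ i))"

definition ceval :: "complex ^ 'n \<Rightarrow> complex ^ 'n \<Rightarrow> complex" where
  "ceval \<xi> X = (\<Sum>i\<in>UNIV. \<xi> $ i * X $ i)"

definition Re_gen :: "(complex ^ 'n) \<times> (complex ^ 'n) \<Rightarrow> (real ^ 'n) \<times> (real ^ 'n)" where
  "Re_gen = map_prod Re_vec Re_vec"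

definition Im_gen :: "(complex ^ 'n) \<times> (complex ^ 'n) \<Rightarrow> (real ^ 'n) \<times> (real ^ 'n)" where
  "Im_gen = map_prod Im_vec Im_vec"

definition Complex_gen ::
  "(real ^ 'n) \<times> (real ^ 'n) \<Rightarrow> (real ^ 'n) \<times> (real ^ 'n) \<Rightarrow> (complex ^ 'n) \<times> (complex ^ 'n)" where
  "Complex_gen u v = (Complex_vec (fst u) (fst v), Complex_vec (snd u) (snd v))"

text \<open>Complex bilinear extensions of real bilinear operations on vector fields, respectively on
  generalized vector fields.\<close>

definition cbilin_vec ::
  "(('m \<Rightarrow> real ^ 'n) \<Rightarrow> ('m \<Rightarrow> real ^ 'n) \<Rightarrow> 'm \<Rightarrow> real ^ 'n) \<Rightarrow>
   ('m \<Rightarrow> complex ^ 'n) \<Rightarrow> ('m \<Rightarrow> complex ^ 'n) \<Rightarrow> 'm \<Rightarrow> complex ^ 'n" where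
  "cbilin_vec B X Y p =
     Complex_vec (B (Re_vec \<circ> X) (Re_vec \<circ> Y) p - B (Im_vec \<circ> X) (Im_vec \<circ> Y) p)
                 (B (Re_vec \<circ> X) (Im_vec \<circ> Y) p + B (Im_vec \<circ> X) (Re_vec \<circ> Y) p)"

definition cbilin_gen ::
  "(('m \<Rightarrow> (real ^ 'n) \<times> (real ^ 'n)) \<Rightarrow> ('m \<Rightarrow> (real ^ 'n) \<times> (real ^ 'n)) \<Rightarrow> 'm \<Rightarrow> (real ^ 'n) \<times> (real ^ 'n)) \<Rightarrow>
   ('m \<Rightarrow> (complex ^ 'n) \<times> (complex ^ 'n)) \<Rightarrow> ('m \<Rightarrow> (complex ^ 'n) \<times> (complex ^ 'n)) \<Rightarrow>
   'm \<Rightarrow> (complex ^ 'n) \<times> (complex ^ 'n)" where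
  "cbilin_gen B u v p =
     Complex_gen (B (Re_gen \<circ> u) (Re_gen \<circ> v) p - B (Im_gen \<circ> u) (Im_gen \<circ> v) p)
                 (B (Re_gen \<circ> u) (Im_gen \<circ> v) p + B (Im_gen \<circ> u) (Re_gen \<circ> v) p)"

definition cdfun ::
  "('m, real ^ 'n) charted_space \<Rightarrow> ('m \<Rightarrow> complex) \<Rightarrow> 'm \<Rightarrow> complex ^ 'n \<Rightarrow> complex" where
  "cdfun M f p Z = dfun M f p (Re_vec Z) + \<i> * dfun M f p (Im_vec Z)"

abbreviation clie_bracket ::
  "('m, real ^ 'n) charted_space \<Rightarrow> ('m \<Rightarrow> complex ^ 'n) \<Rightarrow> ('m \<Rightarrow> complex ^ 'n) \<Rightarrow> 'm \<Rightarrow> complex ^ 'n"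
  where "clie_bracket M \<equiv> cbilin_vec (lie_bracket M)"

abbreviation ccourant_bracket ::
  "('m, real ^ 'n) charted_space \<Rightarrow> ('m \<Rightarrow> (complex ^ 'n) \<times> (complex ^ 'n)) \<Rightarrow>
   ('m \<Rightarrow> (complex ^ 'n) \<times> (complex ^ 'n)) \<Rightarrow> 'm \<Rightarrow> (complex ^ 'n) \<times> (complex ^ 'n)"
  where "ccourant_bracket M \<equiv> cbilin_gen (courant_bracket M)"

text \<open>
  Torsion and curvature of the complex linear extension of \<open>D\<close>, with the sign convention
  \<open>R\<^sub>X\<^sub>,\<^sub>Y = - D\<^sub>X D\<^sub>Y + D\<^sub>Y D\<^sub>X + D\<^bsub>[X,Y]\<^esub>\<close> for the curvature.
\<close>

definition ctorsion ::
  "('m, real ^ 'n) charted_space \<Rightarrow> (('m \<Rightarrow> real ^ 'n) \<Rightarrow> ('m \<Rightarrow> real ^ 'n) \<Rightarrow> 'm \<Rightarrow> real ^ 'n) \<Rightarrow>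
   ('m \<Rightarrow> complex ^ 'n) \<Rightarrow> ('m \<Rightarrow> complex ^ 'n) \<Rightarrow> 'm \<Rightarrow> complex ^ 'n" where
  "ctorsion M D X Y p = cbilin_vec D X Y p - cbilin_vec D Y X p - clie_bracket M X Y p"

definition ccurvature ::
  "('m, real ^ 'n) charted_space \<Rightarrow> (('m \<Rightarrow> real ^ 'n) \<Rightarrow> ('m \<Rightarrow> real ^ 'n) \<Rightarrow> 'm \<Rightarrow> real ^ 'n) \<Rightarrow>
   ('m \<Rightarrow> complex ^ 'n) \<Rightarrow> ('m \<Rightarrow> complex ^ 'n) \<Rightarrow> ('m \<Rightarrow> complex ^ 'n) \<Rightarrow> 'm \<Rightarrow> complex ^ 'n" where
  "ccurvature M D X Y Z p =
     - cbilin_vec D X (cbilin_vec D Y Z) p + cbilin_vec D Y (cbilin_vec D X Z) p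
     + cbilin_vec D (clie_bracket M X Y) Z p"


subsection \<open>Complex subbundles, their sections and involutivity\<close>

definition csections_on ::
  "('m, real ^ 'n) charted_space \<Rightarrow> 'm set \<Rightarrow> ('m \<Rightarrow> (complex ^ 'n) set) \<Rightarrow> ('m \<Rightarrow> complex ^ 'n) set"
  where
  "csections_on M W E =
     {X. smooth_section_on M (tan_coord M) W (Re_vec \<circ> X) \<and>
         smooth_section_on M (tan_coord M) W (Im_vec \<circ> X) \<and> (\<forall>p\<in>W. X p \<in> E p)}"

abbreviation csections ::
  "('m, real ^ 'n) charted_space \<Rightarrow> ('m \<Rightarrow> (complex ^ 'n) set) \<Rightarrow> ('m \<Rightarrow> complex ^ 'n) set" where
  "csections M E \<equiv> csections_on M UNIV E"

definition cgen_sections ::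
  "('m, real ^ 'n) charted_space \<Rightarrow> ('m \<Rightarrow> ((complex ^ 'n) \<times> (complex ^ 'n)) set) \<Rightarrow>
   ('m \<Rightarrow> (complex ^ 'n) \<times> (complex ^ 'n)) set" where
  "cgen_sections M L =
     {u. smooth_section_on M (gen_coord M) UNIV (Re_gen \<circ> u) \<and>
         smooth_section_on M (gen_coord M) UNIV (Im_gen \<circ> u) \<and> (\<forall>p. u p \<in> L p)}"

text \<open>Here \<open>r\<close> is the rank and \<open>e 0, \<dots>, e (r - 1)\<close> is a smooth local frame.\<close>

definition complex_subbundle ::
  "('m, real ^ 'n) charted_space \<Rightarrow> ('m \<Rightarrow> (complex ^ 'n) set) \<Rightarrow> bool" where
  "complex_subbundle M E \<longleftrightarrow>
     (\<exists>r::nat. \<forall>p. \<exists>W e. openin (mfd_topology M) W \<and> p \<in> W \<and>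
        (\<forall>i<r. e i \<in> csections_on M W (\<lambda>q. UNIV)) \<and>
        (\<forall>q\<in>W. E q = vec.span ((\<lambda>i. e i q) ` {..<r}) \<and> vec.dim (E q) = r))"

definition involutive ::
  "('m, real ^ 'n) charted_space \<Rightarrow> ('m \<Rightarrow> (complex ^ 'n) set) \<Rightarrow> bool" where
  "involutive M E \<longleftrightarrow>
     (\<forall>X\<in>csections M E. \<forall>Y\<in>csections M E. clie_bracket M X Y \<in> csections M E)"

text \<open>Smooth sections of the exterior square of the dual of \<open>E\<close>; the values of \<open>\<alpha> p\<close> outside
  \<open>E p\<close> are irrelevant.\<close>

definition two_form_on_subbundle ::
  "('m, real ^ 'n) charted_space \<Rightarrow> ('m \<Rightarrow> (complex ^ 'n) set) \<Rightarrow>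
   ('m \<Rightarrow> complex ^ 'n \<Rightarrow> complex ^ 'n \<Rightarrow> complex) \<Rightarrow> bool" where
  "two_form_on_subbundle M E \<alpha> \<longleftrightarrow>
     (\<forall>p. \<forall>X\<in>E p. \<forall>Y\<in>E p. \<alpha> p X Y = - \<alpha> p Y X) \<and>
     (\<forall>p. \<forall>X\<in>E p. \<forall>X'\<in>E p. \<forall>Y\<in>E p. \<forall>a b.
        \<alpha> p (a *s X + b *s X') Y = a * \<alpha> p X Y + b * \<alpha> p X' Y) \<and>
     (\<forall>W. openin (mfd_topology M) W \<longrightarrow>
        (\<forall>X\<in>csections_on M W E. \<forall>Y\<in>csections_on M W E.
           smooth_fun_on M W (\<lambda>p. \<alpha> p (X p) (Y p))))"

text \<open>The covariant derivative of \<open>\<alpha>\<close>, for \<open>D\<close> preserving the sections of \<open>E\<close>.\<close>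

definition cov_deriv_two_form ::
  "('m, real ^ 'n) charted_space \<Rightarrow> (('m \<Rightarrow> real ^ 'n) \<Rightarrow> ('m \<Rightarrow> real ^ 'n) \<Rightarrow> 'm \<Rightarrow> real ^ 'n) \<Rightarrow>
   ('m \<Rightarrow> complex ^ 'n \<Rightarrow> complex ^ 'n \<Rightarrow> complex) \<Rightarrow>
   ('m \<Rightarrow> complex ^ 'n) \<Rightarrow> ('m \<Rightarrow> complex ^ 'n) \<Rightarrow> ('m \<Rightarrow> complex ^ 'n) \<Rightarrow> 'm \<Rightarrow> complex" where
  "cov_deriv_two_form M D \<alpha> Z X Y p =
     cdfun M (\<lambda>q. \<alpha> q (X q) (Y q)) p (Z p)
     - \<alpha> p (cbilin_vec D Z X p) (Y p) - \<alpha> p (X p) (cbilin_vec D Z Y p)"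


subsection \<open>The holomorphic bundle\<close>

definition cgen_endo ::
  "((real ^ 'n) \<times> (real ^ 'n) \<Rightarrow> (real ^ 'n) \<times> (real ^ 'n)) \<Rightarrow>
   (complex ^ 'n) \<times> (complex ^ 'n) \<Rightarrow> (complex ^ 'n) \<times> (complex ^ 'n)" where
  "cgen_endo A z = Complex_gen (A (Re_gen z)) (A (Im_gen z))"

definition holomorphic_bundle ::
  "('m \<Rightarrow> (real ^ 'n) \<times> (real ^ 'n) \<Rightarrow> (real ^ 'n) \<times> (real ^ 'n)) \<Rightarrow>
   'm \<Rightarrow> ((complex ^ 'n) \<times> (complex ^ 'n)) set" where
  "holomorphic_bundle J p = {z. cgen_endo (J p) z = (\<i> *s fst z, \<i> *s snd z)}"

definition L_bundle ::
  "('m \<Rightarrow> (complex ^ 'n) set) \<Rightarrow> ('m \<Rightarrow> complex ^ 'n \<Rightarrow> complex ^ 'n \<Rightarrow> complex) \<Rightarrow>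
   'm \<Rightarrow> ((complex ^ 'n) \<times> (complex ^ 'n)) set" where
  "L_bundle E \<alpha> p = {(X, \<xi>). X \<in> E p \<and> (\<forall>Y\<in>E p. ceval \<xi> Y = \<alpha> p X Y)}"

text \<open>
  \<open>J\<close> has holomorphic bundle \<open>L(E, \<alpha>)\<close>. The last condition says that the imaginary part of \<open>\<alpha>\<close> is
  non-degenerate on the real space \<open>\<Delta>\<close> whose complexification is the intersection of \<open>E\<close> with its
  complex conjugate. It and the one on the sum of \<open>E\<close> and its conjugate are consequences of the
  others for a generalized complex structure \<open>J\<close>.
\<close>

definition real_part_space :: "('m \<Rightarrow> (complex ^ 'n) set) \<Rightarrow> 'm \<Rightarrow> (real ^ 'n) set" where
  "real_part_space E p = {X. Complex_vec X 0 \<in> E p}"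

definition has_holomorphic_bundle ::
  "('m, real ^ 'n) charted_space \<Rightarrow>
   ('m \<Rightarrow> (real ^ 'n) \<times> (real ^ 'n) \<Rightarrow> (real ^ 'n) \<times> (real ^ 'n)) \<Rightarrow>
   ('m \<Rightarrow> (complex ^ 'n) set) \<Rightarrow> ('m \<Rightarrow> complex ^ 'n \<Rightarrow> complex ^ 'n \<Rightarrow> complex) \<Rightarrow> bool" where
  "has_holomorphic_bundle M J E \<alpha> \<longleftrightarrow>
     complex_subbundle M E \<and> two_form_on_subbundle M E \<alpha> \<and>
     (\<forall>p. E p = fst ` holomorphic_bundle J p) \<and>
     (\<forall>p. holomorphic_bundle J p = L_bundle E \<alpha> p) \<and>
     (\<forall>p. {X + cnj_vec Y | X Y. X \<in> E p \<and> Y \<in> E p} = UNIV) \<and>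
     (\<forall>p. \<forall>X\<in>real_part_space E p.
        (\<forall>Y\<in>real_part_space E p. Im (\<alpha> p (Complex_vec X 0) (Complex_vec Y 0)) = 0) \<longrightarrow> X = 0)"

definition courant_integrable ::
  "('m, real ^ 'n) charted_space \<Rightarrow>
   ('m \<Rightarrow> (real ^ 'n) \<times> (real ^ 'n) \<Rightarrow> (real ^ 'n) \<times> (real ^ 'n)) \<Rightarrow> bool" where
  "courant_integrable M J \<longleftrightarrow>
     (\<forall>u\<in>cgen_sections M (holomorphic_bundle J). \<forall>v\<in>cgen_sections M (holomorphic_bundle J).
        ccourant_bracket M u v \<in> cgen_sections M (holomorphic_bundle J))"

end

(*
  In the coordinates of a chart with Christoffel symbols, the isomorphism from the pull-back of
  TM + T*M to T(T*M) is (v, xi) |-> (v, xi + Gamma(v, _)^T y), so the bracket of two lifted sections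
  (X, xi), (Y, eta) is the lift of ([X,Y], D_X eta - D_Y xi - R_{X,Y}^T y) at the covector y. Since the
  Nijenhuis tensor is tensorial, J^{J,D} is integrable iff this bracket preserves the sections of L,
  for all y. Every point of L extends to a global section Complex_gen (J a) a, and alpha(V, Z) is
  minus the evaluation on V of the covector paired with Z, so neither local frames of E nor
  derivatives of alpha are needed. For sections (X, xi), (Y, eta), (Z, zeta) of L both this condition
  (by R_{E,E} E = 0 and the torsion hypothesis) and the closedness of L under the Courant bracket then
  become the vanishing of
    X(eta(Z)) - Y(xi(Z)) + Z(xi(Y)) + zeta([X,Y]) + eta([Z,X]) + xi([Y,Z]).
*)
theory Submission
  imports Defs
begin

section \<open>Calculus of smooth maps\<close>

text \<open>All hypotheses and both integrability conditions speak of global sections, and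
  \<open>D\<close> is merely an operator on global vector fields. Cut-off functions are therefore
  the bridge to coordinates: they produce the Christoffel symbols, the one-forms that realise
  horizontal vectors, and a global generalized field with any prescribed value at a point. The
  preferred charts may jump from point to point, so an object defined through
  \<open>chart_at\<close> has to be recomputed in a fixed chart before its smoothness can be
  discussed; second derivatives of the transition maps then appear and must cancel. The two brackets
  have the same vector part [X,Y] but in general different covector parts. Only the pairings with E
  count: L is its own annihilator under the metric, so a bracket with vector part in E lies in L as
  soon as it is orthogonal to all sections of L. On E the covector parts agree by the torsion
  hypothesis, because D_Z X and D_Z Y cancel between D_Z \<alpha> and the torsion terms and leave
  D_X Z and D_Y Z, the connection terms of the lifted bracket.\<close>

abbreviation fderiv :: "('a::real_normed_vector \<Rightarrow> 'b::real_normed_vector) \<Rightarrow> 'a \<Rightarrow> 'a \<Rightarrow> 'b" where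
  "fderiv f x \<equiv> frechet_derivative f (at x)"

lemmas has_derivative_local = has_derivative_transform_within_open

lemma fderiv_cong_open:
  assumes "open S" "x \<in> S" "\<And>y. y \<in> S \<Longrightarrow> f y = g y"
  shows "fderiv f x = fderiv g x"
    and "f differentiable (at x) \<longleftrightarrow> g differentiable (at x)"
proof -
  have "(f has_derivative f') (at x) \<longleftrightarrow> (g has_derivative f') (at x)" for f'
    using assms has_derivative_local[of f f' x UNIV S g]
      has_derivative_local[of g f' x UNIV S f] by auto
  then show "fderiv f x = fderiv g x"
    and "f differentiable (at x) \<longleftrightarrow> g differentiable (at x)"
    by (auto simp: frechet_derivative_def differentiable_def)
qed

lemma fderiv_eqI:
  "(f has_derivative f') (at x) \<Longrightarrow> fderiv f x = f'"
  by (metis frechet_derivative_at)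

section \<open>Closure properties of maps of class C^k\<close>

lemma Ck_on_cong:
  assumes "open S" "\<And>x. x \<in> S \<Longrightarrow> f x = g x" "Ck_on k S f"
  shows "Ck_on k S g"
  using assms(2,3)
proof (induction k arbitrary: f g)
  case 0
  then show ?case by (simp cong: continuous_on_cong)
next
  case (Suc k)
  have eq: "fderiv f x = fderiv g x" if "x \<in> S" for x
    by (rule fderiv_cong_open[OF assms(1) that Suc.prems(1)])
  have "g differentiable (at x)" if "x \<in> S" for x
    using fderiv_cong_open(2)[OF assms(1) that, of f g] Suc.prems that by auto
  moreover have "Ck_on k S (\<lambda>x. fderiv g x v)" for v
    by (rule Suc.IH[of "\<lambda>x. fderiv f x v"]) (use Suc.prems(2) eq in auto)
  ultimately show ?case by simp
qed

lemma Ck_on_subset: "Ck_on k S f \<Longrightarrow> T \<subseteq> S \<Longrightarrow> Ck_on k T f"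
  by (induction k arbitrary: f) (auto intro: continuous_on_subset)

lemma Ck_on_imp_lower: "Ck_on (Suc k) S f \<Longrightarrow> Ck_on k S f"
proof (induction k arbitrary: f)
  case 0
  then show ?case
    by (auto simp: continuous_on_eq_continuous_within
        intro!: differentiable_imp_continuous_within[THEN continuous_within_subset])
next
  case (Suc k)
  then show ?case by (metis Ck_on.simps(2))
qed

lemma Ck_on_const: "Ck_on k S (\<lambda>x. c)"
  by (induction k arbitrary: c) (simp_all add: frechet_derivative_const)

lemma Ck_on_bounded_linear:
  assumes "bounded_linear h" "open S" "Ck_on k S f"
  shows "Ck_on k S (\<lambda>x. h (f x))"
  using assms(3)
proof (induction k arbitrary: f)
  case 0
  then show ?case using assms(1) by (simp add: bounded_linear.continuous_on)
next
  case (Suc k)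
  have der: "((\<lambda>x. h (f x)) has_derivative (\<lambda>v. h (fderiv f x v))) (at x)"
    if "x \<in> S" for x
    using Suc.prems that
    by (intro bounded_linear.has_derivative[OF assms(1)]) (simp add: frechet_derivative_works)
  have "Ck_on k S (\<lambda>x. fderiv (\<lambda>x. h (f x)) x v)" for v
    by (rule Ck_on_cong[OF assms(2), of "\<lambda>x. h (fderiv f x v)"])
      (use Suc in \<open>auto simp: fderiv_eqI[OF der]\<close>)
  then show ?case using der by (auto simp: differentiable_def)
qed

lemma Ck_on_add:
  assumes "open S" "Ck_on k S f" "Ck_on k S g"
  shows "Ck_on k S (\<lambda>x. f x + g x)"
  using assms(2,3)
proof (induction k arbitrary: f g)
  case 0
  then show ?case by (simp add: continuous_on_add)
next
  case (Suc k)
  have der: "((\<lambda>x. f x + g x) has_derivative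
      (\<lambda>v. fderiv f x v + fderiv g x v)) (at x)"
    if "x \<in> S" for x
    using Suc.prems that by (intro has_derivative_add) (simp_all add: frechet_derivative_works)
  have "Ck_on k S (\<lambda>x. fderiv (\<lambda>x. f x + g x) x v)" for v
    by (rule Ck_on_cong[OF assms(1),
          of "\<lambda>x. fderiv f x v + fderiv g x v"])
      (use Suc in \<open>auto simp: fderiv_eqI[OF der]\<close>)
  then show ?case using der by (auto simp: differentiable_def)
qed

lemma Ck_on_bilinear:
  assumes "bounded_bilinear prd" "open S" "Ck_on k S f" "Ck_on k S g"
  shows "Ck_on k S (\<lambda>x. prd (f x) (g x))"
  using assms(3,4)
proof (induction k arbitrary: f g)
  case 0
  then show ?case using assms(1) by (simp add: bounded_bilinear.continuous_on)
next
  case (Suc k)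
  have der: "((\<lambda>x. prd (f x) (g x)) has_derivative (\<lambda>v. prd (f x) (fderiv g x v)
       + prd (fderiv f x v) (g x))) (at x)" if "x \<in> S" for x
    using Suc.prems that
    by (intro bounded_bilinear.FDERIV[OF assms(1)]) (simp_all add: frechet_derivative_works)
  have "Ck_on k S (\<lambda>x. fderiv (\<lambda>x. prd (f x) (g x)) x v)" for v
  proof (rule Ck_on_cong[OF assms(2)])
    show "Ck_on k S (\<lambda>x. prd (f x) (fderiv g x v)
       + prd (fderiv f x v) (g x))"
      by (intro Ck_on_add assms(2) Suc.IH)
        (use Suc.prems Ck_on_imp_lower in auto)
  qed (simp add: fderiv_eqI[OF der])
  then show ?case using der by (auto simp: differentiable_def)
qed

lemma Ck_on_sum:
  assumes "open S" "\<And>i. i \<in> I \<Longrightarrow> Ck_on k S (f i)"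
  shows "Ck_on k S (\<lambda>x. \<Sum>i\<in>I. f i x)"
  using assms(2)
  by (induction I rule: infinite_finite_induct) (auto intro: Ck_on_const Ck_on_add[OF assms(1)])

lemma linear_eq_sum_Basis:
  fixes A :: "'a::euclidean_space \<Rightarrow> 'b::real_vector"
  assumes "linear A"
  shows "A v = (\<Sum>b\<in>Basis. (v \<bullet> b) *\<^sub>R A b)"
proof -
  have "A v = A (\<Sum>b\<in>Basis. (v \<bullet> b) *\<^sub>R b)" by (simp add: euclidean_representation)
  also have "\<dots> = (\<Sum>b\<in>Basis. (v \<bullet> b) *\<^sub>R A b)"
    using assms by (simp add: linear_sum linear_scale)
  finally show ?thesis .
qed

text \<open>The chain rule produces \<open>?g' (f x) (?f' x v)\<close>, whose direction moves with
  x. Expanding the direction in \<open>Basis\<close> leaves products of the scalars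
  \<open>?f' x v \<bullet> b\<close> with derivatives of g in fixed directions b composed with f,
  and these are within reach of the induction hypothesis.\<close>

lemma Ck_on_compose:
  fixes f :: "'a::euclidean_space \<Rightarrow> 'b::euclidean_space" and g :: "'b \<Rightarrow> 'c::real_normed_vector"
  assumes "open S" "open T" "f ` S \<subseteq> T" "Ck_on k S f" "Ck_on k T g"
  shows "Ck_on k S (\<lambda>x. g (f x))"
  using assms(4,5)
proof (induction k arbitrary: g)
  case 0
  then show ?case using assms(3) by (simp add: continuous_on_compose2)
next
  case (Suc k)
  let ?f' = "\<lambda>x v. fderiv f x v" and ?g' = "\<lambda>x v. fderiv g x v"
  have der: "((\<lambda>x. g (f x)) has_derivative (\<lambda>v. ?g' (f x) (?f' x v))) (at x)" if "x \<in> S" for x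
  proof (rule has_derivative_compose[of f])
    show "(f has_derivative ?f' x) (at x)" "(g has_derivative ?g' (f x)) (at (f x))"
      using Suc.prems that assms(3) by (auto simp: frechet_derivative_works[symmetric])
  qed
  have "Ck_on k S (\<lambda>x. fderiv (\<lambda>x. g (f x)) x v)" for v
  proof (rule Ck_on_cong[OF assms(1)])
    show "Ck_on k S (\<lambda>x. \<Sum>b\<in>Basis. (?f' x v \<bullet> b) *\<^sub>R ?g' (f x) b)"
      by (intro Ck_on_sum assms(1) Ck_on_bilinear[OF bounded_bilinear_scaleR]
          Ck_on_bounded_linear[OF bounded_linear_inner_left] Suc.IH)
        (use Suc.prems Ck_on_imp_lower in auto)
    show "(\<Sum>b\<in>Basis. (?f' x v \<bullet> b) *\<^sub>R ?g' (f x) b) = fderiv (\<lambda>x. g (f x)) x v"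
      if "x \<in> S" for x
    proof -
      have "linear (?g' (f x))"
        using Suc.prems that assms(3) by (intro linear_frechet_derivative) auto
      from linear_eq_sum_Basis[OF this, of "?f' x v"] show ?thesis
        by (simp add: fderiv_eqI[OF der[OF that]])
    qed
  qed
  then show ?case using der by (auto simp: differentiable_def)
qed

text \<open>Derivatives are taken with \<open>at x\<close> and hence do not depend on the
  neighbourhood, so the iterated derivatives are already global functions and only their continuity
  is glued.\<close>

lemma Ck_on_local:
  assumes "\<And>x. x \<in> S \<Longrightarrow> \<exists>U. open U \<and> x \<in> U \<and> Ck_on k U f"
  shows "Ck_on k S f"
  using assms
proof (induction k arbitrary: f)
  case 0
  have "continuous (at x within S) f" if x: "x \<in> S" for x
  proof -
    obtain U where "open U" "x \<in> U" "continuous_on U f" using 0 x by auto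
    then show ?thesis
      using continuous_on_eq_continuous_at continuous_at_imp_continuous_at_within by blast
  qed
  then show ?case by (simp add: continuous_on_eq_continuous_within)
next
  case (Suc k)
  have "Ck_on k S (\<lambda>x. fderiv f x v)" for v
    by (rule Suc.IH) (metis Suc.prems Ck_on.simps(2))
  moreover have "\<forall>x\<in>S. f differentiable (at x)" by (metis Suc.prems Ck_on.simps(2))
  ultimately show ?case by simp
qed

section \<open>Smooth maps and smooth fields of linear maps\<close>

lemma smooth_on_cong:
  "open S \<Longrightarrow> smooth_on S f \<Longrightarrow> (\<And>x. x \<in> S \<Longrightarrow> f x = g x) \<Longrightarrow> smooth_on S g"
  unfolding smooth_on_def using Ck_on_cong by blast

lemma smooth_on_subset: "smooth_on S f \<Longrightarrow> T \<subseteq> S \<Longrightarrow> smooth_on T f"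
  unfolding smooth_on_def using Ck_on_subset by blast

lemma smooth_on_const: "smooth_on S (\<lambda>x. c)"
  unfolding smooth_on_def using Ck_on_const by blast

lemma smooth_on_bounded_linear:
  "bounded_linear h \<Longrightarrow> open S \<Longrightarrow> smooth_on S f \<Longrightarrow> smooth_on S (\<lambda>x. h (f x))"
  unfolding smooth_on_def using Ck_on_bounded_linear by blast

lemma smooth_on_add:
  "open S \<Longrightarrow> smooth_on S f \<Longrightarrow> smooth_on S g \<Longrightarrow> smooth_on S (\<lambda>x. f x + g x)"
  unfolding smooth_on_def using Ck_on_add by blast

lemma smooth_on_minus: "open S \<Longrightarrow> smooth_on S f \<Longrightarrow> smooth_on S (\<lambda>x. - f x)"
  by (rule smooth_on_bounded_linear[OF bounded_linear_minus[OF bounded_linear_ident]])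

lemma smooth_on_diff:
  "open S \<Longrightarrow> smooth_on S f \<Longrightarrow> smooth_on S g \<Longrightarrow> smooth_on S (\<lambda>x. f x - g x)"
  using smooth_on_add[of S f "\<lambda>x. - g x"] by (simp add: smooth_on_minus)

lemma smooth_on_bilinear:
  "bounded_bilinear prd \<Longrightarrow> open S \<Longrightarrow> smooth_on S f \<Longrightarrow> smooth_on S g \<Longrightarrow>
   smooth_on S (\<lambda>x. prd (f x) (g x))"
  unfolding smooth_on_def using Ck_on_bilinear by blast

lemmas smooth_on_scaleR = smooth_on_bilinear[OF bounded_bilinear_scaleR]
lemmas smooth_on_inner = smooth_on_bilinear[OF bounded_bilinear_inner]
lemmas smooth_on_mult = smooth_on_bilinear[OF bounded_bilinear_mult]

lemma smooth_on_sum: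
  "open S \<Longrightarrow> (\<And>i. i \<in> I \<Longrightarrow> smooth_on S (f i)) \<Longrightarrow> smooth_on S (\<lambda>x. \<Sum>i\<in>I. f i x)"
  unfolding smooth_on_def by (metis Ck_on_sum)

lemma smooth_on_compose:
  fixes f :: "'a::euclidean_space \<Rightarrow> 'b::euclidean_space"
  shows "open S \<Longrightarrow> open T \<Longrightarrow> f ` S \<subseteq> T \<Longrightarrow> smooth_on S f \<Longrightarrow> smooth_on T g \<Longrightarrow>
    smooth_on S (\<lambda>x. g (f x))"
  unfolding smooth_on_def using Ck_on_compose by blast

lemma smooth_on_local:
  "(\<And>x. x \<in> S \<Longrightarrow> \<exists>U. open U \<and> x \<in> U \<and> smooth_on U f) \<Longrightarrow> smooth_on S f"
  unfolding smooth_on_def using Ck_on_local by (metis (no_types, lifting))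

lemma smooth_on_ident: "smooth_on S (\<lambda>x. x)"
proof -
  have "Ck_on k S (\<lambda>x. x)" for k
    by (cases k) (simp_all add: frechet_derivative_ident Ck_on_const)
  then show ?thesis by (simp add: smooth_on_def)
qed

lemma smooth_on_differentiable: "smooth_on S f \<Longrightarrow> x \<in> S \<Longrightarrow> f differentiable (at x)"
  unfolding smooth_on_def by (metis Ck_on.simps(2))

lemma smooth_on_fderiv_at:
  "smooth_on S f \<Longrightarrow> x \<in> S \<Longrightarrow> (f has_derivative fderiv f x) (at x)"
  by (simp add: smooth_on_differentiable flip: frechet_derivative_works)

lemma smooth_on_fderiv:
  "smooth_on S f \<Longrightarrow> smooth_on S (\<lambda>x. fderiv f x v)"
  unfolding smooth_on_def by (metis Ck_on.simps(2))

text \<open>Smoothness in x for each fixed argument is enough: by linearity \<open>A x (v x)\<close>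
  is a finite sum over \<open>Basis\<close> of smooth coefficients times
  \<open>A x b\<close>.\<close>

lemma smooth_on_linear_apply:
  fixes A :: "'a::euclidean_space \<Rightarrow> 'b::euclidean_space \<Rightarrow> 'c::real_normed_vector"
  assumes "open S" "\<And>b. smooth_on S (\<lambda>x. A x b)" "\<And>x. x \<in> S \<Longrightarrow> linear (A x)" "smooth_on S v"
  shows "smooth_on S (\<lambda>x. A x (v x))"
proof (rule smooth_on_cong[OF assms(1)])
  show "smooth_on S (\<lambda>x. \<Sum>b\<in>Basis. (v x \<bullet> b) *\<^sub>R A x b)"
    by (intro smooth_on_sum smooth_on_scaleR smooth_on_inner assms smooth_on_const)
qed (use assms(3) linear_eq_sum_Basis in \<open>auto simp flip: linear_eq_sum_Basis\<close>)

lemma has_derivative_linear_apply: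
  fixes A :: "'a::euclidean_space \<Rightarrow> 'b::euclidean_space \<Rightarrow> 'c::real_normed_vector"
  assumes S: "open S" "x \<in> S" and lin: "\<And>z. z \<in> S \<Longrightarrow> linear (A z)"
    and A: "\<And>b. (\<lambda>z. A z b) differentiable (at x)" and v: "(v has_derivative v') (at x)"
  shows "((\<lambda>z. A z (v z)) has_derivative
    (\<lambda>h. fderiv (\<lambda>z. A z (v x)) x h + A x (v' h))) (at x)"
proof -
  let ?A' = "\<lambda>b. fderiv (\<lambda>z. A z b) x"
  have A': "((\<lambda>z. A z b) has_derivative ?A' b) (at x)" for b
    using A frechet_derivative_works by blast
  have "((\<lambda>z. \<Sum>b\<in>Basis. (w z \<bullet> b) *\<^sub>R A z b) has_derivative
      (\<lambda>h. \<Sum>b\<in>Basis. (w x \<bullet> b) *\<^sub>R ?A' b h + (w' h \<bullet> b) *\<^sub>R A x b)) (at x)"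
    if "(w has_derivative w') (at x)" for w w'
    using that by (auto intro!: derivative_eq_intros A')
  then have der: "((\<lambda>z. A z (w z)) has_derivative
      (\<lambda>h. (\<Sum>b\<in>Basis. (w x \<bullet> b) *\<^sub>R ?A' b h) + A x (w' h))) (at x)"
    if w: "(w has_derivative w') (at x)" for w w'
  proof (rule has_derivative_local[OF has_derivative_eq_rhs S])
    show "(\<Sum>b\<in>Basis. (w z \<bullet> b) *\<^sub>R A z b) = A z (w z)" if "z \<in> S" for z
      using linear_eq_sum_Basis[OF lin[OF that], of "w z"] by simp
    show "(\<lambda>h. \<Sum>b\<in>Basis. (w x \<bullet> b) *\<^sub>R ?A' b h + (w' h \<bullet> b) *\<^sub>R A x b)
      = (\<lambda>h. (\<Sum>b\<in>Basis. (w x \<bullet> b) *\<^sub>R ?A' b h) + A x (w' h))"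
      by (subst (2) linear_eq_sum_Basis[OF lin[OF S(2)]]) (simp add: sum.distrib)
  qed (use w in blast)
  have "A x 0 = 0" using lin S(2) by (simp add: linear_0)
  then have "?A' (v x) = (\<lambda>h. \<Sum>b\<in>Basis. (v x \<bullet> b) *\<^sub>R ?A' b h)"
    using fderiv_eqI[OF der[OF has_derivative_const[of "v x"]]] by simp
  with der[OF v] show ?thesis by simp
qed

lemma smooth_on_fderiv_apply:
  fixes f :: "'a::euclidean_space \<Rightarrow> 'b::real_normed_vector"
  assumes "open S" "smooth_on S f" "smooth_on S v"
  shows "smooth_on S (\<lambda>x. fderiv f x (v x))"
proof (rule smooth_on_linear_apply[OF assms(1) _ _ assms(3)])
  show "linear (fderiv f x)" if "x \<in> S" for x
    using smooth_on_differentiable[OF assms(2) that] by (rule linear_frechet_derivative)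
qed (rule smooth_on_fderiv[OF assms(2)])

lemma linear_inv_bij:
  assumes "linear f" "bij f"
  shows "linear (inv f)"
proof (rule linearI)
  have f: "f (inv f x) = x" for x using assms(2) by (simp add: bij_is_surj surj_f_inv_f)
  have "inv f x = y \<longleftrightarrow> x = f y" for x y using assms(2) by (metis bij_inv_eq_iff)
  then show "inv f (x + y) = inv f x + inv f y" "inv f (r *\<^sub>R x) = r *\<^sub>R inv f x" for x y r
    using assms(1) by (simp_all add: linear_add linear_scale f)
qed

lemma adjoint_inner:
  fixes f :: "'a::euclidean_space \<Rightarrow> 'b::euclidean_space"
  assumes "linear f"
  shows "adjoint f y \<bullet> x = y \<bullet> f x"
  using adjoint_works[OF assms, of x y] by (simp add: inner_commute)

lemma sum_scaleR_Basis_inner: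
  fixes w :: "'a::euclidean_space"
  shows "(\<Sum>b\<in>Basis. g b *\<^sub>R b) \<bullet> w = (\<Sum>b\<in>Basis. (w \<bullet> b) * g b)"
  by (simp add: inner_sum_left inner_commute[of w] mult.commute)

lemma adjoint_eq_sum_Basis:
  fixes A :: "'a::euclidean_space \<Rightarrow> 'b::euclidean_space"
  assumes "linear A"
  shows "adjoint A y = (\<Sum>b\<in>Basis. (y \<bullet> A b) *\<^sub>R b)"
proof -
  have "adjoint A y = (\<Sum>b\<in>Basis. (adjoint A y \<bullet> b) *\<^sub>R b)"
    by (simp add: euclidean_representation)
  then show ?thesis by (simp add: adjoint_inner[OF assms])
qed

lemma smooth_on_adjoint_apply:
  fixes A :: "'a::euclidean_space \<Rightarrow> 'b::euclidean_space \<Rightarrow> 'c::euclidean_space"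
  assumes "open S" "\<And>b. smooth_on S (\<lambda>x. A x b)" "\<And>x. x \<in> S \<Longrightarrow> linear (A x)" "smooth_on S y"
  shows "smooth_on S (\<lambda>x. adjoint (A x) (y x))"
proof (rule smooth_on_cong[OF assms(1)])
  show "smooth_on S (\<lambda>x. \<Sum>b\<in>Basis. (y x \<bullet> A x b) *\<^sub>R b)"
    by (intro smooth_on_sum smooth_on_scaleR smooth_on_inner assms smooth_on_const)
qed (simp add: assms(3) adjoint_eq_sum_Basis)

lemma smooth_on_Pair:
  fixes f :: "'a::euclidean_space \<Rightarrow> 'b::real_normed_vector" and g :: "'a \<Rightarrow> 'c::real_normed_vector"
  assumes "open S" "smooth_on S f" "smooth_on S g"
  shows "smooth_on S (\<lambda>x. (f x, g x))"
proof -
  have "smooth_on S (\<lambda>x. (f x, 0::'c) + (0::'b, g x))"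
    by (intro smooth_on_add assms smooth_on_bounded_linear[of "\<lambda>z. (z, 0)"]
        smooth_on_bounded_linear[of "\<lambda>z. (0, z)"] bounded_linear_Pair
        bounded_linear_ident bounded_linear_zero)
  then show ?thesis by simp
qed

lemma smooth_on_fst: "open S \<Longrightarrow> smooth_on S f \<Longrightarrow> smooth_on S (\<lambda>x. fst (f x))"
  by (rule smooth_on_bounded_linear[OF bounded_linear_fst])

lemma smooth_on_snd: "open S \<Longrightarrow> smooth_on S f \<Longrightarrow> smooth_on S (\<lambda>x. snd (f x))"
  by (rule smooth_on_bounded_linear[OF bounded_linear_snd])

text \<open>The derivative of the reciprocal is again a product of reciprocals, so on the punctured
  line each order of differentiability follows from the previous one by the product rule.\<close>

lemma smooth_on_inverse:
  fixes f :: "'a::euclidean_space \<Rightarrow> real"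
  assumes "open S" "smooth_on S f" "\<And>x. x \<in> S \<Longrightarrow> f x \<noteq> 0"
  shows "smooth_on S (\<lambda>x. inverse (f x))"
proof -
  let ?T = "- {0::real}"
  have T: "open ?T" by (simp add: open_Compl)
  have "Ck_on k ?T inverse" for k
  proof (induction k)
    case 0
    show ?case by (auto intro!: continuous_intros)
  next
    case (Suc k)
    have der: "(inverse has_derivative (\<lambda>v. - (inverse x * v * inverse x))) (at x)"
      if "x \<in> ?T" for x :: real
      using that by (auto intro!: derivative_eq_intros)
    have "Ck_on k ?T (\<lambda>x. fderiv inverse x v)" for v :: real
    proof (rule Ck_on_cong[OF T])
      show "Ck_on k ?T (\<lambda>x. (- v) *\<^sub>R (inverse x * inverse x))"
        by (intro Ck_on_bilinear[OF bounded_bilinear_scaleR] Ck_on_const T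
            Ck_on_bilinear[OF bounded_bilinear_mult] Suc.IH)
    qed (simp add: fderiv_eqI[OF der])
    then show ?case using der by (auto simp: differentiable_def)
  qed
  then have "smooth_on ?T inverse" by (simp add: smooth_on_def)
  moreover have "f ` S \<subseteq> ?T" using assms(3) by auto
  ultimately show ?thesis using smooth_on_compose[OF assms(1) T _ assms(2)] by blast
qed


subsection \<open>Symmetry of second derivatives\<close>

text \<open>The mean value theorem is used twice: along v for the difference \<open>g\<close> of f
  in direction w, then along w for the derivative \<open>k\<close> of f in direction v.\<close>

lemma second_difference_mean_value:
  fixes f :: "'a::euclidean_space \<Rightarrow> real"
  assumes S: "open S" and f: "smooth_on S f" and h: "0 < h"
    and cub: "\<And>s t. 0 \<le> s \<Longrightarrow> s \<le> h \<Longrightarrow> 0 \<le> t \<Longrightarrow> t \<le> h \<Longrightarrow> x + s *\<^sub>R v + t *\<^sub>R w \<in> S"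
  obtains s t where "0 < s" "s < h" "0 < t" "t < h"
    "f (x + h *\<^sub>R v + h *\<^sub>R w) - f (x + h *\<^sub>R v) - f (x + h *\<^sub>R w) + f x
     = h * h * fderiv (\<lambda>x. fderiv f x v) (x + s *\<^sub>R v + t *\<^sub>R w) w"
proof -
  let ?D = "\<lambda>x. fderiv f x v"
  have Dsm: "smooth_on S ?D" using f by (rule smooth_on_fderiv)
  define g where "g s = f (x + s *\<^sub>R v + h *\<^sub>R w) - f (x + s *\<^sub>R v)" for s
  have g': "(g has_real_derivative ?D (x + s *\<^sub>R v + h *\<^sub>R w) - ?D (x + s *\<^sub>R v)) (at s)"
    if "0 \<le> s" "s \<le> h" for s
  proof -
    have in1: "x + s *\<^sub>R v + h *\<^sub>R w \<in> S" "x + s *\<^sub>R v \<in> S"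
      using cub[of s h] cub[of s 0] that h by auto
    note d = smooth_on_fderiv_at[OF f in1(1)] smooth_on_fderiv_at[OF f in1(2)]
    have 1: "((\<lambda>s. f (x + s *\<^sub>R v + h *\<^sub>R w)) has_derivative
        (\<lambda>k. fderiv f (x + s *\<^sub>R v + h *\<^sub>R w) (k *\<^sub>R v))) (at s)"
      by (rule has_derivative_compose[of "\<lambda>s. x + s *\<^sub>R v + h *\<^sub>R w" "\<lambda>k. k *\<^sub>R v" s UNIV f, OF _ d(1)]) (auto intro!: derivative_eq_intros)
    have 2: "((\<lambda>s. f (x + s *\<^sub>R v)) has_derivative
        (\<lambda>k. fderiv f (x + s *\<^sub>R v) (k *\<^sub>R v))) (at s)"
      by (rule has_derivative_compose[of "\<lambda>s. x + s *\<^sub>R v" "\<lambda>k. k *\<^sub>R v" s UNIV f, OF _ d(2)]) (auto intro!: derivative_eq_intros)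
    have lin: "linear (fderiv f y)" if "y \<in> S" for y
      using f that smooth_on_differentiable linear_frechet_derivative by blast
    show ?thesis unfolding has_field_derivative_def g_def
      by (rule has_derivative_eq_rhs[OF has_derivative_diff[OF 1 2]])
        (auto simp: fun_eq_iff linear_scale[OF lin[OF in1(1)]] linear_scale[OF lin[OF in1(2)]]
          right_diff_distrib mult.commute)
  qed
  obtain s where s: "0 < s" "s < h"
    "g h - g 0 = (h - 0) * (?D (x + s *\<^sub>R v + h *\<^sub>R w) - ?D (x + s *\<^sub>R v))"
    using MVT2[of 0 h g "\<lambda>s. ?D (x + s *\<^sub>R v + h *\<^sub>R w) - ?D (x + s *\<^sub>R v)"] h g' by auto
  define k where "k t = ?D (x + s *\<^sub>R v + t *\<^sub>R w)" for t
  have k': "(k has_real_derivative fderiv ?D (x + s *\<^sub>R v + t *\<^sub>R w) w) (at t)"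
    if "0 \<le> t" "t \<le> h" for t
  proof -
    have in1: "x + s *\<^sub>R v + t *\<^sub>R w \<in> S" using cub[of s t] that s by auto
    have 1: "(k has_derivative
        (\<lambda>r. fderiv ?D (x + s *\<^sub>R v + t *\<^sub>R w) (r *\<^sub>R w))) (at t)"
      unfolding k_def
      by (rule has_derivative_compose[of "\<lambda>t. x + s *\<^sub>R v + t *\<^sub>R w" "\<lambda>r. r *\<^sub>R w" t UNIV ?D,
          OF _ smooth_on_fderiv_at[OF Dsm in1]])
        (auto intro!: derivative_eq_intros)
    have lin: "linear (fderiv ?D (x + s *\<^sub>R v + t *\<^sub>R w))"
      using Dsm in1 smooth_on_differentiable linear_frechet_derivative by blast
    show ?thesis using 1 unfolding has_field_derivative_def
      by (simp add: linear_scale[OF lin] mult_commute_abs)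
  qed
  obtain t where t: "0 < t" "t < h"
    "k h - k 0 = (h - 0) * fderiv ?D (x + s *\<^sub>R v + t *\<^sub>R w) w"
    using MVT2[of 0 h k "\<lambda>t. fderiv ?D (x + s *\<^sub>R v + t *\<^sub>R w) w"] h k' by auto
  have "g h - g 0 = h * (h * fderiv ?D (x + s *\<^sub>R v + t *\<^sub>R w) w)"
    using s(3) t(3) by (simp add: k_def)
  then show thesis using that[of s t] s t by (simp add: g_def algebra_simps)
qed

text \<open>The second difference over a parallelogram is unchanged when v and w are exchanged. It
  equals h^2 times either mixed derivative at some point of the parallelogram, and both mixed
  derivatives are continuous at x.\<close>

lemma real_second_derivative_symmetric:
  fixes f :: "'a::euclidean_space \<Rightarrow> real"
  assumes S: "open S" and f: "smooth_on S f" and x: "x \<in> S"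
  shows "fderiv (\<lambda>x. fderiv f x v) x w
    = fderiv (\<lambda>x. fderiv f x w) x v" (is "?A x = ?B x")
proof -
  have cA: "isCont ?A x" and cB: "isCont ?B x"
    using smooth_on_fderiv[OF smooth_on_fderiv[OF f]] x
    by (meson differentiable_imp_continuous_within smooth_on_differentiable)+
  have "\<bar>?A x - ?B x\<bar> \<le> e" if e: "0 < e" for e
  proof -
    have "\<forall>\<^sub>F y in nhds x. y \<in> S \<and> \<bar>?A y - ?A x\<bar> < e / 2 \<and> \<bar>?B y - ?B x\<bar> < e / 2"
    proof (intro eventually_conj)
      show "\<forall>\<^sub>F y in nhds x. y \<in> S" using S x by (rule eventually_nhds_in_open)
      have "(?A \<longlongrightarrow> ?A x) (nhds x)" "(?B \<longlongrightarrow> ?B x) (nhds x)"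
        using cA cB tendsto_at_iff_tendsto_nhds[of ?A x] tendsto_at_iff_tendsto_nhds[of ?B x]
        by (simp_all add: isCont_def)
      note lim = tendstoD[OF this(1), of "e / 2"] tendstoD[OF this(2), of "e / 2"]
      show "\<forall>\<^sub>F y in nhds x. \<bar>?A y - ?A x\<bar> < e / 2" "\<forall>\<^sub>F y in nhds x. \<bar>?B y - ?B x\<bar> < e / 2"
        using lim e by (simp_all add: dist_real_def)
    qed
    then obtain d where d: "d > 0" and
      near: "\<And>y. dist y x < d \<Longrightarrow> y \<in> S \<and> \<bar>?A y - ?A x\<bar> < e / 2 \<and> \<bar>?B y - ?B x\<bar> < e / 2"
      unfolding eventually_nhds_metric by blast
    \<comment> \<open>The parallelogram with sides h v and h w then stays within d / 2 of x; the
      summand 1 keeps the denominator positive when v and w both vanish.\<close>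
    define h where "h = d / (2 * (norm v + norm w + 1))"
    have den: "norm v + norm w + 1 > 0" by (simp add: add_nonneg_pos)
    have h: "h > 0" unfolding h_def using d den by simp
    have close: "dist (x + s *\<^sub>R v + t *\<^sub>R w) x < d" if "0 \<le> s" "s \<le> h" "0 \<le> t" "t \<le> h" for s t
    proof -
      have "dist (x + s *\<^sub>R v + t *\<^sub>R w) x \<le> s * norm v + t * norm w"
        using norm_triangle_ineq[of "s *\<^sub>R v" "t *\<^sub>R w"] that by (simp add: dist_norm algebra_simps)
      also have "\<dots> \<le> h * norm v + h * norm w"
        using that by (intro add_mono mult_right_mono) auto
      also have "\<dots> \<le> h * (norm v + norm w + 1)" using h by (simp add: algebra_simps)
      also have "\<dots> = d / 2" using den unfolding h_def by (simp add: field_simps)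
      finally show ?thesis using d by simp
    qed
    obtain s t where st: "0 < s" "s < h" "0 < t" "t < h"
      "f (x + h *\<^sub>R v + h *\<^sub>R w) - f (x + h *\<^sub>R v) - f (x + h *\<^sub>R w) + f x
        = h * h * ?A (x + s *\<^sub>R v + t *\<^sub>R w)"
      using second_difference_mean_value[OF S f h, of x v w] near close by blast
    have close': "x + s *\<^sub>R w + t *\<^sub>R v \<in> S" if "0 \<le> s" "s \<le> h" "0 \<le> t" "t \<le> h" for s t
      using near[OF close[of t s]] that by (simp add: algebra_simps)
    obtain s' t' where st': "0 < s'" "s' < h" "0 < t'" "t' < h"
      "f (x + h *\<^sub>R w + h *\<^sub>R v) - f (x + h *\<^sub>R w) - f (x + h *\<^sub>R v) + f x
        = h * h * ?B (x + s' *\<^sub>R w + t' *\<^sub>R v)"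
      using second_difference_mean_value[OF S f h, of x w v] close' by blast
    have comm: "x + h *\<^sub>R w + h *\<^sub>R v = x + h *\<^sub>R v + h *\<^sub>R w" by (simp add: algebra_simps)
    have "h * h * ?A (x + s *\<^sub>R v + t *\<^sub>R w) = h * h * ?B (x + s' *\<^sub>R w + t' *\<^sub>R v)"
      using st(5) st'(5)[unfolded comm] by linarith
    then have "?A (x + s *\<^sub>R v + t *\<^sub>R w) = ?B (x + t' *\<^sub>R v + s' *\<^sub>R w)"
      using h by (simp add: algebra_simps)
    moreover have "\<bar>?A (x + s *\<^sub>R v + t *\<^sub>R w) - ?A x\<bar> < e / 2"
      "\<bar>?B (x + t' *\<^sub>R v + s' *\<^sub>R w) - ?B x\<bar> < e / 2"
      using near close st st' by (meson less_imp_le)+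
    ultimately show ?thesis by linarith
  qed
  then have "\<bar>?A x - ?B x\<bar> \<le> 0" by (rule dense_ge)
  then show ?thesis by simp
qed

lemma fderiv_inner:
  assumes "f differentiable (at x)"
  shows "fderiv (\<lambda>x. f x \<bullet> b) x v = fderiv f x v \<bullet> b"
  by (metis assms fderiv_eqI frechet_derivative_works has_derivative_inner_left)

lemma second_derivative_symmetric:
  fixes f :: "'a::euclidean_space \<Rightarrow> 'b::euclidean_space"
  assumes S: "open S" and f: "smooth_on S f" and x: "x \<in> S"
  shows "fderiv (\<lambda>x. fderiv f x v) x w
    = fderiv (\<lambda>x. fderiv f x w) x v"
proof (rule euclidean_eqI)
  fix b :: 'b
  have sm: "smooth_on S (\<lambda>x. f x \<bullet> b)" by (intro smooth_on_inner S f smooth_on_const)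
  have *: "fderiv (\<lambda>x. fderiv (\<lambda>x. f x \<bullet> b) x v) x w
      = fderiv (\<lambda>x. fderiv f x v) x w \<bullet> b" for v w
  proof -
    have "fderiv (\<lambda>x. fderiv (\<lambda>x. f x \<bullet> b) x v) x w
      = fderiv (\<lambda>x. fderiv f x v \<bullet> b) x w"
      by (subst fderiv_cong_open(1)[OF S x])
        (auto intro: fderiv_inner smooth_on_differentiable[OF f])
    also have "\<dots> = fderiv (\<lambda>x. fderiv f x v) x w \<bullet> b"
      by (intro fderiv_inner smooth_on_differentiable[OF _ x]
          smooth_on_fderiv f)
    finally show ?thesis .
  qed
  show "fderiv (\<lambda>x. fderiv f x v) x w \<bullet> b
    = fderiv (\<lambda>x. fderiv f x w) x v \<bullet> b"
    using real_second_derivative_symmetric[OF S sm x, of v w] by (simp add: *)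
qed


subsection \<open>Bump functions\<close>

text \<open>For t > 0 this is t^(-n) exp(-1/t). The whole family is considered because
  differentiation leads from one member to a linear combination of two others; n = 0 is the usual
  building block of bump functions.\<close>

definition flat_fun :: "nat \<Rightarrow> real \<Rightarrow> real" where
  "flat_fun n t = (if t > 0 then inverse t ^ n / exp (inverse t) else 0)"

lemma flat_fun_tendsto: "((\<lambda>t. flat_fun n t) \<longlongrightarrow> 0) (at_right 0)"
proof -
  have "((\<lambda>t. inverse t ^ n / exp (inverse t)) \<longlongrightarrow> (0::real)) (at_right 0)"
    by (rule filterlim_compose[OF tendsto_power_div_exp_0 filterlim_inverse_at_top_right])
  then show ?thesis
    by (rule Lim_transform_eventually)
      (auto simp: eventually_at_filter flat_fun_def intro!: always_eventually)
qed

lemma flat_fun_DERIV: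
  "(flat_fun n has_real_derivative flat_fun (Suc (Suc n)) t - real n * flat_fun (Suc n) t) (at t)"
proof -
  consider "t > 0" | "t < 0" | "t = 0" by linarith
  then show ?thesis
  proof cases
    case 1
    have "((\<lambda>t. inverse t ^ n / exp (inverse t)) has_real_derivative
        flat_fun (Suc (Suc n)) t - real n * flat_fun (Suc n) t) (at t)"
    proof (cases n)
      case (Suc m)
      have "((\<lambda>t. exp (inverse t)) has_real_derivative
          exp (inverse t) * - (inverse t ^ Suc (Suc 0))) (at t)"
        using 1 by (auto intro!: derivative_eq_intros simp: power2_eq_square)
      from DERIV_divide[OF DERIV_power_Suc[OF DERIV_inverse[of t UNIV]] this, of m]
      show ?thesis unfolding Suc
        by (rule DERIV_cong) (use 1 in \<open>auto simp: flat_fun_def field_simps\<close>)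
    qed (use 1 in \<open>auto intro!: derivative_eq_intros simp: flat_fun_def field_simps power2_eq_square\<close>)
    then show ?thesis
      by (rule DERIV_cong_ev[THEN iffD1, rotated -1])
        (use 1 eventually_nhds_in_open[of "{0<..}" t] in \<open>auto simp: flat_fun_def elim!: eventually_mono\<close>)
  next
    case 2
    have "((\<lambda>t. 0) has_real_derivative
        flat_fun (Suc (Suc n)) t - real n * flat_fun (Suc n) t) (at t)"
      using 2 by (simp add: flat_fun_def)
    then show ?thesis
      by (rule DERIV_cong_ev[THEN iffD1, rotated -1])
        (use 2 eventually_nhds_in_open[of "{..<0}" t] in \<open>auto simp: flat_fun_def elim!: eventually_mono\<close>)
  next
    case 3
    \<comment> \<open>For h > 0 the difference quotient at 0 is \<open>flat_fun (Suc n) h\<close>,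
      so the decay of the next member of the family makes the derivative vanish.\<close>
    have "((\<lambda>h. (flat_fun n (0 + h) - flat_fun n 0) / h) \<longlongrightarrow> 0) (at 0)"
      unfolding filterlim_at_split
    proof
      show "((\<lambda>h. (flat_fun n (0 + h) - flat_fun n 0) / h) \<longlongrightarrow> 0) (at_left 0)"
        by (rule Lim_transform_eventually[OF tendsto_const])
          (auto simp: eventually_at_filter flat_fun_def intro!: always_eventually)
      show "((\<lambda>h. (flat_fun n (0 + h) - flat_fun n 0) / h) \<longlongrightarrow> 0) (at_right 0)"
        by (rule Lim_transform_eventually[OF flat_fun_tendsto[of "Suc n"]])
          (auto simp: eventually_at_filter flat_fun_def field_simps intro!: always_eventually)
    qed
    then show ?thesis using 3 by (simp add: DERIV_def flat_fun_def)
  qed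
qed

lemma smooth_on_flat_fun: "smooth_on UNIV (flat_fun n)"
proof -
  have der: "(flat_fun n has_derivative
      (\<lambda>v. v *\<^sub>R (flat_fun (Suc (Suc n)) t - real n * flat_fun (Suc n) t))) (at t)" for n t
    using flat_fun_DERIV[of n t] by (simp add: has_field_derivative_def mult_commute_abs)
  have "Ck_on k UNIV (flat_fun n)" for k n
  proof (induction k arbitrary: n)
    case 0
    show ?case
      using der by (auto intro!: continuous_at_imp_continuous_on has_derivative_continuous)
  next
    case (Suc k)
    have "Ck_on k UNIV (\<lambda>t. fderiv (flat_fun n) t v)" for v
    proof (rule Ck_on_cong[OF open_UNIV])
      show "Ck_on k UNIV (\<lambda>t. v *\<^sub>R (flat_fun (Suc (Suc n)) t + (- real n) * flat_fun (Suc n) t))"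
        by (intro Ck_on_bilinear[OF bounded_bilinear_scaleR] Ck_on_bilinear[OF bounded_bilinear_mult]
            Ck_on_const Ck_on_add Suc.IH open_UNIV)
    qed (simp add: fderiv_eqI[OF der])
    then show ?case using der by (auto simp: differentiable_def)
  qed
  then show ?thesis by (simp add: smooth_on_def)
qed

text \<open>The function is p / (p + q), where p is positive exactly inside the large ball and q
  exactly outside the closed small one; d < e makes the denominator positive everywhere. The squared
  distance \<open>n\<close> is used because it is smooth at the centre as well.\<close>

lemma smooth_bump_exists:
  fixes a :: "'a::euclidean_space"
  assumes "0 < d" "d < e"
  obtains \<psi> :: "'a \<Rightarrow> real" where "smooth_on UNIV \<psi>" "\<And>x. x \<in> ball a d \<Longrightarrow> \<psi> x = 1"
    "\<And>x. x \<notin> ball a e \<Longrightarrow> \<psi> x = 0"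
proof -
  define n where "n x = (x - a) \<bullet> (x - a)" for x
  define p where "p x = flat_fun 0 (e\<^sup>2 - n x)" for x
  define q where "q x = flat_fun 0 (n x - d\<^sup>2)" for x
  have ns: "smooth_on UNIV n"
    unfolding n_def by (intro smooth_on_inner smooth_on_diff smooth_on_ident smooth_on_const open_UNIV)
  have ps: "smooth_on UNIV p" unfolding p_def
    by (rule smooth_on_compose[OF open_UNIV open_UNIV _ _ smooth_on_flat_fun])
      (auto intro!: smooth_on_diff smooth_on_const ns)
  have qs: "smooth_on UNIV q" unfolding q_def
    by (rule smooth_on_compose[OF open_UNIV open_UNIV _ _ smooth_on_flat_fun])
      (auto intro!: smooth_on_diff smooth_on_const ns)
  have de: "d\<^sup>2 < e\<^sup>2" using assms by (simp add: power_strict_mono)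
  have n_norm: "n x = (norm (x - a))\<^sup>2" for x by (simp add: n_def dot_square_norm)
  have pos: "p x + q x \<noteq> 0" for x
  proof -
    have "p x \<ge> 0" "q x \<ge> 0" by (auto simp: p_def q_def flat_fun_def)
    moreover have "p x > 0 \<or> q x > 0" using de by (auto simp: p_def q_def flat_fun_def)
    ultimately show ?thesis by linarith
  qed
  show thesis
  proof
    show "smooth_on UNIV (\<lambda>x. p x * inverse (p x + q x))"
      by (intro smooth_on_mult smooth_on_inverse smooth_on_add ps qs open_UNIV pos)
    show "p x * inverse (p x + q x) = 1" if "x \<in> ball a d" for x
    proof -
      have "norm (x - a) < d" using that by (simp add: dist_norm norm_minus_commute)
      then have "n x < d\<^sup>2" using assms by (simp add: n_norm power_strict_mono)
      then have "q x = 0" by (simp add: q_def flat_fun_def)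
      then show ?thesis using pos[of x] by simp
    qed
    show "p x * inverse (p x + q x) = 0" if "x \<notin> ball a e" for x
    proof -
      have "norm (x - a) \<ge> e" using that by (simp add: dist_norm norm_minus_commute)
      then have "n x \<ge> e\<^sup>2" using assms by (simp add: n_norm power_mono)
      then show ?thesis by (simp add: p_def flat_fun_def)
    qed
  qed
qed


section \<open>Charts and changes of coordinates\<close>

abbreviation chart_img :: "('m, 'v) chart \<Rightarrow> 'v set" where
  "chart_img c \<equiv> chart_map c ` chart_dom c"

abbreviation transition :: "('m, 'v) chart \<Rightarrow> ('m, 'v) chart \<Rightarrow> 'v \<Rightarrow> 'v" where
  "transition c c' \<equiv> chart_map c' \<circ> chart_inv c"

text \<open>The part of the manifold axioms that does not concern the topology; it is what the cotangent
  bundle has to be checked for.\<close>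

locale smooth_atlas =
  fixes M :: "('m, 'v::euclidean_space) charted_space"
  assumes inj_chart: "c \<in> atlas M \<Longrightarrow> inj_on (chart_map c) (chart_dom c)"
    and open_image: "c \<in> atlas M \<Longrightarrow> open (chart_img c)"
    and open_overlap: "c \<in> atlas M \<Longrightarrow> c' \<in> atlas M \<Longrightarrow>
      open (chart_map c ` (chart_dom c \<inter> chart_dom c'))"
    and smooth_transition: "c \<in> atlas M \<Longrightarrow> c' \<in> atlas M \<Longrightarrow>
      smooth_on (chart_map c ` (chart_dom c \<inter> chart_dom c')) (transition c c')"
    and chart_at_atlas [simp]: "chart_at M p \<in> atlas M"
    and chart_at_dom [simp]: "p \<in> chart_dom (chart_at M p)"
begin

lemmas chart_at = chart_at_atlas chart_at_dom

lemma chart_inv_map [simp]: "c \<in> atlas M \<Longrightarrow> p \<in> chart_dom c \<Longrightarrow> chart_inv c (chart_map c p) = p"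
  by (simp add: chart_inv_def inj_chart)

lemma chart_map_inv [simp]: "x \<in> chart_img c \<Longrightarrow> chart_map c (chart_inv c x) = x"
  by (simp add: chart_inv_def f_inv_into_f)

lemma chart_inv_dom [simp]: "x \<in> chart_img c \<Longrightarrow> chart_inv c x \<in> chart_dom c"
  by (simp add: chart_inv_def inv_into_into)

lemma image_Int:
  assumes "c \<in> atlas M" "A \<subseteq> chart_dom c" "B \<subseteq> chart_dom c"
  shows "chart_map c ` (A \<inter> B) = chart_map c ` A \<inter> chart_map c ` B"
  using inj_on_image_Int[OF inj_chart[OF assms(1)] assms(2,3)] .

lemma open_overlap3:
  assumes "c \<in> atlas M" "c' \<in> atlas M" "c'' \<in> atlas M"
  shows "open (chart_map c ` (chart_dom c \<inter> chart_dom c' \<inter> chart_dom c''))"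
proof -
  have "chart_dom c \<inter> chart_dom c' \<inter> chart_dom c''
      = (chart_dom c \<inter> chart_dom c') \<inter> (chart_dom c \<inter> chart_dom c'')" by auto
  then show ?thesis
    using assms by (simp only: image_Int[of c "chart_dom c \<inter> chart_dom c'"
        "chart_dom c \<inter> chart_dom c''"] Int_lower1) (intro open_Int open_overlap)
qed

lemma transition_has_derivative:
  assumes "c \<in> atlas M" "c' \<in> atlas M" "p \<in> chart_dom c" "p \<in> chart_dom c'"
  shows "(transition c c' has_derivative chart_change c c' p) (at (chart_map c p))"
  unfolding chart_change_def
  by (rule smooth_on_fderiv_at[OF smooth_transition]) (use assms in auto)

lemma linear_chart_change:
  assumes "c \<in> atlas M" "c' \<in> atlas M" "p \<in> chart_dom c" "p \<in> chart_dom c'"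
  shows "linear (chart_change c c' p)"
  using transition_has_derivative[OF assms] by (rule has_derivative_linear)

lemma chart_change_self:
  assumes "c \<in> atlas M" "p \<in> chart_dom c"
  shows "chart_change c c p v = v"
proof -
  have "((\<lambda>x. x) has_derivative chart_change c c p) (at (chart_map c p))"
    by (rule has_derivative_local[OF transition_has_derivative open_image[of c]])
      (use assms in auto)
  then have "chart_change c c p = (\<lambda>x. x)"
    using has_derivative_unique has_derivative_ident by blast
  then show ?thesis by simp
qed

lemma chart_change_trans:
  assumes c: "c \<in> atlas M" "c' \<in> atlas M" "c'' \<in> atlas M"
    and p: "p \<in> chart_dom c" "p \<in> chart_dom c'" "p \<in> chart_dom c''"
  shows "chart_change c' c'' p (chart_change c c' p v) = chart_change c c'' p v"
proof -
  have 1: "((\<lambda>x. transition c' c'' (transition c c' x)) has_derivative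
      (\<lambda>v. chart_change c' c'' p (chart_change c c' p v))) (at (chart_map c p))"
    by (rule has_derivative_compose[of "transition c c'"])
      (use transition_has_derivative c p in \<open>auto simp del: o_apply simp: o_apply[of _ _ "chart_map _ p"]\<close>)
  have "(transition c c'' has_derivative
      (\<lambda>v. chart_change c' c'' p (chart_change c c' p v))) (at (chart_map c p))"
    by (rule has_derivative_local[OF 1 open_overlap3[OF c]]) (use c p in auto)
  then have "chart_change c c'' p = (\<lambda>v. chart_change c' c'' p (chart_change c c' p v))"
    using has_derivative_unique transition_has_derivative[OF c(1,3) p(1,3)] by blast
  then show ?thesis by simp
qed

lemma chart_change_inverse:
  assumes "c \<in> atlas M" "c' \<in> atlas M" "p \<in> chart_dom c" "p \<in> chart_dom c'"
  shows "chart_change c' c p (chart_change c c' p v) = v"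
  using assms by (simp add: chart_change_trans chart_change_self)


subsection \<open>Coordinates of tangent vectors and covectors\<close>

lemma linear_tan_coord: "c \<in> atlas M \<Longrightarrow> p \<in> chart_dom c \<Longrightarrow> linear (tan_coord M c p)"
  unfolding tan_coord_def by (intro linear_chart_change) auto

lemma tan_coord_self [simp]: "tan_coord M (chart_at M p) p v = v"
  by (simp add: tan_coord_def chart_change_self)

lemma tan_coord_change:
  assumes "c \<in> atlas M" "c' \<in> atlas M" "p \<in> chart_dom c" "p \<in> chart_dom c'"
  shows "chart_change c c' p (tan_coord M c p v) = tan_coord M c' p v"
  using assms by (simp add: tan_coord_def chart_change_trans)

lemma tan_coord_of_change [simp]:
  assumes "c \<in> atlas M" "p \<in> chart_dom c"
  shows "tan_coord M c p (chart_change c (chart_at M p) p w) = w"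
  using assms by (simp add: tan_coord_def chart_change_inverse)

lemma change_of_tan_coord [simp]:
  assumes "c \<in> atlas M" "p \<in> chart_dom c"
  shows "chart_change c (chart_at M p) p (tan_coord M c p w) = w"
  using assms by (simp add: tan_coord_def chart_change_inverse)

lemma bij_tan_coord: "c \<in> atlas M \<Longrightarrow> p \<in> chart_dom c \<Longrightarrow> bij (tan_coord M c p)"
  by (rule o_bij[of "chart_change c (chart_at M p) p"]) (auto simp: fun_eq_iff)

lemma inv_tan_coord:
  assumes "c \<in> atlas M" "p \<in> chart_dom c"
  shows "inv (tan_coord M c p) = chart_change c (chart_at M p) p"
  by (rule inv_equality) (use assms in auto)

text \<open>Covector coefficients change with the transposed inverse Jacobian, so the evaluation is
  the same number in every chart. Identities between covectors are later proved by pairing both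
  sides with an arbitrary vector.\<close>

lemma cot_tan_pairing [simp]:
  assumes "c \<in> atlas M" "p \<in> chart_dom c"
  shows "cot_coord M c p \<xi> \<bullet> tan_coord M c p v = \<xi> \<bullet> v"
  using assms by (simp add: cot_coord_def adjoint_inner linear_chart_change)

lemma cot_coord_inner:
  assumes "c \<in> atlas M" "p \<in> chart_dom c"
  shows "cot_coord M c p \<xi> \<bullet> w = \<xi> \<bullet> chart_change c (chart_at M p) p w"
  using cot_tan_pairing[OF assms, of \<xi> "chart_change c (chart_at M p) p w"] assms by simp

lemma linear_cot_coord: "c \<in> atlas M \<Longrightarrow> p \<in> chart_dom c \<Longrightarrow> linear (cot_coord M c p)"
  unfolding cot_coord_def by (intro adjoint_linear linear_chart_change) auto

lemma cot_coord_self [simp]: "cot_coord M (chart_at M p) p \<xi> = \<xi>"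
  by (rule vector_eq_rdot[THEN iffD1]) (simp add: cot_coord_inner chart_change_self)

lemma cot_coord_change:
  assumes "c \<in> atlas M" "c' \<in> atlas M" "p \<in> chart_dom c" "p \<in> chart_dom c'"
  shows "adjoint (chart_change c c' p) (cot_coord M c' p \<xi>) = cot_coord M c p \<xi>"
proof (rule vector_eq_rdot[THEN iffD1], rule allI)
  fix w
  show "adjoint (chart_change c c' p) (cot_coord M c' p \<xi>) \<bullet> w = cot_coord M c p \<xi> \<bullet> w"
    using assms by (simp add: adjoint_inner[OF linear_chart_change] cot_coord_inner chart_change_trans)
qed

lemma cot_coord_adjoint_tan_coord [simp]:
  assumes "c \<in> atlas M" "p \<in> chart_dom c"
  shows "cot_coord M c p (adjoint (tan_coord M c p) y) = y"
  by (rule vector_eq_rdot[THEN iffD1])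
    (use assms in \<open>simp add: cot_coord_inner adjoint_inner linear_tan_coord\<close>)

lemma adjoint_tan_coord_cot_coord [simp]:
  assumes "c \<in> atlas M" "p \<in> chart_dom c"
  shows "adjoint (tan_coord M c p) (cot_coord M c p \<xi>) = \<xi>"
  by (rule vector_eq_rdot[THEN iffD1])
    (use assms in \<open>simp add: adjoint_inner linear_tan_coord\<close>)

lemma inv_cot_coord:
  assumes "c \<in> atlas M" "p \<in> chart_dom c"
  shows "inv (cot_coord M c p) = adjoint (tan_coord M c p)"
  by (rule inv_equality) (use assms in auto)

lemma bij_cot_coord: "c \<in> atlas M \<Longrightarrow> p \<in> chart_dom c \<Longrightarrow> bij (cot_coord M c p)"
  by (rule o_bij[of "adjoint (tan_coord M c p)"]) (auto simp: fun_eq_iff)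

lemma bij_gen_coord: "c \<in> atlas M \<Longrightarrow> p \<in> chart_dom c \<Longrightarrow> bij (gen_coord M c p)"
  unfolding gen_coord_def using bij_tan_coord bij_cot_coord bij_betw_map_prod[of _ UNIV UNIV _ UNIV UNIV]
  by (metis UNIV_Times_UNIV)

lemma linear_gen_coord: "c \<in> atlas M \<Longrightarrow> p \<in> chart_dom c \<Longrightarrow> linear (gen_coord M c p)"
  using linear_tan_coord[of c p] linear_cot_coord[of c p]
  by (auto simp: gen_coord_def linear_iff)


subsection \<open>Coordinate representations of sections\<close>

abbreviation VF :: "('m \<Rightarrow> 'v) set" where
  "VF \<equiv> vector_fields M"

abbreviation smooth_fun :: "('m \<Rightarrow> 'b::real_normed_vector) \<Rightarrow> bool" where
  "smooth_fun \<equiv> smooth_fun_on M UNIV"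

abbreviation trep :: "('m, 'v) chart \<Rightarrow> ('m \<Rightarrow> 'v) \<Rightarrow> 'v \<Rightarrow> 'v" where
  "trep \<equiv> section_rep (tan_coord M)"

abbreviation crep :: "('m, 'v) chart \<Rightarrow> ('m \<Rightarrow> 'v) \<Rightarrow> 'v \<Rightarrow> 'v" where
  "crep \<equiv> section_rep (cot_coord M)"

abbreviation grep :: "('m, 'v) chart \<Rightarrow> ('m \<Rightarrow> 'v \<times> 'v) \<Rightarrow> 'v \<Rightarrow> 'v \<times> 'v" where
  "grep \<equiv> section_rep (gen_coord M)"

definition gen_fields :: "('m \<Rightarrow> 'v \<times> 'v) set" where
  "gen_fields = {u. smooth_section_on M (gen_coord M) UNIV u}"

lemma section_rep_at [simp]:
  "c \<in> atlas M \<Longrightarrow> q \<in> chart_dom c \<Longrightarrow> section_rep \<kappa> c s (chart_map c q) = \<kappa> c q (s q)"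
  by (simp add: section_rep_def)

lemma vector_fields_iff:
  "X \<in> VF \<longleftrightarrow> (\<forall>c\<in>atlas M. smooth_on (chart_img c) (trep c X))"
  by (simp add: vector_fields_def smooth_section_on_def)

lemma one_forms_iff:
  "\<xi> \<in> one_forms M \<longleftrightarrow> (\<forall>c\<in>atlas M. smooth_on (chart_img c) (crep c \<xi>))"
  by (simp add: one_forms_def smooth_section_on_def)

lemma smooth_fun_iff:
  "smooth_fun f \<longleftrightarrow> (\<forall>c\<in>atlas M. smooth_on (chart_img c) (f \<circ> chart_inv c))"
  by (simp add: smooth_fun_on_def)

lemma trep_smooth: "X \<in> VF \<Longrightarrow> c \<in> atlas M \<Longrightarrow> smooth_on (chart_img c) (trep c X)"
  by (simp add: vector_fields_iff)

lemma crep_smooth: "\<xi> \<in> one_forms M \<Longrightarrow> c \<in> atlas M \<Longrightarrow> smooth_on (chart_img c) (crep c \<xi>)"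
  by (simp add: one_forms_iff)

lemma fun_smooth:
  "smooth_fun f \<Longrightarrow> c \<in> atlas M \<Longrightarrow> smooth_on (chart_img c) (f \<circ> chart_inv c)"
  by (simp add: smooth_fun_on_def)

lemma grep_eq: "grep c u x = (trep c (\<lambda>q. fst (u q)) x, crep c (\<lambda>q. snd (u q)) x)"
  by (simp add: section_rep_def gen_coord_def map_prod_def split_beta)

lemma gen_fields_iff:
  "u \<in> gen_fields \<longleftrightarrow> (\<lambda>q. fst (u q)) \<in> VF \<and> (\<lambda>q. snd (u q)) \<in> one_forms M"
proof
  assume u: "u \<in> gen_fields"
  have "smooth_on (chart_img c) (trep c (\<lambda>q. fst (u q)))"
    "smooth_on (chart_img c) (crep c (\<lambda>q. snd (u q)))" if c: "c \<in> atlas M" for c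
  proof -
    have g: "smooth_on (chart_img c) (grep c u)"
      using u c by (simp add: gen_fields_def smooth_section_on_def)
    show "smooth_on (chart_img c) (trep c (\<lambda>q. fst (u q)))"
      using smooth_on_fst[OF open_image[OF c] g] by (simp add: grep_eq)
    show "smooth_on (chart_img c) (crep c (\<lambda>q. snd (u q)))"
      using smooth_on_snd[OF open_image[OF c] g] by (simp add: grep_eq)
  qed
  then show "(\<lambda>q. fst (u q)) \<in> VF \<and> (\<lambda>q. snd (u q)) \<in> one_forms M"
    by (simp add: vector_fields_iff one_forms_iff)
next
  assume u: "(\<lambda>q. fst (u q)) \<in> VF \<and> (\<lambda>q. snd (u q)) \<in> one_forms M"
  have "smooth_on (chart_img c) (grep c u)" if c: "c \<in> atlas M" for c
  proof -
    have "grep c u = (\<lambda>x. (trep c (\<lambda>q. fst (u q)) x, crep c (\<lambda>q. snd (u q)) x))"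
      by (simp add: fun_eq_iff grep_eq)
    then show ?thesis
      using u c by (simp add: smooth_on_Pair open_image trep_smooth crep_smooth)
  qed
  then show "u \<in> gen_fields" by (simp add: gen_fields_def smooth_section_on_def)
qed

lemma image_overlap_iff:
  assumes "c \<in> atlas M"
  shows "x \<in> chart_map c ` (chart_dom c \<inter> chart_dom c') \<longleftrightarrow>
    x \<in> chart_img c \<and> chart_inv c x \<in> chart_dom c'"
  using assms by (auto simp: rev_image_eqI)

lemma transition_in_overlap:
  assumes "c \<in> atlas M" "c' \<in> atlas M" "x \<in> chart_map c ` (chart_dom c \<inter> chart_dom c')"
  shows "transition c c' x \<in> chart_map c' ` (chart_dom c' \<inter> chart_dom c)"
    and "chart_inv c' (transition c c' x) = chart_inv c x"
  using assms by (auto intro!: imageI)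

lemma trep_transition:
  assumes "c \<in> atlas M" "c' \<in> atlas M" "x \<in> chart_map c ` (chart_dom c \<inter> chart_dom c')"
  shows "trep c' X (transition c c' x) = fderiv (transition c c') x (trep c X x)"
  using assms by (auto simp: section_rep_def tan_coord_change[of c c', symmetric] chart_change_def)

lemma crep_transition:
  assumes "c \<in> atlas M" "c' \<in> atlas M" "x \<in> chart_map c ` (chart_dom c \<inter> chart_dom c')"
  shows "crep c \<xi> x = adjoint (fderiv (transition c c') x) (crep c' \<xi> (transition c c' x))"
  using assms by (auto simp: section_rep_def cot_coord_change[of c c', symmetric] chart_change_def)

lemma open_preimage_transition:
  assumes c: "c \<in> atlas M" "c' \<in> atlas M" and N: "open N"
  shows "open {y \<in> chart_map c' ` (chart_dom c' \<inter> chart_dom c). transition c' c y \<in> N}"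
proof -
  have "continuous_on (chart_map c' ` (chart_dom c' \<inter> chart_dom c)) (transition c' c)"
    using smooth_transition[OF c(2,1)] by (metis Ck_on.simps(1) smooth_on_def)
  from continuous_open_preimage[OF this open_overlap[OF c(2,1)] N] show ?thesis
    by (simp add: vimage_def Int_def)
qed

abbreviation chart_nbhd :: "'m \<Rightarrow> ('m, 'v) chart \<Rightarrow> 'v set \<Rightarrow> bool" where
  "chart_nbhd q c N \<equiv> c \<in> atlas M \<and> open N \<and> q \<in> chart_dom c \<and> chart_map c q \<in> N \<and> N \<subseteq> chart_img c"

text \<open>On U the old representation is composed with the chart change. A vector field in
  addition picks up the Jacobian of the change from c to c', taken at the point in the chart c; a
  one-form picks up the transposed Jacobian of the change from c' to c.\<close>

lemma smooth_transfer:
  assumes c: "c \<in> atlas M" "c' \<in> atlas M" and N: "open N" "N \<subseteq> chart_img c"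
  defines "U \<equiv> {y \<in> chart_map c' ` (chart_dom c' \<inter> chart_dom c). transition c' c y \<in> N}"
  shows "smooth_on N (f \<circ> chart_inv c) \<Longrightarrow> smooth_on U (f \<circ> chart_inv c')"
    and "smooth_on N (trep c X) \<Longrightarrow> smooth_on U (trep c' X)"
    and "smooth_on N (crep c X) \<Longrightarrow> smooth_on U (crep c' X)"
proof -
  have U: "open U" unfolding U_def by (rule open_preimage_transition[OF c N(1)])
  have Usub: "U \<subseteq> chart_map c' ` (chart_dom c' \<inter> chart_dom c)" by (auto simp: U_def)
  have tr: "smooth_on U (transition c' c)"
    by (rule smooth_on_subset[OF smooth_transition[OF c(2,1)] Usub])
  have trN: "transition c' c ` U \<subseteq> N" by (auto simp: U_def)
  note comp = smooth_on_compose[OF U N(1) trN tr]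
  show "smooth_on U (f \<circ> chart_inv c')" if "smooth_on N (f \<circ> chart_inv c)"
    by (rule smooth_on_cong[OF U comp[OF that]])
      (use transition_in_overlap(2)[OF c(2,1)] Usub in \<open>auto simp del: o_apply simp: o_apply[of f]\<close>)
  show "smooth_on U (trep c' X)" if X: "smooth_on N (trep c X)"
  proof (rule smooth_on_cong[OF U])
    let ?W = "chart_map c ` (chart_dom c \<inter> chart_dom c')"
    have W: "transition c' c y \<in> ?W" if "y \<in> U" for y
      using transition_in_overlap(1)[OF c(2,1)] Usub that by auto
    have lin: "linear (fderiv (transition c c') y)" if "y \<in> ?W" for y
      using smooth_on_differentiable[OF smooth_transition[OF c] that] by (rule linear_frechet_derivative)
    show "smooth_on U (\<lambda>y. fderiv (transition c c') (transition c' c y)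
        (trep c X (transition c' c y)))"
    proof (rule smooth_on_linear_apply[OF U _ _ comp[OF X]])
      show "smooth_on U (\<lambda>y. fderiv (transition c c') (transition c' c y) b)" for b
        by (rule smooth_on_compose[OF U open_overlap[OF c] _ tr
              smooth_on_fderiv[OF smooth_transition[OF c]]]) (use W in blast)
    qed (use lin W in blast)
    show "fderiv (transition c c') (transition c' c y)
        (trep c X (transition c' c y)) = trep c' X y" if "y \<in> U" for y
    proof -
      have "transition c c' (transition c' c y) = y"
        using transition_in_overlap(2)[OF c(2,1), of y] Usub that by (auto simp: chart_map_inv)
      then show ?thesis using trep_transition[OF c W[OF that], of X] by simp
    qed
  qed
  show "smooth_on U (crep c' X)" if X: "smooth_on N (crep c X)"
  proof (rule smooth_on_cong[OF U])
    show "smooth_on U (\<lambda>y. adjoint (fderiv (transition c' c) y) (crep c X (transition c' c y)))"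
    proof (rule smooth_on_adjoint_apply[OF U _ _ comp[OF X]])
      show "smooth_on U (\<lambda>y. fderiv (transition c' c) y b)" for b
        by (rule smooth_on_fderiv[OF tr])
      show "linear (fderiv (transition c' c) y)" if "y \<in> U" for y
        using smooth_on_differentiable[OF tr that] by (rule linear_frechet_derivative)
    qed
  qed (use crep_transition[OF c(2,1)] Usub in auto)
qed

text \<open>The definitions demand smoothness in every chart of the atlas; this reduces them to one
  convenient chart around each point. \<open>P\<close> and \<open>g\<close> are kept abstract so
  that one argument serves functions, vector fields and one-forms.\<close>

lemma smooth_locally:
  assumes "\<And>q. \<exists>c N. chart_nbhd q c N \<and> P c N"
    and tr: "\<And>c c' N. c \<in> atlas M \<Longrightarrow> c' \<in> atlas M \<Longrightarrow> open N \<Longrightarrow> N \<subseteq> chart_img c \<Longrightarrow>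
      P c N \<Longrightarrow> smooth_on {y \<in> chart_map c' ` (chart_dom c' \<inter> chart_dom c). transition c' c y \<in> N} (g c')"
    and c': "c' \<in> atlas M"
  shows "smooth_on (chart_img c') (g c')"
proof (rule smooth_on_local)
  fix x assume x: "x \<in> chart_img c'"
  obtain c N where cN: "c \<in> atlas M" "open N" "chart_inv c' x \<in> chart_dom c"
      "chart_map c (chart_inv c' x) \<in> N" "N \<subseteq> chart_img c" "P c N"
    using assms(1)[of "chart_inv c' x"] by blast
  then show "\<exists>U. open U \<and> x \<in> U \<and> smooth_on U (g c')"
    using x by (intro exI[of _ "{y \<in> chart_map c' ` (chart_dom c' \<inter> chart_dom c). transition c' c y \<in> N}"]
        conjI open_preimage_transition tr c') (auto simp: image_overlap_iff[OF c'])
qed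

lemma vector_fieldsI:
  assumes "\<And>q. \<exists>c N. chart_nbhd q c N \<and> smooth_on N (trep c X)"
  shows "X \<in> VF"
  unfolding vector_fields_iff
  by (rule ballI, rule smooth_locally[OF assms, where g = "\<lambda>c'. trep c' X"]) (rule smooth_transfer(2))

lemma one_formsI:
  assumes "\<And>q. \<exists>c N. chart_nbhd q c N \<and> smooth_on N (crep c X)"
  shows "X \<in> one_forms M"
  unfolding one_forms_iff
  by (rule ballI, rule smooth_locally[OF assms, where g = "\<lambda>c'. crep c' X"]) (rule smooth_transfer(3))

lemma smooth_funI:
  assumes "\<And>q. \<exists>c N. chart_nbhd q c N \<and> smooth_on N (f \<circ> chart_inv c)"
  shows "smooth_fun f"
  unfolding smooth_fun_iff
  by (rule ballI, rule smooth_locally[OF assms, where g = "\<lambda>c'. f \<circ> chart_inv c'"]) (rule smooth_transfer(1))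

section \<open>Sums, multiples and pairings of smooth sections\<close>

lemma vector_fields_add:
  assumes "X \<in> VF" "Y \<in> VF"
  shows "(\<lambda>q. X q + Y q) \<in> VF"
proof -
  have "smooth_on (chart_img c) (trep c (\<lambda>q. X q + Y q))" if c: "c \<in> atlas M" for c
    by (rule smooth_on_cong[OF open_image[OF c]
          smooth_on_add[OF open_image[OF c] trep_smooth[OF assms(1) c] trep_smooth[OF assms(2) c]]])
      (use c in \<open>simp add: section_rep_def linear_add[OF linear_tan_coord]\<close>)
  then show ?thesis by (simp add: vector_fields_iff)
qed

lemma vector_fields_scaleR:
  assumes "smooth_fun f" "X \<in> VF"
  shows "(\<lambda>q. f q *\<^sub>R X q) \<in> VF"
proof -
  have "smooth_on (chart_img c) (trep c (\<lambda>q. f q *\<^sub>R X q))" if c: "c \<in> atlas M" for c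
    by (rule smooth_on_cong[OF open_image[OF c]
          smooth_on_scaleR[OF open_image[OF c] fun_smooth[OF assms(1) c] trep_smooth[OF assms(2) c]]])
      (use c in \<open>simp add: section_rep_def linear_scale[OF linear_tan_coord]\<close>)
  then show ?thesis by (simp add: vector_fields_iff)
qed

lemma smooth_fun_const: "smooth_fun (\<lambda>q. k)"
  by (simp add: smooth_fun_on_def o_def smooth_on_const)

lemma vector_fields_zero: "(\<lambda>q. 0) \<in> VF"
  unfolding vector_fields_iff
proof
  fix c assume c: "c \<in> atlas M"
  show "smooth_on (chart_img c) (trep c (\<lambda>q. 0))"
    by (rule smooth_on_cong[OF open_image[OF c] smooth_on_const[of _ 0]])
      (use c in \<open>simp add: section_rep_def linear_0[OF linear_tan_coord]\<close>)
qed

lemma vector_fields_diff: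
  assumes "X \<in> VF" "Y \<in> VF"
  shows "(\<lambda>q. X q - Y q) \<in> VF"
  using vector_fields_add[OF assms(1) vector_fields_scaleR[OF smooth_fun_const[of "-1"] assms(2)]]
  by simp

lemma one_forms_add:
  assumes "X \<in> one_forms M" "Y \<in> one_forms M"
  shows "(\<lambda>q. X q + Y q) \<in> one_forms M"
proof -
  have "smooth_on (chart_img c) (crep c (\<lambda>q. X q + Y q))" if c: "c \<in> atlas M" for c
    by (rule smooth_on_cong[OF open_image[OF c]
          smooth_on_add[OF open_image[OF c] crep_smooth[OF assms(1) c] crep_smooth[OF assms(2) c]]])
      (use c in \<open>simp add: section_rep_def linear_add[OF linear_cot_coord]\<close>)
  then show ?thesis by (simp add: one_forms_iff)
qed

lemma one_forms_scale:
  assumes "X \<in> one_forms M"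
  shows "(\<lambda>q. (k::real) *\<^sub>R X q) \<in> one_forms M"
proof -
  have "smooth_on (chart_img c) (crep c (\<lambda>q. k *\<^sub>R X q))" if c: "c \<in> atlas M" for c
    by (rule smooth_on_cong[OF open_image[OF c]
          smooth_on_scaleR[OF open_image[OF c] smooth_on_const[of _ k] crep_smooth[OF assms c]]])
      (use c in \<open>simp add: section_rep_def linear_scale[OF linear_cot_coord]\<close>)
  then show ?thesis by (simp add: one_forms_iff)
qed

lemma one_forms_diff:
  assumes "X \<in> one_forms M" "Y \<in> one_forms M"
  shows "(\<lambda>q. X q - Y q) \<in> one_forms M"
  using one_forms_add[OF assms(1) one_forms_scale[OF assms(2), of "-1"]] by simp

lemma pairing_rep:
  assumes "c \<in> atlas M" "x \<in> chart_img c"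
  shows "((\<lambda>q. \<xi> q \<bullet> X q) \<circ> chart_inv c) x = crep c \<xi> x \<bullet> trep c X x"
  using assms by (simp add: section_rep_def)

lemma pairing_smooth:
  assumes "\<xi> \<in> one_forms M" "X \<in> VF"
  shows "smooth_fun (\<lambda>q. \<xi> q \<bullet> X q)"
  unfolding smooth_fun_iff
proof
  fix c assume c: "c \<in> atlas M"
  show "smooth_on (chart_img c) ((\<lambda>q. \<xi> q \<bullet> X q) \<circ> chart_inv c)"
    by (rule smooth_on_cong[OF open_image[OF c] smooth_on_inner[OF open_image[OF c]
          crep_smooth[OF assms(1) c] trep_smooth[OF assms(2) c]]]) (simp only: pairing_rep[OF c])
qed


subsection \<open>Coordinate independence of derivatives\<close>

lemma rep_has_derivative:
  assumes "c \<in> atlas M" "p \<in> chart_dom c"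
  shows "X \<in> VF \<Longrightarrow> (trep c X has_derivative
      fderiv (trep c X) (chart_map c p)) (at (chart_map c p))"
    and "\<xi> \<in> one_forms M \<Longrightarrow> (crep c \<xi> has_derivative
      fderiv (crep c \<xi>) (chart_map c p)) (at (chart_map c p))"
    and "smooth_fun f \<Longrightarrow> (f \<circ> chart_inv c has_derivative
      fderiv (f \<circ> chart_inv c) (chart_map c p)) (at (chart_map c p))"
  using assms trep_smooth crep_smooth fun_smooth by (blast intro: smooth_on_fderiv_at)+

lemma dfun_chart:
  assumes f: "smooth_fun f" and c: "c \<in> atlas M" "p \<in> chart_dom c"
  shows "dfun M f p v = fderiv (f \<circ> chart_inv c) (chart_map c p) (tan_coord M c p v)"
proof -
  let ?c = "chart_at M p"
  have "((\<lambda>x. (f \<circ> chart_inv c) (transition ?c c x)) has_derivative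
      (\<lambda>v. fderiv (f \<circ> chart_inv c) (chart_map c p) (chart_change ?c c p v)))
      (at (chart_map ?c p))"
    by (rule has_derivative_compose[of "transition ?c c"])
      (use transition_has_derivative[of ?c c p] rep_has_derivative(3)[OF c f] c in
        \<open>simp_all add: o_apply[of _ _ "chart_map _ p"] del: o_apply\<close>)
  then have "((f \<circ> chart_inv ?c) has_derivative
      (\<lambda>v. fderiv (f \<circ> chart_inv c) (chart_map c p) (chart_change ?c c p v)))
      (at (chart_map ?c p))"
    by (rule has_derivative_local[OF _ open_overlap[of ?c c]])
      (use c in \<open>auto simp: transition_in_overlap(2)\<close>)
  then show ?thesis unfolding dfun_def tan_coord_def by (simp add: fderiv_eqI)
qed

text \<open>The product rule for the coefficients in c. Each of the two summands depends on the
  chart, their sum does not.\<close>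

lemma dfun_pairing:
  assumes c: "c \<in> atlas M" "p \<in> chart_dom c" and \<omega>: "\<omega> \<in> one_forms M" and Z: "Z \<in> VF"
  shows "dfun M (\<lambda>q. \<omega> q \<bullet> Z q) p v
    = fderiv (crep c \<omega>) (chart_map c p) (tan_coord M c p v) \<bullet> tan_coord M c p (Z p)
      + cot_coord M c p (\<omega> p) \<bullet> fderiv (trep c Z) (chart_map c p) (tan_coord M c p v)"
proof -
  let ?x = "chart_map c p"
  have "((\<lambda>x. crep c \<omega> x \<bullet> trep c Z x) has_derivative
      (\<lambda>h. crep c \<omega> ?x \<bullet> fderiv (trep c Z) ?x h
         + fderiv (crep c \<omega>) ?x h \<bullet> trep c Z ?x)) (at ?x)"
    by (intro has_derivative_inner rep_has_derivative \<omega> Z c)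
  then have "((\<lambda>q. \<omega> q \<bullet> Z q) \<circ> chart_inv c has_derivative
      (\<lambda>h. crep c \<omega> ?x \<bullet> fderiv (trep c Z) ?x h
         + fderiv (crep c \<omega>) ?x h \<bullet> trep c Z ?x)) (at ?x)"
    by (rule has_derivative_local[OF _ open_image[OF c(1)]])
      (use c in \<open>auto simp: pairing_rep\<close>)
  then show ?thesis
    using c by (simp add: dfun_chart[OF pairing_smooth[OF \<omega> Z] c] fderiv_eqI)
qed

lemma linear_dfun:
  assumes "smooth_fun f"
  shows "linear (dfun M f p)"
  unfolding dfun_def
  using rep_has_derivative(3)[OF chart_at assms] has_derivative_linear by blast

lemma dform_inner:
  assumes "smooth_fun f"
  shows "dform M f p \<bullet> v = dfun M f p v"
  unfolding dform_def linear_eq_sum_Basis[OF linear_dfun[OF assms], of p v]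
  by (simp add: sum_scaleR_Basis_inner)

lemma dform_smooth:
  assumes f: "smooth_fun f"
  shows "dform M f \<in> one_forms M"
  unfolding one_forms_iff
proof
  fix c assume c: "c \<in> atlas M"
  let ?g = "\<lambda>x. \<Sum>b\<in>Basis. fderiv (f \<circ> chart_inv c) x b *\<^sub>R b"
  show "smooth_on (chart_img c) (crep c (dform M f))"
  proof (rule smooth_on_cong[OF open_image[OF c]])
    show "smooth_on (chart_img c) ?g"
      by (intro smooth_on_sum smooth_on_scaleR smooth_on_fderiv smooth_on_const
          open_image[OF c] fun_smooth[OF f c])
    fix x assume "x \<in> chart_img c"
    then obtain p where p: "x = chart_map c p" "p \<in> chart_dom c" by blast
    have lin: "linear (fderiv (f \<circ> chart_inv c) x)"
      using rep_has_derivative(3)[OF c p(2) f] p(1) has_derivative_linear by blast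
    show "?g x = crep c (dform M f) x"
    proof (rule vector_eq_rdot[THEN iffD1], rule allI)
      fix w
      have "crep c (dform M f) x \<bullet> w = fderiv (f \<circ> chart_inv c) x w"
        using c p by (simp add: cot_coord_inner dform_inner[OF f] dfun_chart[OF f c p(2)])
      also have "\<dots> = ?g x \<bullet> w"
        by (subst linear_eq_sum_Basis[OF lin])
          (simp add: sum_scaleR_Basis_inner)
      finally show "?g x \<bullet> w = crep c (dform M f) x \<bullet> w" by simp
    qed
  qed
qed

text \<open>The Jacobian of the transition map enters the derivative of a vector field through second
  derivatives, which cancel in brackets by symmetry.\<close>

lemma trep_derivative_change:
  assumes c: "c \<in> atlas M" "p \<in> chart_dom c" and X: "X \<in> VF"
  defines "c0 \<equiv> chart_at M p"
  shows "fderiv (trep c X) (chart_map c p) (tan_coord M c p h)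
    = fderiv (\<lambda>z. fderiv (transition c0 c) z (X p)) (chart_map c0 p) h
      + tan_coord M c p (fderiv (trep c0 X) (chart_map c0 p) h)"
proof -
  let ?D = "\<lambda>z. fderiv (transition c0 c) z"
  let ?S = "chart_map c0 ` (chart_dom c0 \<inter> chart_dom c)"
  have c0: "c0 \<in> atlas M" "p \<in> chart_dom c0" by (auto simp: c0_def)
  have S: "open ?S" "chart_map c0 p \<in> ?S" using open_overlap c0 c by auto
  note tr = smooth_transition[OF c0(1) c(1)]
  have lin: "linear (?D z)" if "z \<in> ?S" for z
    using smooth_on_differentiable[OF tr that] by (rule linear_frechet_derivative)
  have Dx: "?D (chart_map c0 p) = tan_coord M c p" and ch: "chart_change c0 c p = tan_coord M c p"
    by (simp_all add: tan_coord_def chart_change_def c0_def fun_eq_iff)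
  have X0: "tan_coord M c0 p v = v" for v by (simp add: c0_def)
  have 1: "((\<lambda>z. ?D z (trep c0 X z)) has_derivative
      (\<lambda>h. fderiv (\<lambda>z. ?D z (trep c0 X (chart_map c0 p))) (chart_map c0 p) h
         + ?D (chart_map c0 p) (fderiv (trep c0 X) (chart_map c0 p) h)))
      (at (chart_map c0 p))"
    by (rule has_derivative_linear_apply[OF S lin])
      (use smooth_on_differentiable[OF smooth_on_fderiv[OF tr] S(2)]
        rep_has_derivative(1)[OF c0 X] in auto)
  have "((\<lambda>z. trep c X (transition c0 c z)) has_derivative
      (\<lambda>h. fderiv (trep c X) (chart_map c p) (chart_change c0 c p h)))
      (at (chart_map c0 p))"
    by (rule has_derivative_compose[of "transition c0 c"])
      (use transition_has_derivative[OF c0(1) c(1) c0(2) c(2)] rep_has_derivative(1)[OF c X] c0 in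
        \<open>simp_all add: o_apply[of _ _ "chart_map _ p"] del: o_apply\<close>)
  then have 2: "((\<lambda>z. ?D z (trep c0 X z)) has_derivative
      (\<lambda>h. fderiv (trep c X) (chart_map c p) (chart_change c0 c p h)))
      (at (chart_map c0 p))"
    by (rule has_derivative_local[OF _ S]) (rule trep_transition[OF c0(1) c(1)])
  \<comment> \<open>\<open>1\<close> is the product rule for the Jacobian applied to the
    coefficients in the preferred chart, \<open>2\<close> the chain rule for the coefficients in c;
    both differentiate the same function.\<close>
  show ?thesis
    using fun_cong[OF has_derivative_unique[OF 2 1], of h] c0
    by (simp add: Dx X0 ch)
qed

lemma transition_symmetric:
  assumes c: "c \<in> atlas M" "p \<in> chart_dom c"
  defines "c0 \<equiv> chart_at M p"
  shows "fderiv (\<lambda>z. fderiv (transition c0 c) z v) (chart_map c0 p) w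
    = fderiv (\<lambda>z. fderiv (transition c0 c) z w) (chart_map c0 p) v"
  by (rule second_derivative_symmetric[OF open_overlap smooth_transition])
    (use c in \<open>auto simp: c0_def\<close>)

lemma lie_bracket_chart:
  assumes c: "c \<in> atlas M" "p \<in> chart_dom c" and X: "X \<in> VF" and Y: "Y \<in> VF"
  shows "tan_coord M c p (lie_bracket M X Y p)
    = fderiv (trep c Y) (chart_map c p) (tan_coord M c p (X p))
      - fderiv (trep c X) (chart_map c p) (tan_coord M c p (Y p))"
  unfolding trep_derivative_change[OF c X] trep_derivative_change[OF c Y] lie_bracket_def Let_def
  using transition_symmetric[OF c, of "X p" "Y p"]
  by (simp add: linear_diff[OF linear_tan_coord[OF c]])

text \<open>With a vector v fixed in the preferred chart, differentiating the invariance of the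
  pairing of \<eta> with v yields a second derivative of the transition map in the directions v and
  X p, paired with \<eta>. The change of the derivative of X contributes the same term with the
  opposite sign.\<close>

lemma lie_deriv_form_chart:
  assumes c: "c \<in> atlas M" "p \<in> chart_dom c" and X: "X \<in> VF" and \<eta>: "\<eta> \<in> one_forms M"
  shows "cot_coord M c p (lie_deriv_form M X \<eta> p) \<bullet> w
    = fderiv (crep c \<eta>) (chart_map c p) (tan_coord M c p (X p)) \<bullet> w
      + cot_coord M c p (\<eta> p) \<bullet> fderiv (trep c X) (chart_map c p) w"
proof -
  define c0 where "c0 = chart_at M p"
  let ?x = "chart_map c0 p" and ?D = "\<lambda>z. fderiv (transition c0 c) z"
  let ?S = "chart_map c0 ` (chart_dom c0 \<inter> chart_dom c)"
  have c0: "c0 \<in> atlas M" "p \<in> chart_dom c0" by (auto simp: c0_def)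
  have S: "open ?S" "?x \<in> ?S" using open_overlap c0 c by auto
  note tr = smooth_transition[OF c0(1) c(1)]
  have lin: "linear (?D z)" if "z \<in> ?S" for z
    using smooth_on_differentiable[OF tr that] by (rule linear_frechet_derivative)
  define v where "v = chart_change c (chart_at M p) p w"
  have w: "w = tan_coord M c p v" using c by (simp add: v_def)
  have Dx: "?D ?x = tan_coord M c p" by (simp add: tan_coord_def chart_change_def c0_def fun_eq_iff)
  have "((\<lambda>z. crep c \<eta> (transition c0 c z)) has_derivative
      (\<lambda>h. fderiv (crep c \<eta>) (chart_map c p) (chart_change c0 c p h))) (at ?x)"
    by (rule has_derivative_compose[of "transition c0 c"])
      (use transition_has_derivative[OF c0(1) c(1) c0(2) c(2)] rep_has_derivative(2)[OF c \<eta>] c0 in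
        \<open>simp_all add: o_apply[of _ _ "chart_map _ p"] del: o_apply\<close>)
  moreover have "((\<lambda>z. ?D z v) has_derivative fderiv (\<lambda>z. ?D z v) ?x) (at ?x)"
    by (rule smooth_on_fderiv_at[OF smooth_on_fderiv[OF tr] S(2)])
  ultimately have "((\<lambda>z. crep c \<eta> (transition c0 c z) \<bullet> ?D z v) has_derivative
      (\<lambda>h. crep c \<eta> (transition c0 c ?x) \<bullet> fderiv (\<lambda>z. ?D z v) ?x h
         + fderiv (crep c \<eta>) (chart_map c p) (chart_change c0 c p h) \<bullet> ?D ?x v)) (at ?x)"
    by (rule has_derivative_inner)
  then have 1: "((\<lambda>z. crep c0 \<eta> z \<bullet> v) has_derivative
      (\<lambda>h. crep c \<eta> (transition c0 c ?x) \<bullet> fderiv (\<lambda>z. ?D z v) ?x h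
         + fderiv (crep c \<eta>) (chart_map c p) (chart_change c0 c p h) \<bullet> ?D ?x v)) (at ?x)"
  proof (rule has_derivative_local[OF _ S])
    fix z assume z: "z \<in> ?S"
    show "crep c \<eta> (transition c0 c z) \<bullet> ?D z v = crep c0 \<eta> z \<bullet> v"
      by (simp only: crep_transition[OF c0(1) c(1) z] adjoint_inner[OF lin[OF z]])
  qed
  have 2: "((\<lambda>z. crep c0 \<eta> z \<bullet> v) has_derivative
      (\<lambda>h. fderiv (crep c0 \<eta>) ?x h \<bullet> v)) (at ?x)"
    by (intro has_derivative_inner_left rep_has_derivative(2)[OF c0 \<eta>])
  have *: "fderiv (crep c0 \<eta>) ?x (X p) \<bullet> v
    = cot_coord M c p (\<eta> p) \<bullet> fderiv (\<lambda>z. ?D z v) ?x (X p)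
      + fderiv (crep c \<eta>) (chart_map c p) (tan_coord M c p (X p)) \<bullet> w"
    using fun_cong[OF has_derivative_unique[OF 2 1], of "X p"] c0 c
    by (simp add: Dx w tan_coord_def[of _ _ p] flip: c0_def)
  have linX: "linear (fderiv (trep c0 X) ?x)"
    using rep_has_derivative(1)[OF c0 X] has_derivative_linear by blast
  have "cot_coord M c p (lie_deriv_form M X \<eta> p) \<bullet> w = lie_deriv_form M X \<eta> p \<bullet> v"
    unfolding w using c by simp
  also have "\<dots> = fderiv (crep c0 \<eta>) ?x (X p) \<bullet> v
      + \<eta> p \<bullet> fderiv (trep c0 X) ?x v"
    using linX by (simp add: lie_deriv_form_def Let_def c0_def inner_add_left adjoint_inner)
  also have "\<eta> p \<bullet> fderiv (trep c0 X) ?x v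
      = cot_coord M c p (\<eta> p) \<bullet> tan_coord M c p (fderiv (trep c0 X) ?x v)"
    using c by simp
  also have "tan_coord M c p (fderiv (trep c0 X) ?x v)
      = fderiv (trep c X) (chart_map c p) w - fderiv (\<lambda>z. ?D z (X p)) ?x v"
    unfolding w using trep_derivative_change[OF c X, of v] by (simp add: c0_def)
  finally show ?thesis
    using * transition_symmetric[OF c, of v "X p"] by (simp add: inner_diff_right c0_def)
qed

text \<open>The definition uses another chart at each point, so smoothness is read off from the
  formula in the fixed chart c.\<close>

lemma lie_bracket_smooth:
  assumes X: "X \<in> VF" and Y: "Y \<in> VF"
  shows "lie_bracket M X Y \<in> VF"
  unfolding vector_fields_iff
proof
  fix c assume c: "c \<in> atlas M"
  show "smooth_on (chart_img c) (trep c (lie_bracket M X Y))"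
  proof (rule smooth_on_cong[OF open_image[OF c]])
    show "smooth_on (chart_img c)
      (\<lambda>x. fderiv (trep c Y) x (trep c X x) - fderiv (trep c X) x (trep c Y x))"
      by (intro smooth_on_diff smooth_on_fderiv_apply open_image trep_smooth c X Y)
  qed (use c in \<open>auto simp: lie_bracket_chart[OF c _ X Y]\<close>)
qed

lemma lie_deriv_form_smooth:
  assumes X: "X \<in> VF" and \<eta>: "\<eta> \<in> one_forms M"
  shows "lie_deriv_form M X \<eta> \<in> one_forms M"
  unfolding one_forms_iff
proof
  fix c assume c: "c \<in> atlas M"
  have lin: "linear (fderiv (trep c X) x)" if "x \<in> chart_img c" for x
    using smooth_on_differentiable[OF trep_smooth[OF X c] that] by (rule linear_frechet_derivative)
  let ?g = "\<lambda>x. fderiv (crep c \<eta>) x (trep c X x)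
      + adjoint (fderiv (trep c X) x) (crep c \<eta> x)"
  show "smooth_on (chart_img c) (crep c (lie_deriv_form M X \<eta>))"
  proof (rule smooth_on_cong[OF open_image[OF c]])
    show "smooth_on (chart_img c) ?g"
      by (intro smooth_on_add smooth_on_fderiv_apply smooth_on_adjoint_apply lin
          smooth_on_fderiv open_image trep_smooth crep_smooth c X \<eta>)
    fix x assume x: "x \<in> chart_img c"
    then obtain p where p: "x = chart_map c p" "p \<in> chart_dom c" by blast
    show "?g x = crep c (lie_deriv_form M X \<eta>) x"
    proof (rule vector_eq_rdot[THEN iffD1], rule allI)
      fix w
      show "?g x \<bullet> w = crep c (lie_deriv_form M X \<eta>) x \<bullet> w"
        using lie_deriv_form_chart[OF c p(2) X \<eta>, of w] lin[OF x] c p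
        by (simp add: inner_add_left adjoint_inner)
    qed
  qed
qed

lemma lie_bracket_swap: "lie_bracket M Y X p = - lie_bracket M X Y p"
  by (simp add: lie_bracket_def Let_def)

text \<open>This form of the Lie derivative no longer refers to charts; the Courant bracket is later
  evaluated on vector fields through it.\<close>

lemma lie_deriv_form_pairing:
  assumes X: "X \<in> VF" and \<eta>: "\<eta> \<in> one_forms M" and Z: "Z \<in> VF"
  shows "lie_deriv_form M X \<eta> p \<bullet> Z p
    = dfun M (\<lambda>q. \<eta> q \<bullet> Z q) p (X p) - \<eta> p \<bullet> lie_bracket M X Z p"
  using lie_deriv_form_chart[OF chart_at X \<eta>, of p "Z p"]
    dfun_pairing[OF chart_at \<eta> Z, of p "X p"]
  by (simp add: lie_bracket_def Let_def inner_diff_right)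

end


subsection \<open>The Nijenhuis tensor\<close>

context smooth_atlas
begin

definition endo_rep :: "('m, 'v) chart \<Rightarrow> ('m \<Rightarrow> 'v \<Rightarrow> 'v) \<Rightarrow> 'v \<Rightarrow> 'v \<Rightarrow> 'v" where
  "endo_rep c J x w = trep c (\<lambda>q. J q (inv (tan_coord M c q) w)) x"

lemma endo_rep_smooth:
  "almost_complex_structure M J \<Longrightarrow> c \<in> atlas M \<Longrightarrow> smooth_on (chart_img c) (\<lambda>x. endo_rep c J x w)"
  by (simp add: almost_complex_structure_def smooth_endo_def endo_rep_def)

lemma endo_rep_apply:
  assumes "c \<in> atlas M" "x \<in> chart_img c"
  shows "endo_rep c J x (trep c A x) = trep c (\<lambda>q. J q (A q)) x"
  using assms by (simp add: endo_rep_def section_rep_def inv_tan_coord)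

lemma linear_endo_rep:
  assumes "almost_complex_structure M J" "c \<in> atlas M" "x \<in> chart_img c"
  shows "linear (endo_rep c J x)"
proof -
  let ?p = "chart_inv c x"
  have "endo_rep c J x = tan_coord M c ?p \<circ> J ?p \<circ> chart_change c (chart_at M ?p) ?p"
    using assms by (simp add: fun_eq_iff endo_rep_def section_rep_def inv_tan_coord)
  moreover have "linear (J ?p)" using assms(1) by (simp add: almost_complex_structure_def)
  ultimately show ?thesis
    using assms by (simp add: linear_compose linear_chart_change linear_tan_coord)
qed

text \<open>In the preferred chart the derivatives of A and B cancel because J^2 = -1. Only the
  values of A and B at u and the derivative \<open>P\<close> of the matrix of J remain, which is the
  tensoriality of the Nijenhuis tensor.\<close>

lemma nijenhuis_formula:
  assumes J: "almost_complex_structure M J"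
    and A: "A \<in> VF" and B: "B \<in> VF"
  defines "P \<equiv> \<lambda>u a. fderiv (\<lambda>z. endo_rep (chart_at M u) J z a) (chart_map (chart_at M u) u)"
  shows "nijenhuis M J A B u
    = P u (B u) (J u (A u)) - P u (A u) (J u (B u)) + J u (P u (A u) (B u)) - J u (P u (B u) (A u))"
proof -
  define c where "c = chart_at M u"
  let ?x = "chart_map c u" and ?S = "chart_img c"
  have c: "c \<in> atlas M" "u \<in> chart_dom c" by (auto simp: c_def)
  have S: "open ?S" "?x \<in> ?S" using c open_image by auto
  have t: "tan_coord M c u v = v" for v by (simp add: c_def)
  have Jx: "endo_rep c J ?x w = J u w" for w
    using c by (simp add: endo_rep_def inv_tan_coord t) (simp add: c_def chart_change_self)
  have linJ: "linear (J u)" and J2: "J u (J u w) = - w" for w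
    using J by (auto simp: almost_complex_structure_def)
  have der: "fderiv (trep c (\<lambda>q. J q (V q))) ?x h
      = P u (V u) h + J u (fderiv (trep c V) ?x h)" if V: "V \<in> VF" for V h
  proof -
    have "((\<lambda>z. endo_rep c J z (trep c V z)) has_derivative
      (\<lambda>h. fderiv (\<lambda>z. endo_rep c J z (trep c V ?x)) ?x h
         + endo_rep c J ?x (fderiv (trep c V) ?x h))) (at ?x)"
      by (rule has_derivative_linear_apply[OF S linear_endo_rep[OF J c(1)]])
        (use smooth_on_differentiable[OF endo_rep_smooth[OF J c(1)] S(2)]
          rep_has_derivative(1)[OF c V] in auto)
    then have "((\<lambda>z. endo_rep c J z (trep c V z)) has_derivative
      (\<lambda>h. P u (V u) h + J u (fderiv (trep c V) ?x h))) (at ?x)"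
      using c by (simp add: Jx t P_def flip: c_def)
    from has_derivative_local[OF this S endo_rep_apply[OF c(1)]]
    show ?thesis by (simp add: fderiv_eqI)
  qed
  show ?thesis
    unfolding nijenhuis_def lie_bracket_def Let_def c_def[symmetric]
    by (simp add: der A B linear_add[OF linJ] linear_diff[OF linJ] J2)
qed

lemma nijenhuis_tensorial:
  assumes "almost_complex_structure M J"
    and "A \<in> VF" "A' \<in> VF" "B \<in> VF" "B' \<in> VF"
    and "A u = A' u" "B u = B' u"
  shows "nijenhuis M J A B u = nijenhuis M J A' B' u"
  using assms by (simp add: nijenhuis_formula)

end


section \<open>Smooth manifolds and cut-off functions\<close>

locale smooth_mfd =
  fixes M :: "('m, 'v::euclidean_space) charted_space"
  assumes smooth_manifold: "smooth_manifold M"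

sublocale smooth_mfd \<subseteq> smooth_atlas M
  using smooth_manifold unfolding smooth_manifold_def by unfold_locales (blast+)

context smooth_mfd
begin

text \<open>\<open>topology\<close> yields the intended open sets only after the predicate is known
  to satisfy the axioms. Injectivity of the charts enters for intersections.\<close>

lemma openin_mfd_topology:
  "openin (mfd_topology M) W \<longleftrightarrow> (\<forall>c\<in>atlas M. open (chart_map c ` (W \<inter> chart_dom c)))"
proof -
  have "istopology (\<lambda>W. \<forall>c\<in>atlas M. open (chart_map c ` (W \<inter> chart_dom c)))"
    unfolding istopology_def
  proof (intro conjI allI impI ballI)
    fix S T c assume S: "\<forall>c\<in>atlas M. open (chart_map c ` (S \<inter> chart_dom c))"
      and T: "\<forall>c\<in>atlas M. open (chart_map c ` (T \<inter> chart_dom c))" and c: "c \<in> atlas M"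
    have "chart_map c ` (S \<inter> T \<inter> chart_dom c)
        = chart_map c ` (S \<inter> chart_dom c) \<inter> chart_map c ` (T \<inter> chart_dom c)"
      by (subst image_Int[OF c, symmetric]) (auto intro: arg_cong[where f = "image _"])
    then show "open (chart_map c ` (S \<inter> T \<inter> chart_dom c))" using S T c by auto
  next
    fix K c assume K: "\<forall>S\<in>K. \<forall>c\<in>atlas M. open (chart_map c ` (S \<inter> chart_dom c))" and c: "c \<in> atlas M"
    have "chart_map c ` (\<Union>K \<inter> chart_dom c) = (\<Union>S\<in>K. chart_map c ` (S \<inter> chart_dom c))" by auto
    then show "open (chart_map c ` (\<Union>K \<inter> chart_dom c))" using K c by auto
  qed
  then show ?thesis by (simp add: mfd_topology_def topology_inverse')
qed

lemma topspace_mfd_topology [simp]: "topspace (mfd_topology M) = UNIV"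
proof -
  have "openin (mfd_topology M) UNIV" by (simp add: openin_mfd_topology open_image)
  from openin_subset[OF this] show ?thesis by blast
qed

text \<open>The condition on the support is phrased by an open set W that, together with the chart
  domain, covers the manifold and on which \<beta> vanishes. Near a point outside the domain
  everything multiplied by \<beta> is then zero, as extension by zero requires.\<close>

definition is_bump :: "('m, 'v) chart \<Rightarrow> 'm \<Rightarrow> ('m \<Rightarrow> real) \<Rightarrow> 'v set \<Rightarrow> bool" where
  "is_bump c q \<beta> N \<longleftrightarrow> smooth_fun \<beta> \<and>
     (\<exists>W. openin (mfd_topology M) W \<and> W \<union> chart_dom c = UNIV \<and> (\<forall>r\<in>W. \<beta> r = 0)) \<and>
     open N \<and> chart_map c q \<in> N \<and> N \<subseteq> chart_img c \<and> (\<forall>x\<in>N. \<beta> (chart_inv c x) = 1)"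

text \<open>A compact ball in a chart is closed in the manifold because the latter is Hausdorff.\<close>

lemma bump_exists:
  assumes c: "c \<in> atlas M" and q: "q \<in> chart_dom c"
  obtains \<beta> N where "is_bump c q \<beta> N"
proof -
  let ?S = "chart_img c" and ?T = "mfd_topology M"
  obtain e where e: "e > 0" "cball (chart_map c q) e \<subseteq> ?S"
    using open_image[OF c] q open_contains_cball by blast
  obtain \<psi> :: "'v \<Rightarrow> real" where \<psi>: "smooth_on UNIV \<psi>" "\<And>x. x \<in> ball (chart_map c q) (e/2) \<Longrightarrow> \<psi> x = 1"
    "\<And>x. x \<notin> ball (chart_map c q) e \<Longrightarrow> \<psi> x = 0"
    using smooth_bump_exists[of "e/2" e "chart_map c q"] e(1) by auto
  define K where "K = chart_inv c ` cball (chart_map c q) e"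
  \<comment> \<open>The preimage of an open W is the chart image of its part in the domain, which is
    open by the definition of the topology.\<close>
  have "continuous_map (top_of_set ?S) ?T (chart_inv c)"
    unfolding continuous_map
  proof (intro conjI allI impI)
    fix W assume W: "openin ?T W"
    have "{x \<in> topspace (top_of_set ?S). chart_inv c x \<in> W} = chart_map c ` (W \<inter> chart_dom c)"
      using c by (force simp: image_iff)
    moreover have "open (chart_map c ` (W \<inter> chart_dom c))" using W c by (simp add: openin_mfd_topology)
    ultimately show "openin (top_of_set ?S) {x \<in> topspace (top_of_set ?S). chart_inv c x \<in> W}"
      by (simp add: openin_open_eq[OF open_image[OF c]] image_mono)
  qed auto
  moreover have "compactin (top_of_set ?S) (cball (chart_map c q) e)"
    using e by (simp add: compactin_subtopology)
  ultimately have "compactin ?T K" unfolding K_def by (rule image_compactin[rotated])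
  moreover have "Hausdorff_space ?T" using smooth_manifold by (simp add: smooth_manifold_def)
  ultimately have "closedin ?T K" by (rule compactin_imp_closedin[rotated])
  then have W: "openin ?T (- K)" by (simp add: closedin_def Compl_eq_Diff_UNIV)
  have Kdom: "K \<subseteq> chart_dom c" using e by (auto simp: K_def)
  define \<beta> where "\<beta> r = (if r \<in> chart_dom c then \<psi> (chart_map c r) else 0)" for r
  have \<beta>0: "\<beta> r = 0" if "r \<notin> K" for r
  proof (cases "r \<in> chart_dom c")
    case True
    then have "chart_map c r \<notin> cball (chart_map c q) e"
      using that c unfolding K_def by (metis chart_inv_map image_eqI)
    then show ?thesis using \<psi>(3)[of "chart_map c r"] by (auto simp: \<beta>_def)
  qed (simp add: \<beta>_def)
  have "smooth_fun \<beta>"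
  proof (rule smooth_funI)
    fix r
    show "\<exists>c N. chart_nbhd r c N \<and> smooth_on N (\<beta> \<circ> chart_inv c)"
    proof (cases "r \<in> chart_dom c")
      case True
      have "smooth_on ?S (\<beta> \<circ> chart_inv c)"
        by (rule smooth_on_cong[OF open_image[OF c] smooth_on_subset[OF \<psi>(1)]])
          (use c in \<open>auto simp: \<beta>_def\<close>)
      then show ?thesis using True c open_image by blast
    next
      case False
      let ?c = "chart_at M r"
      let ?N = "chart_map ?c ` (- K \<inter> chart_dom ?c)"
      have N: "open ?N" using W by (simp add: openin_mfd_topology)
      have "smooth_on ?N (\<beta> \<circ> chart_inv ?c)"
        by (rule smooth_on_cong[OF N smooth_on_const[of _ 0]]) (auto simp: \<beta>0)
      then show ?thesis using N False Kdom
        by (intro exI[of _ ?c] exI[of _ ?N]) auto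
    qed
  qed
  then have "is_bump c q \<beta> (ball (chart_map c q) (e/2))"
    unfolding is_bump_def
  proof (intro conjI exI[of _ "- K"])
    have sub: "ball (chart_map c q) (e/2) \<subseteq> ?S"
    proof -
      have "ball (chart_map c q) (e/2) \<subseteq> cball (chart_map c q) e" using e(1) by auto
      then show ?thesis using e(2) by blast
    qed
    show "ball (chart_map c q) (e/2) \<subseteq> ?S" by (rule sub)
    show "\<forall>x\<in>ball (chart_map c q) (e/2). \<beta> (chart_inv c x) = 1"
      using sub \<psi>(2) by (auto simp: \<beta>_def subset_iff)
  qed (use W Kdom \<beta>0 e in auto)
  then show thesis by (rule that)
qed

definition cut_vec :: "('m, 'v) chart \<Rightarrow> ('m \<Rightarrow> real) \<Rightarrow> ('v \<Rightarrow> 'v) \<Rightarrow> 'm \<Rightarrow> 'v" where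
  "cut_vec c \<beta> V q = (if q \<in> chart_dom c then \<beta> q *\<^sub>R inv (tan_coord M c q) (V (chart_map c q)) else 0)"

definition cut_form :: "('m, 'v) chart \<Rightarrow> ('m \<Rightarrow> real) \<Rightarrow> ('v \<Rightarrow> 'v) \<Rightarrow> 'm \<Rightarrow> 'v" where
  "cut_form c \<beta> V q = (if q \<in> chart_dom c then \<beta> q *\<^sub>R inv (cot_coord M c q) (V (chart_map c q)) else 0)"

definition cut_fun :: "('m, 'v) chart \<Rightarrow> ('m \<Rightarrow> real) \<Rightarrow> ('v \<Rightarrow> real) \<Rightarrow> 'm \<Rightarrow> real" where
  "cut_fun c \<beta> V q = (if q \<in> chart_dom c then \<beta> q * V (chart_map c q) else 0)"

lemma cut_rep:
  assumes "c \<in> atlas M" "x \<in> chart_img c"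
  shows "trep c (cut_vec c \<beta> V) x = \<beta> (chart_inv c x) *\<^sub>R V x"
    and "crep c (cut_form c \<beta> V) x = \<beta> (chart_inv c x) *\<^sub>R V x"
    and "(cut_fun c \<beta> f \<circ> chart_inv c) x = \<beta> (chart_inv c x) * f x"
  using assms by (simp_all add: section_rep_def cut_vec_def cut_form_def cut_fun_def inv_tan_coord
      inv_cot_coord linear_scale[OF linear_tan_coord] linear_scale[OF linear_cot_coord])

text \<open>A point lies either in the chart domain, where the coefficients are known, or in the
  open set on which \<beta> vanishes, where they are all zero in whatever chart is used.\<close>

lemma cut_smooth_aux:
  assumes c: "c \<in> atlas M" and \<beta>: "is_bump c q \<beta> N"
    and in_chart: "P c (chart_img c)"
    and vanishing: "\<And>c N. c \<in> atlas M \<Longrightarrow> open N \<Longrightarrow> N \<subseteq> chart_img c \<Longrightarrow>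
      (\<And>x. x \<in> N \<Longrightarrow> \<beta> (chart_inv c x) = 0) \<Longrightarrow> P c N"
  shows "\<exists>c N. chart_nbhd r c N \<and> P c N"
proof (cases "r \<in> chart_dom c")
  case True
  then show ?thesis using c in_chart open_image by blast
next
  case False
  obtain W where W: "openin (mfd_topology M) W" "W \<union> chart_dom c = UNIV" "\<forall>r\<in>W. \<beta> r = 0"
    using \<beta> by (auto simp: is_bump_def)
  let ?c = "chart_at M r"
  let ?N = "chart_map ?c ` (W \<inter> chart_dom ?c)"
  have N: "open ?N" using W by (simp add: openin_mfd_topology)
  have "P ?c ?N" using W(3) by (intro vanishing N) auto
  moreover have "r \<in> W" using False W(2) by blast
  ultimately show ?thesis using N by (intro exI[of _ ?c] exI[of _ ?N]) auto
qed

lemma cut_smooth: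
  assumes c: "c \<in> atlas M" and \<beta>: "is_bump c q \<beta> N"
  shows "smooth_on (chart_img c) V \<Longrightarrow> cut_vec c \<beta> V \<in> VF"
    and "smooth_on (chart_img c) V \<Longrightarrow> cut_form c \<beta> V \<in> one_forms M"
    and "smooth_on (chart_img c) f \<Longrightarrow> smooth_fun (cut_fun c \<beta> f)"
proof -
  have \<beta>s: "smooth_on (chart_img c) (\<lambda>x. \<beta> (chart_inv c x))"
    using \<beta> c fun_smooth[of \<beta> c] by (simp add: is_bump_def o_def)
  note op = open_image[OF c]
  have zero: "smooth_on N g" if "open N" "\<And>x. x \<in> N \<Longrightarrow> g x = 0"
    for g :: "'v \<Rightarrow> 'w::real_normed_vector" and N
    by (rule smooth_on_cong[OF that(1) smooth_on_const[of _ 0]]) (simp add: that(2))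
  show "cut_vec c \<beta> V \<in> VF" if V: "smooth_on (chart_img c) V"
  proof (rule vector_fieldsI, rule cut_smooth_aux[OF c \<beta>, where P = "\<lambda>c' N. smooth_on N (trep c' (cut_vec c \<beta> V))"])
    show "smooth_on (chart_img c) (trep c (cut_vec c \<beta> V))"
      by (rule smooth_on_cong[OF op smooth_on_scaleR[OF op \<beta>s V]]) (simp add: cut_rep(1)[OF c])
  qed (erule zero, auto simp: section_rep_def cut_vec_def linear_0[OF linear_tan_coord] subset_iff)
  show "cut_form c \<beta> V \<in> one_forms M" if V: "smooth_on (chart_img c) V"
  proof (rule one_formsI, rule cut_smooth_aux[OF c \<beta>, where P = "\<lambda>c' N. smooth_on N (crep c' (cut_form c \<beta> V))"])
    show "smooth_on (chart_img c) (crep c (cut_form c \<beta> V))"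
      by (rule smooth_on_cong[OF op smooth_on_scaleR[OF op \<beta>s V]]) (simp add: cut_rep(2)[OF c])
  qed (erule zero, auto simp: section_rep_def cut_form_def linear_0[OF linear_cot_coord] subset_iff)
  show "smooth_fun (cut_fun c \<beta> f)" if V: "smooth_on (chart_img c) f"
  proof (rule smooth_funI, rule cut_smooth_aux[OF c \<beta>, where P = "\<lambda>c' N. smooth_on N (cut_fun c \<beta> f \<circ> chart_inv c')"])
    show "smooth_on (chart_img c) (cut_fun c \<beta> f \<circ> chart_inv c)"
      by (rule smooth_on_cong[OF op smooth_on_mult[OF op \<beta>s V]]) (simp only: cut_rep(3)[OF c])
  qed (erule zero, auto simp: cut_fun_def)
qed

section \<open>Global fields with prescribed germs or prescribed values\<close>

lemma extend_vector_field:
  assumes c: "c \<in> atlas M" "q \<in> chart_dom c" and V: "smooth_on (chart_img c) V"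
  obtains X N where "X \<in> VF" "open N" "chart_map c q \<in> N" "N \<subseteq> chart_img c"
    "\<And>x. x \<in> N \<Longrightarrow> trep c X x = V x"
proof -
  obtain \<beta> N where \<beta>: "is_bump c q \<beta> N" using bump_exists[OF c] .
  show thesis
    by (rule that[OF cut_smooth(1)[OF c(1) \<beta> V], of N])
      (use \<beta> in \<open>auto simp: is_bump_def subset_iff cut_rep(1)[OF c(1)]\<close>)
qed

lemma extend_one_form:
  assumes c: "c \<in> atlas M" "q \<in> chart_dom c" and V: "smooth_on (chart_img c) V"
  obtains \<xi> N where "\<xi> \<in> one_forms M" "open N" "chart_map c q \<in> N" "N \<subseteq> chart_img c"
    "\<And>x. x \<in> N \<Longrightarrow> crep c \<xi> x = V x"
proof -
  obtain \<beta> N where \<beta>: "is_bump c q \<beta> N" using bump_exists[OF c] .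
  show thesis
    by (rule that[OF cut_smooth(2)[OF c(1) \<beta> V], of N])
      (use \<beta> in \<open>auto simp: is_bump_def subset_iff cut_rep(2)[OF c(1)]\<close>)
qed

lemma vector_field_through:
  obtains X where "X \<in> VF" "X p = v"
proof -
  let ?c = "chart_at M p"
  obtain X N where X: "X \<in> VF" "chart_map ?c p \<in> N" "\<And>x. x \<in> N \<Longrightarrow> trep ?c X x = v"
    using extend_vector_field[OF chart_at smooth_on_const[of _ v], of p] by metis
  show thesis using that[OF X(1)] X(3)[OF X(2)] by simp
qed

lemma one_form_through:
  obtains \<xi> where "\<xi> \<in> one_forms M" "\<xi> p = y"
proof -
  let ?c = "chart_at M p"
  obtain X N where X: "X \<in> one_forms M" "chart_map ?c p \<in> N" "\<And>x. x \<in> N \<Longrightarrow> crep ?c X x = y"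
    using extend_one_form[OF chart_at smooth_on_const[of _ y], of p] by metis
  show thesis using that[OF X(1)] X(3)[OF X(2)] by simp
qed

lemma gen_field_through:
  obtains u where "u \<in> gen_fields" "u p = z"
proof -
  obtain X \<xi> where "X \<in> VF" "X p = fst z" "\<xi> \<in> one_forms M" "\<xi> p = snd z"
    using vector_field_through one_form_through by metis
  then show thesis using that[of "\<lambda>q. (X q, \<xi> q)"] by (simp add: gen_fields_iff)
qed

end


section \<open>Linear connections in coordinates\<close>

text \<open>\<open>g i j\<close> is the vector of Christoffel symbols of the basis vectors i and j,
  and \<open>chr g\<close> is its bilinear extension. Only pairs from \<open>Basis\<close> enter the
  sum, which is why smoothness of the symbols is demanded for these.\<close>

definition chr :: "('v \<Rightarrow> 'v \<Rightarrow> 'v) \<Rightarrow> 'v \<Rightarrow> 'v \<Rightarrow> 'v::euclidean_space" where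
  "chr g v w = (\<Sum>i\<in>Basis. \<Sum>j\<in>Basis. ((v \<bullet> i) * (w \<bullet> j)) *\<^sub>R g i j)"

lemma chr_add_left: "chr g (v + v') w = chr g v w + chr g v' w"
  by (simp add: chr_def inner_add_left distrib_right scaleR_add_left sum.distrib)

lemma chr_add_right: "chr g v (w + w') = chr g v w + chr g v w'"
  by (simp add: chr_def inner_add_left distrib_left scaleR_add_left sum.distrib)

lemma chr_scale_left: "chr g (k *\<^sub>R v) w = k *\<^sub>R chr g v w"
  by (simp add: chr_def scaleR_sum_right mult.assoc)

lemma chr_scale_right: "chr g v (k *\<^sub>R w) = k *\<^sub>R chr g v w"
  by (simp add: chr_def scaleR_sum_right mult.assoc mult.left_commute)

lemma linear_chr: "linear (chr g v)" "linear (\<lambda>v. chr g v w)"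
  by (rule linearI; simp add: chr_add_left chr_add_right chr_scale_left chr_scale_right)+

lemma chr_has_derivative:
  fixes g :: "'a::euclidean_space \<Rightarrow> 'v \<Rightarrow> 'v \<Rightarrow> 'v::euclidean_space"
  assumes "\<And>i j. i \<in> Basis \<Longrightarrow> j \<in> Basis \<Longrightarrow> ((\<lambda>x. g x i j) has_derivative (\<lambda>h. g' h i j)) (at x)"
    and "(v has_derivative v') (at x)" "(w has_derivative w') (at x)"
  shows "((\<lambda>x. chr (g x) (v x) (w x)) has_derivative
    (\<lambda>h. chr (g' h) (v x) (w x) + chr (g x) (v' h) (w x) + chr (g x) (v x) (w' h))) (at x)"
  unfolding chr_def
  by (rule has_derivative_eq_rhs, (rule has_derivative_sum has_derivative_scaleR has_derivative_mult
        has_derivative_inner_left assms | assumption)+)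
    (simp add: fun_eq_iff scaleR_add_left sum.distrib algebra_simps)

lemma chr_smooth:
  fixes g :: "'a::euclidean_space \<Rightarrow> 'v \<Rightarrow> 'v \<Rightarrow> 'v::euclidean_space"
  assumes "open S" "\<And>i j. i \<in> Basis \<Longrightarrow> j \<in> Basis \<Longrightarrow> smooth_on S (\<lambda>x. g x i j)"
    and "smooth_on S v" "smooth_on S w"
  shows "smooth_on S (\<lambda>x. chr (g x) (v x) (w x))"
  unfolding chr_def by (intro smooth_on_sum smooth_on_scaleR smooth_on_mult smooth_on_inner
      smooth_on_const assms)

locale connection = smooth_mfd M for M :: "('m, 'v::euclidean_space) charted_space" +
  fixes D :: "('m \<Rightarrow> 'v) \<Rightarrow> ('m \<Rightarrow> 'v) \<Rightarrow> 'm \<Rightarrow> 'v"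
  assumes linear_connection: "linear_connection M D"
begin

section \<open>Consequences of the axioms of a linear connection\<close>

lemma conn_smooth: "X \<in> VF \<Longrightarrow> Y \<in> VF \<Longrightarrow> D X Y \<in> VF"
  using linear_connection by (simp add: linear_connection_def)

lemma conn_add_left: "X \<in> VF \<Longrightarrow> X' \<in> VF \<Longrightarrow> Y \<in> VF \<Longrightarrow>
    D (\<lambda>q. X q + X' q) Y p = D X Y p + D X' Y p"
  using linear_connection by (simp add: linear_connection_def)

lemma conn_add_right: "X \<in> VF \<Longrightarrow> Y \<in> VF \<Longrightarrow> Y' \<in> VF \<Longrightarrow>
    D X (\<lambda>q. Y q + Y' q) p = D X Y p + D X Y' p"
  using linear_connection by (simp add: linear_connection_def)

lemma conn_scale_left: "smooth_fun f \<Longrightarrow> X \<in> VF \<Longrightarrow> Y \<in> VF \<Longrightarrow>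
    D (\<lambda>q. f q *\<^sub>R X q) Y p = f p *\<^sub>R D X Y p"
  using linear_connection by (simp add: linear_connection_def)

lemma conn_scale_right: "smooth_fun f \<Longrightarrow> X \<in> VF \<Longrightarrow> Y \<in> VF \<Longrightarrow>
    D X (\<lambda>q. f q *\<^sub>R Y q) p = dfun M f p (X p) *\<^sub>R Y p + f p *\<^sub>R D X Y p"
  using linear_connection by (simp add: linear_connection_def)

lemma dfun_const: "dfun M (\<lambda>q. k) p v = 0"
  by (simp add: dfun_def o_def frechet_derivative_const)

lemma conn_diff_left: "X \<in> VF \<Longrightarrow> X' \<in> VF \<Longrightarrow> Y \<in> VF \<Longrightarrow>
    D (\<lambda>q. X q - X' q) Y p = D X Y p - D X' Y p"
  using conn_add_left[of X "\<lambda>q. (-1) *\<^sub>R X' q" Y p] vector_fields_scaleR[OF smooth_fun_const, of X' "-1"]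
    conn_scale_left[OF smooth_fun_const, of X' Y "-1" p] by simp

lemma conn_diff_right: "X \<in> VF \<Longrightarrow> Y \<in> VF \<Longrightarrow> Y' \<in> VF \<Longrightarrow>
    D X (\<lambda>q. Y q - Y' q) p = D X Y p - D X Y' p"
  using conn_add_right[of X Y "\<lambda>q. (-1) *\<^sub>R Y' q" p] vector_fields_scaleR[OF smooth_fun_const, of Y' "-1"]
    conn_scale_right[OF smooth_fun_const, of X Y' "-1" p] by (simp add: dfun_const)

lemma vector_fields_sum:
  "(\<And>i. i \<in> I \<Longrightarrow> F i \<in> VF) \<Longrightarrow> (\<lambda>q. \<Sum>i\<in>I. F i q) \<in> VF"
  by (induction I rule: infinite_finite_induct) (auto simp: vector_fields_zero vector_fields_add)

lemma conn_sum_left: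
  assumes "\<And>i. i \<in> I \<Longrightarrow> F i \<in> VF" "Y \<in> VF"
  shows "D (\<lambda>q. \<Sum>i\<in>I. F i q) Y p = (\<Sum>i\<in>I. D (F i) Y p)"
  using assms
proof (induction I rule: infinite_finite_induct)
  case (insert i I)
  then show ?case by (simp add: conn_add_left vector_fields_sum)
qed (use conn_diff_left[OF vector_fields_zero vector_fields_zero] in simp_all)

lemma conn_sum_right:
  assumes "X \<in> VF" "\<And>i. i \<in> I \<Longrightarrow> F i \<in> VF"
  shows "D X (\<lambda>q. \<Sum>i\<in>I. F i q) p = (\<Sum>i\<in>I. D X (F i) p)"
  using assms
proof (induction I rule: infinite_finite_induct)
  case (insert i I)
  then show ?case by (simp add: conn_add_right vector_fields_sum)
qed (use conn_diff_right[OF _ vector_fields_zero vector_fields_zero] in simp_all)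

text \<open>The coordinate formula for \<open>D\<close> is asked on an open part N of the chart,
  since the symbols are found with a cut-off function and are the true ones only where that function
  is 1.\<close>

definition is_christoffel :: "('m, 'v) chart \<Rightarrow> 'v set \<Rightarrow> ('v \<Rightarrow> 'v \<Rightarrow> 'v \<Rightarrow> 'v) \<Rightarrow> bool" where
  "is_christoffel c N \<Gamma> \<longleftrightarrow> open N \<and> N \<subseteq> chart_img c \<and>
     (\<forall>i\<in>Basis. \<forall>j\<in>Basis. smooth_on N (\<lambda>x. \<Gamma> x i j)) \<and>
     (\<forall>X\<in>VF. \<forall>Y\<in>VF. \<forall>x\<in>N.
        trep c (D X Y) x = fderiv (trep c Y) x (trep c X x) + chr (\<Gamma> x) (trep c X x) (trep c Y x))"

text \<open>With a cut-off function \<open>\<beta>\<close>, the fields \<open>\<beta>\<^sup>2 X\<close> and \<open>\<beta>\<^sup>2 Y\<close> are globally combinations of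
  the cut-off coordinate fields, and \<open>D\<close> does not notice the factor where \<open>\<beta> = 1\<close>.\<close>

lemma christoffel_exists:
  assumes c: "c \<in> atlas M" "q \<in> chart_dom c"
  obtains N \<Gamma> where "chart_map c q \<in> N" "is_christoffel c N \<Gamma>"
proof -
  let ?S = "chart_img c"
  obtain \<beta> N where \<beta>: "is_bump c q \<beta> N" using bump_exists[OF c] .
  have N: "open N" "chart_map c q \<in> N" "N \<subseteq> ?S" and \<beta>1: "\<And>x. x \<in> N \<Longrightarrow> \<beta> (chart_inv c x) = 1"
    and \<beta>s: "smooth_fun \<beta>"
    using \<beta> by (auto simp: is_bump_def)
  define E where "E i = cut_vec c \<beta> (\<lambda>x. i)" for i :: 'v
  define a where "a X i = cut_fun c \<beta> (\<lambda>x. trep c X x \<bullet> i)" for X and i :: 'v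
  have E: "E i \<in> VF" for i
    unfolding E_def by (rule cut_smooth(1)[OF c(1) \<beta> smooth_on_const])
  have a: "smooth_fun (a X i)" if "X \<in> VF" for X i
    unfolding a_def by (rule cut_smooth(3)[OF c(1) \<beta>])
      (intro smooth_on_inner smooth_on_const trep_smooth that c open_image)
  have \<beta>2: "smooth_fun (\<lambda>q. \<beta> q * \<beta> q)"
    unfolding smooth_fun_iff o_def
    using fun_smooth[OF \<beta>s] by (auto intro!: smooth_on_mult open_image simp: o_def)
  \<comment> \<open>Both \<open>a X i\<close> and \<open>E i\<close> carry one factor \<beta>,
    whence the square on the left.\<close>
  have decomp: "(\<lambda>q. (\<beta> q * \<beta> q) *\<^sub>R X q) = (\<lambda>q. \<Sum>i\<in>Basis. a X i q *\<^sub>R E i q)" for X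
  proof
    fix r
    show "(\<beta> r * \<beta> r) *\<^sub>R X r = (\<Sum>i\<in>Basis. a X i r *\<^sub>R E i r)"
    proof (cases "r \<in> chart_dom c")
      case True
      let ?L = "chart_change c (chart_at M r) r"
      have lin: "linear ?L" using c True by (intro linear_chart_change) auto
      have "(\<Sum>i\<in>Basis. a X i r *\<^sub>R E i r)
          = (\<beta> r * \<beta> r) *\<^sub>R (\<Sum>i\<in>Basis. (tan_coord M c r (X r) \<bullet> i) *\<^sub>R ?L i)"
        using c True by (simp add: a_def E_def cut_fun_def cut_vec_def inv_tan_coord scaleR_sum_right mult_ac)
      also have "\<dots> = (\<beta> r * \<beta> r) *\<^sub>R X r"
        using c True by (simp flip: linear_eq_sum_Basis[OF lin])
      finally show ?thesis by simp
    next
      case False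
      then have "\<beta> r = 0" using \<beta> by (auto simp: is_bump_def)
      then show ?thesis using False by (simp add: a_def cut_fun_def)
    qed
  qed
  define \<Gamma> where "\<Gamma> x i j = trep c (D (E i) (E j)) x" for x and i j :: 'v
  have "is_christoffel c N \<Gamma>"
    unfolding is_christoffel_def
  proof (intro conjI ballI)
    show "smooth_on N (\<lambda>x. \<Gamma> x i j)" for i j
      unfolding \<Gamma>_def by (rule smooth_on_subset[OF trep_smooth[OF conn_smooth[OF E E] c(1)] N(3)])
  next
    fix X Y x assume X: "X \<in> VF" and Y: "Y \<in> VF" and x: "x \<in> N"
    define p where "p = chart_inv c x"
    have p: "p \<in> chart_dom c" "chart_map c p = x" using x N by (auto simp: p_def)
    have \<beta>p: "\<beta> p = 1" using \<beta>1[OF x] by (simp add: p_def)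
    note aE = vector_fields_scaleR[OF a E]
    have d\<beta>: "dfun M (\<lambda>q. \<beta> q * \<beta> q) p v = 0" for v
    proof -
      have "((\<lambda>q. \<beta> q * \<beta> q) \<circ> chart_inv c has_derivative (\<lambda>h. 0)) (at x)"
        by (rule has_derivative_local[OF has_derivative_const[of 1] N(1) x])
          (simp add: \<beta>1)
      then show ?thesis using dfun_chart[OF \<beta>2 c(1) p(1)] p(2) by (simp add: fderiv_eqI)
    qed
    have ap: "a V i p = trep c V x \<bullet> i" for V i
      using c p \<beta>p by (simp add: a_def cut_fun_def)
    have da: "dfun M (a V i) p v = fderiv (trep c V) x (tan_coord M c p v) \<bullet> i"
      if V: "V \<in> VF" for V i v
    proof -
      have "((\<lambda>x. trep c V x \<bullet> i) has_derivative (\<lambda>h. fderiv (trep c V) x h \<bullet> i)) (at x)"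
        by (intro has_derivative_inner_left)
          (use rep_has_derivative(1)[OF c(1) p(1) V] p(2) in simp)
      then have "(a V i \<circ> chart_inv c has_derivative (\<lambda>h. fderiv (trep c V) x h \<bullet> i)) (at x)"
        by (rule has_derivative_local[OF _ N(1) x])
          (use N(3) cut_rep(3)[OF c(1)] \<beta>1 in \<open>auto simp: a_def subset_iff\<close>)
      then show ?thesis using dfun_chart[OF a[OF V] c(1) p(1)] p(2) by (simp add: fderiv_eqI)
    qed
    have Ep: "tan_coord M c p (E i p) = i" for i
      using c p \<beta>p by (simp add: E_def cut_vec_def inv_tan_coord)
    let ?X = "trep c X x" and ?Y = "trep c Y x" and ?dY = "fderiv (trep c Y) x"
    have lin: "linear ?dY"
      using rep_has_derivative(1)[OF c(1) p(1) Y] p(2) has_derivative_linear by metis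
    have "D X Y p = D (\<lambda>q. (\<beta> q * \<beta> q) *\<^sub>R X q) (\<lambda>q. (\<beta> q * \<beta> q) *\<^sub>R Y q) p"
      by (simp add: conn_scale_left conn_scale_right \<beta>2 X Y vector_fields_scaleR \<beta>p d\<beta>)
    also have "\<dots> = (\<Sum>i\<in>Basis. a X i p *\<^sub>R (\<Sum>j\<in>Basis. dfun M (a Y j) p (E i p) *\<^sub>R E j p + a Y j p *\<^sub>R D (E i) (E j) p))"
      unfolding decomp
      by (simp add: conn_sum_left conn_sum_right conn_scale_left conn_scale_right aE a X Y E vector_fields_sum
          scaleR_sum_right)
    finally have "trep c (D X Y) x = (\<Sum>i\<in>Basis. (?X \<bullet> i) *\<^sub>R (\<Sum>j\<in>Basis. (?dY i \<bullet> j) *\<^sub>R j + (?Y \<bullet> j) *\<^sub>R \<Gamma> x i j))"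
      using c p by (simp add: section_rep_def \<Gamma>_def ap da Y Ep linear_sum[OF linear_tan_coord]
          linear_add[OF linear_tan_coord] linear_scale[OF linear_tan_coord] flip: p_def)
    also have "\<dots> = (\<Sum>i\<in>Basis. (?X \<bullet> i) *\<^sub>R ?dY i) + chr (\<Gamma> x) ?X ?Y"
      by (simp add: sum.distrib euclidean_representation scaleR_add_right chr_def scaleR_sum_right)
    finally show "trep c (D X Y) x = ?dY ?X + chr (\<Gamma> x) ?X ?Y"
      by (simp flip: linear_eq_sum_Basis[OF lin])
  qed (use N in auto)
  then show thesis using that N(2) by blast
qed

end


section \<open>The cotangent bundle\<close>

context smooth_atlas
begin

lemma cot_chart_dom [simp]: "chart_dom (cot_chart M c) = chart_dom c \<times> UNIV"
  by (simp add: cot_chart_def)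

lemma cot_chart_map [simp]: "chart_map (cot_chart M c) (p, \<gamma>) = (chart_map c p, cot_coord M c p \<gamma>)"
  by (simp add: cot_chart_def)

lemma cot_chart_image:
  assumes "c \<in> atlas M" "A \<subseteq> chart_dom c"
  shows "chart_map (cot_chart M c) ` (A \<times> UNIV) = chart_map c ` A \<times> UNIV"
proof -
  have "(chart_map c p, y) \<in> chart_map (cot_chart M c) ` (A \<times> UNIV)" if "p \<in> A" for p y
    by (rule image_eqI[of _ _ "(p, adjoint (tan_coord M c p) y)"]) (use assms that in auto)
  then show ?thesis by force
qed

lemma inj_cot_chart: "c \<in> atlas M \<Longrightarrow> inj_on (chart_map (cot_chart M c)) (chart_dom (cot_chart M c))"
  by (rule inj_on_inverseI[of _ "\<lambda>(x, y). (chart_inv c x, adjoint (tan_coord M c (chart_inv c x)) y)"]) auto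

lemma cot_chart_inv:
  assumes "c \<in> atlas M" "x \<in> chart_img c"
  shows "chart_inv (cot_chart M c) (x, y) = (chart_inv c x, adjoint (tan_coord M c (chart_inv c x)) y)"
  unfolding chart_inv_def[of "cot_chart M c"]
  by (rule inv_into_f_eq[OF inj_cot_chart[OF assms(1)]]) (use assms in auto)

text \<open>With \<tau> the transition from c to d, the induced transition sends (x, y) to
  (\<tau>(x), A^T y), where A is the Jacobian at \<tau>(x) of the transition from d back to c. Its
  smoothness rests on that of the transitions in both directions.\<close>

lemma smooth_atlas_cotangent: "smooth_atlas (cotangent_bundle M)"
proof
  fix c' assume "c' \<in> atlas (cotangent_bundle M)"
  then obtain c where c: "c \<in> atlas M" "c' = cot_chart M c" by (auto simp: cotangent_bundle_def)
  show "inj_on (chart_map c') (chart_dom c')" unfolding c(2) by (rule inj_cot_chart[OF c(1)])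
  show "open (chart_img c')"
    unfolding c(2) cot_chart_dom cot_chart_image[OF c(1) order_refl]
    by (intro open_Times open_image[OF c(1)] open_UNIV)
  fix d' assume "d' \<in> atlas (cotangent_bundle M)"
  then obtain d where d: "d \<in> atlas M" "d' = cot_chart M d" by (auto simp: cotangent_bundle_def)
  let ?W = "chart_map c ` (chart_dom c \<inter> chart_dom d)"
  have dom: "chart_dom c' \<inter> chart_dom d' = (chart_dom c \<inter> chart_dom d) \<times> UNIV"
    by (auto simp: c d)
  have im: "chart_map c' ` (chart_dom c' \<inter> chart_dom d') = ?W \<times> UNIV"
    unfolding dom unfolding c(2) by (rule cot_chart_image[OF c(1)]) auto
  have W: "open ?W" and WU: "open (?W \<times> (UNIV :: 'v set))"
    using open_overlap[OF c(1) d(1)] by (auto intro: open_Times)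
  show "open (chart_map c' ` (chart_dom c' \<inter> chart_dom d'))" unfolding im by (rule WU)
  have sm_fst: "smooth_on (?W \<times> UNIV) (\<lambda>z::'v \<times> 'v. fst z)" and sm_snd: "smooth_on (?W \<times> UNIV) (\<lambda>z::'v \<times> 'v. snd z)"
    by (intro smooth_on_fst smooth_on_snd smooth_on_ident WU)+
  have tr: "smooth_on (?W \<times> UNIV) (\<lambda>z::'v \<times> 'v. transition c d (fst z))"
    by (rule smooth_on_compose[OF WU W _ sm_fst smooth_transition[OF c(1) d(1)]]) auto
  let ?A = "\<lambda>z::'v \<times> 'v. fderiv (transition d c) (transition c d (fst z))"
  have in_im: "transition c d (fst z) \<in> chart_map d ` (chart_dom d \<inter> chart_dom c)" if "z \<in> ?W \<times> UNIV" for z :: "'v \<times> 'v"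
    using transition_in_overlap(1)[OF c(1) d(1), of "fst z"] that by auto
  have "smooth_on (?W \<times> UNIV) (\<lambda>z. (transition c d (fst z), adjoint (?A z) (snd z)))"
  proof (intro smooth_on_Pair smooth_on_adjoint_apply WU tr sm_snd)
    show "smooth_on (?W \<times> UNIV) (\<lambda>z. ?A z b)" for b
      by (rule smooth_on_compose[OF WU open_overlap[OF d(1) c(1)] _ tr
            smooth_on_fderiv[OF smooth_transition[OF d(1) c(1)]]]) (use in_im in blast)
    show "linear (?A z)" if "z \<in> ?W \<times> UNIV" for z
      using smooth_on_differentiable[OF smooth_transition[OF d(1) c(1)] in_im[OF that]]
      by (rule linear_frechet_derivative)
  qed
  then show "smooth_on (chart_map c' ` (chart_dom c' \<inter> chart_dom d')) (transition c' d')"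
    unfolding im
  proof (rule smooth_on_cong[OF WU])
    fix z :: "'v \<times> 'v" assume "z \<in> ?W \<times> UNIV"
    then obtain q y where z: "z = (chart_map c q, y)" "q \<in> chart_dom c" "q \<in> chart_dom d" by auto
    let ?\<xi> = "adjoint (tan_coord M c q) y"
    have "cot_coord M d q ?\<xi> = adjoint (chart_change d c q) (cot_coord M c q ?\<xi>)"
      using cot_coord_change[OF d(1) c(1) z(3,2)] by simp
    then show "(transition c d (fst z), adjoint (?A z) (snd z)) = transition c' d' z"
      using c d z by (simp add: cot_chart_inv chart_change_def)
  qed
next
  show "chart_at (cotangent_bundle M) u \<in> atlas (cotangent_bundle M)" for u
    by (cases u) (simp add: cotangent_bundle_def)
  show "u \<in> chart_dom (chart_at (cotangent_bundle M) u)" for u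
    by (cases u) (simp add: cotangent_bundle_def)
qed

lemma cot_chart_atlas: "c \<in> atlas M \<Longrightarrow> cot_chart M c \<in> atlas (cotangent_bundle M)"
  by (simp add: cotangent_bundle_def)

lemma chart_at_cotangent: "chart_at (cotangent_bundle M) (p, \<gamma>) = cot_chart M (chart_at M p)"
  by (simp add: cotangent_bundle_def)

end


subsection \<open>Horizontal and vertical lifts in coordinates\<close>

context connection
begin

abbreviation CM :: "('m \<times> 'v, 'v \<times> 'v) charted_space" where
  "CM \<equiv> cotangent_bundle M"

interpretation T: smooth_atlas CM
  by (rule smooth_atlas_cotangent)

lemma graph_has_derivative:
  assumes "c \<in> atlas M" "p \<in> chart_dom c" "\<omega> \<in> one_forms M"
  shows "(chart_map (cot_chart M c) \<circ> (\<lambda>q. (q, \<omega> q)) \<circ> chart_inv c has_derivative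
    (\<lambda>h. (h, fderiv (crep c \<omega>) (chart_map c p) h))) (at (chart_map c p))"
proof (rule has_derivative_local[OF _ open_image[OF assms(1)]])
  show "((\<lambda>x. (x, crep c \<omega> x)) has_derivative
    (\<lambda>h. (h, fderiv (crep c \<omega>) (chart_map c p) h))) (at (chart_map c p))"
    by (intro has_derivative_Pair has_derivative_ident rep_has_derivative(2) assms)
qed (use assms in \<open>auto simp: section_rep_def\<close>)

lemma mfd_deriv_graph:
  assumes "\<omega> \<in> one_forms M"
  shows "mfd_deriv M CM (\<lambda>q. (q, \<omega> q)) p v
    = (v, fderiv (crep (chart_at M p) \<omega>) (chart_map (chart_at M p) p) v)"
  unfolding mfd_deriv_def chart_at_cotangent
  using fderiv_eqI[OF graph_has_derivative[OF chart_at assms]] by simp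

text \<open>The coordinate expression of the section is reached in two ways, by changing the chart
  of the cotangent bundle afterwards or the chart of M beforehand; the two derivatives agree. This
  frees the differential of a section from the preferred charts.\<close>

lemma tan_coord_mfd_deriv_graph:
  assumes c: "c \<in> atlas M" "p \<in> chart_dom c" and \<omega>: "\<omega> \<in> one_forms M"
  shows "tan_coord CM (cot_chart M c) (p, \<omega> p)
      (mfd_deriv M CM (\<lambda>q. (q, \<omega> q)) p v)
    = (tan_coord M c p v, fderiv (crep c \<omega>) (chart_map c p) (tan_coord M c p v))"
proof -
  let ?c = "chart_at M p" and ?s = "\<lambda>q. (q, \<omega> q)"
  let ?x = "chart_map ?c p" and ?C = "cot_chart M (chart_at M p)"
  let ?g = "chart_map ?C \<circ> ?s \<circ> chart_inv ?c" and ?g' = "chart_map (cot_chart M c) \<circ> ?s \<circ> chart_inv c"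
  have 1: "(?g has_derivative mfd_deriv M CM ?s p) (at ?x)"
    using graph_has_derivative[OF chart_at \<omega>, of p] by (simp add: mfd_deriv_graph[OF \<omega>, abs_def])
  have gx: "?g ?x = chart_map ?C (p, \<omega> p)" by simp
  have 2: "(transition ?C (cot_chart M c) has_derivative
      tan_coord CM (cot_chart M c) (p, \<omega> p)) (at (?g ?x))"
    unfolding gx tan_coord_def chart_at_cotangent
    by (rule T.transition_has_derivative) (use c in \<open>auto intro: cot_chart_atlas\<close>)
  have 3: "((\<lambda>x. transition ?C (cot_chart M c) (?g x)) has_derivative
      (\<lambda>v. tan_coord CM (cot_chart M c) (p, \<omega> p) (mfd_deriv M CM ?s p v))) (at ?x)"
    by (rule has_derivative_compose[OF 1 2])
  have 4: "((\<lambda>x. ?g' (transition ?c c x)) has_derivative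
      (\<lambda>v. (tan_coord M c p v, fderiv (crep c \<omega>) (chart_map c p) (tan_coord M c p v)))) (at ?x)"
  proof (rule has_derivative_compose[of "transition ?c c" "tan_coord M c p"])
    show "(transition ?c c has_derivative tan_coord M c p) (at ?x)"
      unfolding tan_coord_def by (rule transition_has_derivative) (use c in auto)
    show "(?g' has_derivative (\<lambda>h. (h, fderiv (crep c \<omega>) (chart_map c p) h)))
        (at (transition ?c c ?x))"
      using graph_has_derivative[OF c \<omega>] by simp
  qed
  have "((\<lambda>x. ?g' (transition ?c c x)) has_derivative
      (\<lambda>v. tan_coord CM (cot_chart M c) (p, \<omega> p) (mfd_deriv M CM ?s p v))) (at ?x)"
  proof (rule has_derivative_local[OF 3 open_overlap[OF chart_at_atlas c(1)]])
    fix x assume "x \<in> chart_map ?c ` (chart_dom ?c \<inter> chart_dom c)"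
    then obtain q where q: "x = chart_map ?c q" "q \<in> chart_dom ?c" "q \<in> chart_dom c" by auto
    show "transition ?C (cot_chart M c) (?g x) = ?g' (transition ?c c x)"
      using q c by (simp add: cot_chart_inv del: cot_chart_map) (simp add: cot_chart_inv)
  qed (use c in auto)
  from fun_cong[OF has_derivative_unique[OF this 4], of v] show ?thesis by simp
qed

lemma mfd_deriv_proj: "mfd_deriv CM M fst u w = fst w"
proof -
  obtain p \<gamma> where u: "u = (p, \<gamma>)" by (cases u)
  let ?c = "chart_at M p"
  have "(chart_map ?c \<circ> fst \<circ> chart_inv (cot_chart M ?c) has_derivative fst)
      (at (chart_map (cot_chart M ?c) (p, \<gamma>)))"
  proof (rule has_derivative_local)
    show "(fst has_derivative fst) (at (chart_map (cot_chart M ?c) (p, \<gamma>)))"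
      by (rule bounded_linear_imp_has_derivative[OF bounded_linear_fst])
    show "open (chart_img ?c \<times> (UNIV :: 'v set))"
      by (intro open_Times open_image open_UNIV) auto
  qed (auto simp: cot_chart_inv)
  then show ?thesis
    by (simp add: mfd_deriv_def u chart_at_cotangent fderiv_eqI del: cot_chart_map)
qed

lemma vertical_lift_eq: "vertical_lift M u \<xi> = (0, \<xi>)"
proof -
  obtain p \<gamma> where u: "u = (p, \<gamma>)" by (cases u)
  have "((\<lambda>t. (chart_map (chart_at M p) p, \<gamma> + t *\<^sub>R \<xi>)) has_vector_derivative (0, \<xi>)) (at 0)"
    by (auto intro!: derivative_eq_intros simp: has_vector_derivative_def)
  then show ?thesis by (simp add: vertical_lift_def u chart_at_cotangent vector_derivative_at)
qed

text \<open>The chart change is differentiated along the line \<gamma> + t \<xi> in one fibre, on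
  which it is affine in t.\<close>

lemma tan_coord_vertical:
  assumes c: "c \<in> atlas M" "p \<in> chart_dom c"
  shows "tan_coord CM (cot_chart M c) (p, \<gamma>) (0, \<xi>) = (0, cot_coord M c p \<xi>)"
proof -
  let ?c = "chart_at M p"
  let ?f = "\<lambda>t. chart_map (cot_chart M ?c) (p, \<gamma> + t *\<^sub>R \<xi>)"
  have 1: "(?f has_derivative (\<lambda>t. (0, t *\<^sub>R \<xi>))) (at 0)"
    by (auto intro!: derivative_eq_intros)
  have f0: "?f 0 = chart_map (cot_chart M ?c) (p, \<gamma>)" by simp
  have 2: "(transition (cot_chart M ?c) (cot_chart M c) has_derivative
      tan_coord CM (cot_chart M c) (p, \<gamma>)) (at (?f 0))"
    unfolding f0 tan_coord_def chart_at_cotangent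
    by (rule T.transition_has_derivative) (use c in \<open>auto intro: cot_chart_atlas\<close>)
  have "(\<lambda>t. transition (cot_chart M ?c) (cot_chart M c) (?f t))
      = (\<lambda>t. (chart_map c p, cot_coord M c p \<gamma> + t *\<^sub>R cot_coord M c p \<xi>))"
  proof
    fix t
    have "chart_inv (cot_chart M ?c) (?f t) = (p, \<gamma> + t *\<^sub>R \<xi>)"
      by (rule T.chart_inv_map) (auto intro: cot_chart_atlas)
    then show "transition (cot_chart M ?c) (cot_chart M c) (?f t)
      = (chart_map c p, cot_coord M c p \<gamma> + t *\<^sub>R cot_coord M c p \<xi>)"
      using c by (simp add: linear_add[OF linear_cot_coord] linear_scale[OF linear_cot_coord])
  qed
  moreover have "((\<lambda>t. (chart_map c p, cot_coord M c p \<gamma> + t *\<^sub>R cot_coord M c p \<xi>)) has_derivative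
      (\<lambda>t. (0, t *\<^sub>R cot_coord M c p \<xi>))) (at 0)"
    by (auto intro!: derivative_eq_intros)
  ultimately show ?thesis
    using fun_cong[OF has_derivative_unique[OF has_derivative_compose[OF 1 2]], of _ 1] by simp
qed

lemma conn_chart:
  assumes "is_christoffel c N \<Gamma>" "c \<in> atlas M" "p \<in> chart_dom c" "chart_map c p \<in> N"
    and "X \<in> VF" "Y \<in> VF"
  shows "tan_coord M c p (D X Y p)
    = fderiv (trep c Y) (chart_map c p) (tan_coord M c p (X p))
      + chr (\<Gamma> (chart_map c p)) (tan_coord M c p (X p)) (tan_coord M c p (Y p))"
proof -
  let ?x = "chart_map c p"
  have "trep c (D X Y) ?x = fderiv (trep c Y) ?x (trep c X ?x) + chr (\<Gamma> ?x) (trep c X ?x) (trep c Y ?x)"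
    using assms(1,4,5,6) unfolding is_christoffel_def by blast
  then show ?thesis using assms(2,3) by simp
qed

lemma dual_connection_chart:
  assumes \<Gamma>: "is_christoffel c N \<Gamma>" and c: "c \<in> atlas M" "p \<in> chart_dom c" "chart_map c p \<in> N"
    and X: "X \<in> VF" and Z: "Z \<in> VF" and \<omega>: "\<omega> \<in> one_forms M"
  shows "dual_connection M D X \<omega> Z p
    = fderiv (crep c \<omega>) (chart_map c p) (tan_coord M c p (X p)) \<bullet> tan_coord M c p (Z p)
      - cot_coord M c p (\<omega> p) \<bullet> chr (\<Gamma> (chart_map c p)) (tan_coord M c p (X p)) (tan_coord M c p (Z p))"
proof -
  have "\<omega> p \<bullet> D X Z p = cot_coord M c p (\<omega> p) \<bullet> tan_coord M c p (D X Z p)" using c by simp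
  then show ?thesis
    by (simp add: dual_connection_def dfun_pairing[OF c(1,2) \<omega> Z] conn_chart[OF \<Gamma> c X Z]
        inner_add_right)
qed

text \<open>The fibre part of the horizontal lift of v at the covector y, in indices the sum of y_k
  \<Gamma>^k_ij v^i. It comes with a plus sign because the dual connection carries minus
  \<Gamma>.\<close>

definition hor :: "('v \<Rightarrow> 'v \<Rightarrow> 'v) \<Rightarrow> 'v \<Rightarrow> 'v \<Rightarrow> 'v" where
  "hor g y v = adjoint (chr g v) y"

lemma hor_inner: "hor g y v \<bullet> w = y \<bullet> chr g v w"
  by (simp add: hor_def adjoint_inner linear_chr)

lemma linear_hor: "linear (hor g y)"
proof (rule linearI)
  show "hor g y (v + w) = hor g y v + hor g y w" for v w
    by (rule euclidean_eqI) (simp add: hor_inner inner_add_left inner_add_right chr_add_left)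
  show "hor g y (r *\<^sub>R v) = r *\<^sub>R hor g y v" for r v
    by (rule euclidean_eqI) (simp add: hor_inner chr_scale_left)
qed

text \<open>Since Z may take any value at p, the vanishing of all these numbers is one equation
  between covectors, prescribing the derivative of the coefficients of \<omega> along X.\<close>

lemma horizontal_iff:
  assumes \<Gamma>: "is_christoffel c N \<Gamma>" and c: "c \<in> atlas M" "p \<in> chart_dom c" "chart_map c p \<in> N"
    and X: "X \<in> VF" and \<omega>: "\<omega> \<in> one_forms M"
  shows "(\<forall>Z\<in>VF. dual_connection M D X \<omega> Z p = 0) \<longleftrightarrow>
    fderiv (crep c \<omega>) (chart_map c p) (tan_coord M c p (X p))
      = hor (\<Gamma> (chart_map c p)) (cot_coord M c p (\<omega> p)) (tan_coord M c p (X p))" (is "?L \<longleftrightarrow> ?d = ?h")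
proof
  assume L: ?L
  show "?d = ?h"
  proof (rule vector_eq_rdot[THEN iffD1], rule allI)
    fix w
    obtain Z where "Z \<in> VF" "Z p = chart_change c (chart_at M p) p w"
      using vector_field_through by metis
    then show "?d \<bullet> w = ?h \<bullet> w"
      using dual_connection_chart[OF \<Gamma> c X _ \<omega>, of Z] L c by (simp add: hor_inner)
  qed
next
  assume "?d = ?h"
  then show ?L using dual_connection_chart[OF \<Gamma> c X _ \<omega>] by (simp add: hor_inner)
qed

text \<open>A horizontal vector is determined by its projection, by the same formula in every chart
  with Christoffel symbols. In the preferred chart this is the uniqueness of the horizontal lift, in
  the others it gives smoothness.\<close>

lemma horizontal_space_chart:
  assumes \<Gamma>: "is_christoffel c N \<Gamma>" and c: "c \<in> atlas M" "p \<in> chart_dom c" "chart_map c p \<in> N"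
    and w: "w \<in> horizontal_space M D (p, \<gamma>)"
  shows "tan_coord CM (cot_chart M c) (p, \<gamma>) w
    = (tan_coord M c p (fst w), hor (\<Gamma> (chart_map c p)) (cot_coord M c p \<gamma>) (tan_coord M c p (fst w)))"
proof -
  obtain \<omega> X where \<omega>: "\<omega> \<in> one_forms M" "\<omega> p = \<gamma>" and X: "X \<in> VF"
    and w: "w = mfd_deriv M CM (\<lambda>q. (q, \<omega> q)) p (X p)"
    and h: "\<forall>Z\<in>VF. dual_connection M D X \<omega> Z p = 0"
    using w by (auto simp: horizontal_space_def)
  have "fst w = X p" using w \<omega> by (simp add: mfd_deriv_graph)
  then show ?thesis
    using tan_coord_mfd_deriv_graph[OF c(1,2) \<omega>(1), of "X p"] h[unfolded horizontal_iff[OF \<Gamma> c X \<omega>(1)]]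
    by (simp add: \<omega> flip: w)
qed

text \<open>\<open>horizontal_lift\<close> is a definite description, so both the existence and the
  uniqueness of a horizontal vector over v have to be supplied.\<close>

lemma horizontal_lift_works:
  "horizontal_lift M D u v \<in> horizontal_space M D u \<and> fst (horizontal_lift M D u v) = v"
proof -
  obtain p \<gamma> where u: "u = (p, \<gamma>)" by (cases u)
  let ?c = "chart_at M p"
  let ?x = "chart_map ?c p"
  obtain N \<Gamma> where N: "?x \<in> N" and \<Gamma>: "is_christoffel ?c N \<Gamma>"
    using christoffel_exists[OF chart_at] .
  \<comment> \<open>Coefficients of a one-form, affine in the chart, with value \<gamma> at p and
    derivative \<open>hor (\<Gamma> ?x) \<gamma>\<close> there; by \<open>horizontal_iff\<close> its
    covariant derivative vanishes at p in every direction.\<close>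
  let ?V = "\<lambda>x. \<gamma> + hor (\<Gamma> ?x) \<gamma> (x - ?x)"
  have bl: "bounded_linear (hor (\<Gamma> ?x) \<gamma>)" using linear_hor linear_conv_bounded_linear by blast
  have "smooth_on (chart_img ?c) ?V"
    by (intro smooth_on_add smooth_on_const smooth_on_bounded_linear[OF bl] smooth_on_diff smooth_on_ident
        open_image chart_at_atlas)
  then obtain \<omega> U where \<omega>: "\<omega> \<in> one_forms M" and U: "open U" "?x \<in> U"
    and \<omega>V: "\<And>x. x \<in> U \<Longrightarrow> crep ?c \<omega> x = ?V x"
    using extend_one_form[OF chart_at] by metis
  obtain X where X: "X \<in> VF" "X p = v" using vector_field_through by metis
  have \<omega>p: "\<omega> p = \<gamma>" using \<omega>V[OF U(2)] linear_0[OF linear_hor] by simp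
  have "((\<lambda>x. hor (\<Gamma> ?x) \<gamma> (x - ?x)) has_derivative (\<lambda>h. hor (\<Gamma> ?x) \<gamma> h)) (at ?x)"
    by (rule bounded_linear.has_derivative[OF bl]) (auto intro!: derivative_eq_intros)
  from has_derivative_add[OF has_derivative_const[of \<gamma>] this]
  have "(?V has_derivative hor (\<Gamma> ?x) \<gamma>) (at ?x)" by simp
  then have "(crep ?c \<omega> has_derivative hor (\<Gamma> ?x) \<gamma>) (at ?x)"
    by (rule has_derivative_local[OF _ U]) (simp add: \<omega>V)
  then have d\<omega>: "fderiv (crep ?c \<omega>) ?x = hor (\<Gamma> ?x) \<gamma>"
    by (rule fderiv_eqI)
  have "mfd_deriv M CM (\<lambda>q. (q, \<omega> q)) p (X p) \<in> horizontal_space M D u"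
    unfolding horizontal_space_def mem_Collect_eq
    by (intro exI[of _ \<omega>] exI[of _ X] conjI \<omega> X)
      (simp_all add: u \<omega>p horizontal_iff[OF \<Gamma> chart_at N X(1) \<omega>] d\<omega>)
  then have ex: "(v, hor (\<Gamma> ?x) \<gamma> v) \<in> horizontal_space M D u"
    by (simp add: mfd_deriv_graph[OF \<omega>] d\<omega> X)
  have unique: "w = (v, hor (\<Gamma> ?x) \<gamma> v)" if "w \<in> horizontal_space M D u" "fst w = v" for w
  proof -
    have "tan_coord CM (cot_chart M ?c) (p, \<gamma>) w = w"
      using T.tan_coord_self[of "(p, \<gamma>)" w] by (simp add: chart_at_cotangent)
    then show ?thesis
      using horizontal_space_chart[OF \<Gamma> chart_at N, of w \<gamma>] that by (simp add: u)
  qed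
  show ?thesis
    unfolding horizontal_lift_def mfd_deriv_proj
  proof (rule theI)
    show "(v, hor (\<Gamma> ?x) \<gamma> v) \<in> horizontal_space M D u \<and> fst (v, hor (\<Gamma> ?x) \<gamma> v) = v"
      using ex by simp
  qed (use unique in blast)
qed

lemma gen_lift_chart:
  assumes \<Gamma>: "is_christoffel c N \<Gamma>" and c: "c \<in> atlas M" "p \<in> chart_dom c" "chart_map c p \<in> N"
  shows "tan_coord CM (cot_chart M c) (p, \<gamma>) (gen_lift M D (p, \<gamma>) z)
    = (tan_coord M c p (fst z), cot_coord M c p (snd z)
        + hor (\<Gamma> (chart_map c p)) (cot_coord M c p \<gamma>) (tan_coord M c p (fst z)))"
proof -
  have "linear (tan_coord CM (cot_chart M c) (p, \<gamma>))"
    by (rule T.linear_tan_coord) (use c in \<open>auto intro: cot_chart_atlas\<close>)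
  then show ?thesis
    using horizontal_space_chart[OF \<Gamma> c, of "horizontal_lift M D (p, \<gamma>) (fst z)" \<gamma>]
      horizontal_lift_works[of "(p, \<gamma>)" "fst z"]
    by (simp add: gen_lift_def vertical_lift_eq linear_add tan_coord_vertical[OF c(1,2)])
qed

lemma gen_lift_eq:
  assumes \<Gamma>: "is_christoffel (chart_at M p) N \<Gamma>" and N: "chart_map (chart_at M p) p \<in> N"
  shows "gen_lift M D (p, \<gamma>) z = (fst z, snd z + hor (\<Gamma> (chart_map (chart_at M p) p)) \<gamma> (fst z))"
  using gen_lift_chart[OF \<Gamma> chart_at N, of \<gamma> z]
    T.tan_coord_self[of "(p, \<gamma>)" "gen_lift M D (p, \<gamma>) z"] by (simp add: chart_at_cotangent)

lemma gen_lift_inv: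
  assumes \<Gamma>: "is_christoffel (chart_at M p) N \<Gamma>" and N: "chart_map (chart_at M p) p \<in> N"
  shows "inv (gen_lift M D (p, \<gamma>)) w = (fst w, snd w - hor (\<Gamma> (chart_map (chart_at M p) p)) \<gamma> (fst w))"
  by (subst inv_equality[of "\<lambda>w. (fst w, snd w - hor (\<Gamma> (chart_map (chart_at M p) p)) \<gamma> (fst w))"])
    (auto simp: gen_lift_eq[OF \<Gamma> N])

lemma gen_lift_bij_linear: "bij (gen_lift M D u)" "linear (gen_lift M D u)"
proof -
  obtain p \<gamma> where u: "u = (p, \<gamma>)" by (cases u)
  let ?x = "chart_map (chart_at M p) p"
  obtain N \<Gamma> where N: "?x \<in> N" and \<Gamma>: "is_christoffel (chart_at M p) N \<Gamma>"
    using christoffel_exists[OF chart_at] .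
  note eq = gen_lift_eq[OF \<Gamma> N]
  show "bij (gen_lift M D u)"
    by (rule o_bij[of "\<lambda>w. (fst w, snd w - hor (\<Gamma> ?x) \<gamma> (fst w))"]) (auto simp: u eq fun_eq_iff)
  show "linear (gen_lift M D u)"
    by (rule linearI) (simp_all add: u eq linear_add[OF linear_hor] linear_scale[OF linear_hor] algebra_simps)
qed

lemma inv_gen_lift [simp]: "inv (gen_lift M D u) (gen_lift M D u z) = z" "gen_lift M D u (inv (gen_lift M D u) w) = w"
  using gen_lift_bij_linear(1)[of u] by (simp_all add: bij_is_inj bij_is_surj surj_f_inv_f)

section \<open>Lifts of generalized vector fields and their brackets\<close>

definition lift :: "('m \<Rightarrow> 'v \<times> 'v) \<Rightarrow> 'm \<times> 'v \<Rightarrow> 'v \<times> 'v" where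
  "lift a u = gen_lift M D u (a (fst u))"

lemma lift_rep:
  assumes \<Gamma>: "is_christoffel c N \<Gamma>" and c: "c \<in> atlas M" and x: "x \<in> N"
  shows "T.trep (cot_chart M c) (lift a) (x, y)
    = (trep c (fst \<circ> a) x, crep c (snd \<circ> a) x + hor (\<Gamma> x) y (trep c (fst \<circ> a) x))"
proof -
  have xc: "x \<in> chart_img c" using \<Gamma> x by (auto simp: is_christoffel_def)
  show ?thesis
    using gen_lift_chart[OF \<Gamma> c, of "chart_inv c x" _ "a (chart_inv c x)"] xc c x
    by (simp add: section_rep_def[of _ "cot_chart M c"] cot_chart_inv lift_def)
      (simp add: section_rep_def)
qed

lemma hor_smooth:
  fixes S :: "'a::euclidean_space set"
  assumes "open S" "\<And>i j. i \<in> Basis \<Longrightarrow> j \<in> Basis \<Longrightarrow> smooth_on S (\<lambda>x. g x i j)"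
    and "smooth_on S y" "smooth_on S v"
  shows "smooth_on S (\<lambda>x. hor (g x) (y x) (v x))"
  unfolding hor_def
  by (intro smooth_on_adjoint_apply chr_smooth smooth_on_const linear_chr assms)

lemma christoffel_smooth_pullback:
  assumes "is_christoffel c N \<Gamma>" "i \<in> Basis" "j \<in> Basis"
  shows "smooth_on (N \<times> UNIV) (\<lambda>z::'v \<times> 'v. \<Gamma> (fst z) i j)"
  using assms by (intro smooth_on_compose[OF _ _ _ smooth_on_fst[OF _ smooth_on_ident], of _ N])
    (auto simp: is_christoffel_def intro: open_Times)

lemma lift_vector_field:
  assumes a: "a \<in> gen_fields"
  shows "lift a \<in> vector_fields CM"
proof (rule T.vector_fieldsI)
  fix u :: "'m \<times> 'v"
  obtain p \<gamma> where u: "u = (p, \<gamma>)" by (cases u)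
  let ?c = "chart_at M p"
  obtain N \<Gamma> where N: "chart_map ?c p \<in> N" and \<Gamma>: "is_christoffel ?c N \<Gamma>"
    using christoffel_exists[OF chart_at] .
  have oN: "open N" "N \<subseteq> chart_img ?c" using \<Gamma> by (auto simp: is_christoffel_def)
  let ?N = "N \<times> (UNIV :: 'v set)"
  have o: "open ?N" using oN by (auto intro: open_Times)
  have X: "(fst \<circ> a) \<in> VF" "(snd \<circ> a) \<in> one_forms M"
    using a by (simp_all add: gen_fields_iff o_def)
  have f: "smooth_on ?N (\<lambda>z. fst z)" and s: "smooth_on ?N (\<lambda>z. snd z)"
    by (intro smooth_on_fst smooth_on_snd smooth_on_ident o)+
  have 1: "smooth_on ?N (\<lambda>z. trep ?c (fst \<circ> a) (fst z))"
    by (rule smooth_on_compose[OF o oN(1) _ f smooth_on_subset[OF trep_smooth[OF X(1) chart_at_atlas] oN(2)]]) auto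
  have 2: "smooth_on ?N (\<lambda>z. crep ?c (snd \<circ> a) (fst z))"
    by (rule smooth_on_compose[OF o oN(1) _ f smooth_on_subset[OF crep_smooth[OF X(2) chart_at_atlas] oN(2)]]) auto
  have "smooth_on ?N (\<lambda>z. (trep ?c (fst \<circ> a) (fst z),
      crep ?c (snd \<circ> a) (fst z) + hor (\<Gamma> (fst z)) (snd z) (trep ?c (fst \<circ> a) (fst z))))"
    by (intro smooth_on_Pair smooth_on_add hor_smooth o 1 2 s christoffel_smooth_pullback[OF \<Gamma>])
  then have "smooth_on ?N (T.trep (cot_chart M ?c) (lift a))"
    by (rule smooth_on_cong[OF o]) (auto simp: lift_rep[OF \<Gamma> chart_at_atlas])
  then show "\<exists>C N. T.chart_nbhd u C N \<and> smooth_on N (T.trep C (lift a))"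
    using o oN N cot_chart_image[OF chart_at_atlas order_refl, of p]
    by (intro exI[of _ "cot_chart M ?c"] exI[of _ ?N]) (auto simp: u cot_chart_atlas)
qed

text \<open>The value depends on the covector and not only on its base point, because the curvature
  enters; it is therefore a function on the cotangent bundle and not a generalized field on
  M.\<close>

definition lift_bracket :: "('m \<Rightarrow> 'v \<times> 'v) \<Rightarrow> ('m \<Rightarrow> 'v \<times> 'v) \<Rightarrow> 'm \<times> 'v \<Rightarrow> 'v \<times> 'v" where
  "lift_bracket a b u = inv (gen_lift M D u) (lie_bracket CM (lift a) (lift b) u)"

definition curvature :: "('m \<Rightarrow> 'v) \<Rightarrow> ('m \<Rightarrow> 'v) \<Rightarrow> ('m \<Rightarrow> 'v) \<Rightarrow> 'm \<Rightarrow> 'v" where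
  "curvature X Y Z p = - D X (D Y Z) p + D Y (D X Z) p + D (lie_bracket M X Y) Z p"

text \<open>In the chart the lift of (X, \<xi>) is (X, \<xi> + \<Gamma>(X, _)^T y). The direction h
  acts on X, \<xi> and \<Gamma>, whereas k takes the place of y. Pairing with a constant w avoids
  differentiating an adjoint.\<close>

lemma lift_derivative:
  assumes \<Gamma>: "is_christoffel (chart_at M p) N \<Gamma>" and N: "chart_map (chart_at M p) p \<in> N"
    and b: "b \<in> gen_fields"
  fixes \<gamma> :: 'v
  defines "c \<equiv> chart_at M p"
  defines "x \<equiv> chart_map c p"
  defines "d \<equiv> fderiv (T.trep (cot_chart M c) (lift b)) (x, \<gamma>)"
  shows "fst (d (h, k)) = fderiv (trep c (fst \<circ> b)) x h"
    and "snd (d (h, k)) \<bullet> w = fderiv (crep c (snd \<circ> b)) x h \<bullet> w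
      + k \<bullet> chr (\<Gamma> x) (fst (b p)) w
      + \<gamma> \<bullet> (chr (\<lambda>i j. fderiv (\<lambda>x. \<Gamma> x i j) x h) (fst (b p)) w
            + chr (\<Gamma> x) (fderiv (trep c (fst \<circ> b)) x h) w)"
proof -
  have c: "c \<in> atlas M" "p \<in> chart_dom c" by (auto simp: c_def)
  have \<Gamma>c: "is_christoffel c N \<Gamma>" and xN: "x \<in> N" using \<Gamma> N by (auto simp: c_def x_def)
  have X: "(fst \<circ> b) \<in> VF" "(snd \<circ> b) \<in> one_forms M"
    using b by (simp_all add: gen_fields_iff o_def)
  have x\<gamma>: "(x, \<gamma>) = chart_map (cot_chart M c) (p, \<gamma>)" by (simp add: x_def c_def)
  have o: "open (N \<times> (UNIV :: 'v set))" using \<Gamma> by (auto simp: is_christoffel_def intro: open_Times)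
  have mem: "(x, \<gamma>) \<in> N \<times> UNIV" using xN by simp
  have der: "(T.trep (cot_chart M c) (lift b) has_derivative d) (at (x, \<gamma>))"
    unfolding d_def x\<gamma>
    by (rule T.rep_has_derivative(1)) (use c b in \<open>auto intro: lift_vector_field cot_chart_atlas\<close>)
  have fstder: "(fst has_derivative fst) (at (x, \<gamma>))" and sndder: "(snd has_derivative snd) (at (x, \<gamma>))"
    by (rule bounded_linear_imp_has_derivative bounded_linear_fst bounded_linear_snd)+
  have dX: "((\<lambda>z. trep c (fst \<circ> b) (fst z)) has_derivative
      (\<lambda>z. fderiv (trep c (fst \<circ> b)) x (fst z))) (at (x, \<gamma>))"
    by (rule has_derivative_compose[OF fstder, of "trep c (fst \<circ> b)" "fderiv (trep c (fst \<circ> b)) x"])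
      (use rep_has_derivative(1)[OF c X(1)] in \<open>simp add: x_def\<close>)
  have d\<xi>: "((\<lambda>z. crep c (snd \<circ> b) (fst z)) has_derivative
      (\<lambda>z. fderiv (crep c (snd \<circ> b)) x (fst z))) (at (x, \<gamma>))"
    by (rule has_derivative_compose[OF fstder, of "crep c (snd \<circ> b)" "fderiv (crep c (snd \<circ> b)) x"])
      (use rep_has_derivative(2)[OF c X(2)] in \<open>simp add: x_def\<close>)
  have d\<Gamma>: "((\<lambda>z. \<Gamma> (fst z) i j) has_derivative (\<lambda>z. fderiv (\<lambda>x. \<Gamma> x i j) x (fst z))) (at (x, \<gamma>))"
    if "i \<in> Basis" "j \<in> Basis" for i j
    by (rule has_derivative_compose[OF fstder, of "\<lambda>x. \<Gamma> x i j"])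
      (use \<Gamma>c xN that in \<open>auto simp: is_christoffel_def intro!: smooth_on_fderiv_at[of N]\<close>)
  have Xx: "trep c (fst \<circ> b) x = fst (b p)" by (simp add: x_def c_def)
  have 1: "((\<lambda>z. fst (T.trep (cot_chart M c) (lift b) z)) has_derivative (\<lambda>z. fst (d z))) (at (x, \<gamma>))"
    by (rule bounded_linear.has_derivative[OF bounded_linear_fst der])
  have "((\<lambda>z. trep c (fst \<circ> b) (fst z)) has_derivative (\<lambda>z. fst (d z))) (at (x, \<gamma>))"
    by (rule has_derivative_local[OF 1 o mem]) (auto simp: lift_rep[OF \<Gamma>c c(1)])
  from fun_cong[OF has_derivative_unique[OF this dX], of "(h, k)"]
  show "fst (d (h, k)) = fderiv (trep c (fst \<circ> b)) x h" by simp
  have 2: "((\<lambda>z. snd (T.trep (cot_chart M c) (lift b) z) \<bullet> w) has_derivative (\<lambda>z. snd (d z) \<bullet> w)) (at (x, \<gamma>))"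
    by (intro has_derivative_inner_left bounded_linear.has_derivative[OF bounded_linear_snd der])
  have 3: "((\<lambda>z. crep c (snd \<circ> b) (fst z) \<bullet> w + snd z \<bullet> chr (\<Gamma> (fst z)) (trep c (fst \<circ> b) (fst z)) w)
      has_derivative (\<lambda>z. snd (d z) \<bullet> w)) (at (x, \<gamma>))"
    by (rule has_derivative_local[OF 2 o mem])
      (auto simp: lift_rep[OF \<Gamma>c c(1)] inner_add_left hor_inner)
  have "((\<lambda>z. crep c (snd \<circ> b) (fst z) \<bullet> w + snd z \<bullet> chr (\<Gamma> (fst z)) (trep c (fst \<circ> b) (fst z)) w)
      has_derivative (\<lambda>z. fderiv (crep c (snd \<circ> b)) x (fst z) \<bullet> w
        + (snd (x, \<gamma>) \<bullet> (chr (\<lambda>i j. fderiv (\<lambda>x. \<Gamma> x i j) x (fst z)) (trep c (fst \<circ> b) (fst (x, \<gamma>))) w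
            + chr (\<Gamma> (fst (x, \<gamma>))) (fderiv (trep c (fst \<circ> b)) x (fst z)) w
            + chr (\<Gamma> (fst (x, \<gamma>))) (trep c (fst \<circ> b) (fst (x, \<gamma>))) 0)
          + snd z \<bullet> chr (\<Gamma> (fst (x, \<gamma>))) (trep c (fst \<circ> b) (fst (x, \<gamma>))) w))) (at (x, \<gamma>))"
    by (intro has_derivative_add has_derivative_inner_left has_derivative_inner d\<xi> sndder
        chr_has_derivative dX d\<Gamma> has_derivative_const)
  from fun_cong[OF has_derivative_unique[OF 3 this], of "(h, k)"]
  show "snd (d (h, k)) \<bullet> w = fderiv (crep c (snd \<circ> b)) x h \<bullet> w
      + k \<bullet> chr (\<Gamma> x) (fst (b p)) w
      + \<gamma> \<bullet> (chr (\<lambda>i j. fderiv (\<lambda>x. \<Gamma> x i j) x h) (fst (b p)) w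
            + chr (\<Gamma> x) (fderiv (trep c (fst \<circ> b)) x h) w)"
    by (simp add: Xx linear_0[OF linear_chr(1)] inner_add_right)
qed

text \<open>The formula dZ(Y) + \<Gamma>(Y, Z) for the coefficients of D_Y Z holds on all of N and
  can be differentiated once more; the last summand is the Christoffel term of the outer
  derivative.\<close>

lemma second_conn_chart:
  assumes \<Gamma>: "is_christoffel (chart_at M p) N \<Gamma>" and N: "chart_map (chart_at M p) p \<in> N"
    and X: "X \<in> VF" and Y: "Y \<in> VF" and Z: "Z \<in> VF"
  defines "c \<equiv> chart_at M p"
  defines "x \<equiv> chart_map c p"
  defines "dY \<equiv> fderiv (trep c Y) x" and "dZ \<equiv> fderiv (trep c Z) x"
  shows "D X (D Y Z) p = fderiv (\<lambda>z. fderiv (trep c Z) z (Y p)) x (X p)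
    + dZ (dY (X p)) + chr (\<lambda>i j. fderiv (\<lambda>x. \<Gamma> x i j) x (X p)) (Y p) (Z p)
    + chr (\<Gamma> x) (dY (X p)) (Z p) + chr (\<Gamma> x) (Y p) (dZ (X p))
    + chr (\<Gamma> x) (X p) (dZ (Y p) + chr (\<Gamma> x) (Y p) (Z p))"
proof -
  have c: "c \<in> atlas M" "p \<in> chart_dom c" by (auto simp: c_def)
  have \<Gamma>c: "is_christoffel c N \<Gamma>" and xN: "x \<in> N" using \<Gamma> N by (auto simp: c_def x_def)
  have oN: "open N" "N \<subseteq> chart_img c" using \<Gamma>c by (auto simp: is_christoffel_def)
  have at_p: "trep c V x = V p" for V by (simp add: x_def c_def)
  have t: "tan_coord M c p v = v" for v by (simp add: c_def)
  have dd: "(trep c Y has_derivative dY) (at x)" "(trep c Z has_derivative dZ) (at x)"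
    unfolding dY_def dZ_def x_def using rep_has_derivative(1)[OF c] Y Z by auto
  have 1: "((\<lambda>z. fderiv (trep c Z) z (trep c Y z)) has_derivative
    (\<lambda>h. fderiv (\<lambda>z. fderiv (trep c Z) z (trep c Y x)) x h + dZ (dY h))) (at x)"
    unfolding dZ_def
  proof (rule has_derivative_linear_apply[OF oN(1) xN _ _ dd(1)])
    have sm: "smooth_on N (trep c Z)" by (rule smooth_on_subset[OF trep_smooth[OF Z c(1)] oN(2)])
    show "linear (fderiv (trep c Z) z)" if "z \<in> N" for z
      using smooth_on_differentiable[OF sm that] by (rule linear_frechet_derivative)
    show "(\<lambda>z. fderiv (trep c Z) z b) differentiable (at x)" for b
      by (rule smooth_on_differentiable[OF smooth_on_fderiv[OF sm] xN])
  qed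
  have 2: "((\<lambda>z. chr (\<Gamma> z) (trep c Y z) (trep c Z z)) has_derivative
    (\<lambda>h. chr (\<lambda>i j. fderiv (\<lambda>x. \<Gamma> x i j) x h) (trep c Y x) (trep c Z x)
      + chr (\<Gamma> x) (dY h) (trep c Z x) + chr (\<Gamma> x) (trep c Y x) (dZ h))) (at x)"
    by (rule chr_has_derivative[OF _ dd])
      (use \<Gamma>c xN in \<open>auto simp: is_christoffel_def intro!: smooth_on_fderiv_at[of N]\<close>)
  have "(trep c (D Y Z) has_derivative (\<lambda>h.
      (fderiv (\<lambda>z. fderiv (trep c Z) z (trep c Y x)) x h + dZ (dY h)) +
      (chr (\<lambda>i j. fderiv (\<lambda>x. \<Gamma> x i j) x h) (trep c Y x) (trep c Z x)
      + chr (\<Gamma> x) (dY h) (trep c Z x) + chr (\<Gamma> x) (trep c Y x) (dZ h)))) (at x)"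
    by (rule has_derivative_local[OF has_derivative_add[OF 1 2] oN(1) xN])
      (use \<Gamma>c Y Z in \<open>simp add: is_christoffel_def\<close>)
  then show ?thesis
    using conn_chart[OF \<Gamma>c c xN[unfolded x_def] X conn_smooth[OF Y Z]]
      conn_chart[OF \<Gamma>c c xN[unfolded x_def] Y Z]
    by (simp add: t at_p fderiv_eqI dZ_def flip: x_def)
qed

text \<open>The second derivatives of Z cancel by symmetry, and the first derivatives of X and Y are
  absorbed by D_[X,Y] Z. The overall minus is that of the sign convention for the curvature.\<close>

lemma curvature_chart:
  assumes \<Gamma>: "is_christoffel (chart_at M p) N \<Gamma>" and N: "chart_map (chart_at M p) p \<in> N"
    and X: "X \<in> VF" and Y: "Y \<in> VF" and Z: "Z \<in> VF"
  defines "x \<equiv> chart_map (chart_at M p) p"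
  defines "d\<Gamma> \<equiv> \<lambda>h i j. fderiv (\<lambda>x. \<Gamma> x i j) x h"
  shows "curvature X Y Z p = - (chr (\<Gamma> x) (X p) (chr (\<Gamma> x) (Y p) (Z p)) - chr (\<Gamma> x) (Y p) (chr (\<Gamma> x) (X p) (Z p))
    + chr (d\<Gamma> (X p)) (Y p) (Z p) - chr (d\<Gamma> (Y p)) (X p) (Z p))"
proof -
  let ?c = "chart_at M p"
  have sym: "fderiv (\<lambda>z. fderiv (trep ?c Z) z (Y p)) x (X p)
    = fderiv (\<lambda>z. fderiv (trep ?c Z) z (X p)) x (Y p)"
    by (rule second_derivative_symmetric[OF open_image trep_smooth[OF Z]]) (auto simp: x_def)
  have lin: "linear (fderiv (trep ?c Z) x)"
    using rep_has_derivative(1)[OF chart_at Z] has_derivative_linear x_def by blast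
  have lie: "lie_bracket M X Y p = fderiv (trep ?c Y) x (X p) - fderiv (trep ?c X) x (Y p)"
    by (simp add: lie_bracket_def Let_def x_def)
  have "D (lie_bracket M X Y) Z p = fderiv (trep ?c Z) x (lie_bracket M X Y p)
      + chr (\<Gamma> x) (lie_bracket M X Y p) (Z p)"
    using conn_chart[OF \<Gamma> chart_at N lie_bracket_smooth[OF X Y] Z] by (simp add: x_def)
  then show ?thesis
    unfolding curvature_def second_conn_chart[OF \<Gamma> N X Y Z] second_conn_chart[OF \<Gamma> N Y X Z]
    using sym
    by (simp add: lie linear_diff[OF lin] linear_diff[OF linear_chr(2)] chr_add_right d\<Gamma>_def flip: x_def)
qed

lemma lift_bracket:
  assumes a: "a \<in> gen_fields" and b: "b \<in> gen_fields"
  defines "X \<equiv> fst \<circ> a" and "\<xi> \<equiv> snd \<circ> a" and "Y \<equiv> fst \<circ> b" and "\<eta> \<equiv> snd \<circ> b"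
  shows "fst (lift_bracket a b (p, \<gamma>)) = lie_bracket M X Y p"
    and "Z \<in> VF \<Longrightarrow> snd (lift_bracket a b (p, \<gamma>)) \<bullet> Z p
      = dual_connection M D X \<eta> Z p - dual_connection M D Y \<xi> Z p - \<gamma> \<bullet> curvature X Y Z p"
proof -
  let ?c = "chart_at M p"
  let ?x = "chart_map ?c p"
  obtain N \<Gamma> where N: "?x \<in> N" and \<Gamma>: "is_christoffel ?c N \<Gamma>"
    using christoffel_exists[OF chart_at] .
  have fields: "X \<in> VF" "Y \<in> VF" "\<xi> \<in> one_forms M" "\<eta> \<in> one_forms M"
    using a b by (simp_all add: X_def Y_def \<xi>_def \<eta>_def gen_fields_iff o_def)
  have p: "X p = fst (a p)" "Y p = fst (b p)" "\<xi> p = snd (a p)" "\<eta> p = snd (b p)"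
    by (simp_all add: X_def Y_def \<xi>_def \<eta>_def)
  have lie: "lie_bracket CM (lift a) (lift b) (p, \<gamma>)
    = fderiv (T.trep (cot_chart M ?c) (lift b)) (?x, \<gamma>) (X p, \<xi> p + hor (\<Gamma> ?x) \<gamma> (X p))
      - fderiv (T.trep (cot_chart M ?c) (lift a)) (?x, \<gamma>) (Y p, \<eta> p + hor (\<Gamma> ?x) \<gamma> (Y p))"
    by (simp add: lie_bracket_def Let_def chart_at_cotangent lift_def gen_lift_eq[OF \<Gamma> N] p)
  note d = lift_derivative[OF \<Gamma> N a, of \<gamma>] lift_derivative[OF \<Gamma> N b, of \<gamma>]
  have lieM: "lie_bracket M X Y p = fderiv (trep ?c Y) ?x (X p) - fderiv (trep ?c X) ?x (Y p)"
    by (simp add: lie_bracket_def Let_def)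
  show 1: "fst (lift_bracket a b (p, \<gamma>)) = lie_bracket M X Y p"
    using lieM by (simp add: lift_bracket_def gen_lift_inv[OF \<Gamma> N] lie d X_def Y_def)
  assume Z: "Z \<in> VF"
  have "snd (lift_bracket a b (p, \<gamma>)) = snd (lie_bracket CM (lift a) (lift b) (p, \<gamma>))
      - hor (\<Gamma> ?x) \<gamma> (lie_bracket M X Y p)"
    using 1 by (simp add: lift_bracket_def gen_lift_inv[OF \<Gamma> N])
  \<comment> \<open>The \<open>hor\<close> part of the first lift is a direction in which the second
    one is differentiated; this gives \<gamma>(\<Gamma>(X, \<Gamma>(Y, Z))), which together with the
    derivatives of \<Gamma> makes up the curvature. Derivatives of X and Y cancel against the
    \<open>hor\<close> of the Lie bracket, and the remaining terms form the two dual
    derivatives.\<close>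
  then show "snd (lift_bracket a b (p, \<gamma>)) \<bullet> Z p
      = dual_connection M D X \<eta> Z p - dual_connection M D Y \<xi> Z p - \<gamma> \<bullet> curvature X Y Z p"
    unfolding dual_connection_chart[OF \<Gamma> chart_at N fields(1) Z fields(4)]
      dual_connection_chart[OF \<Gamma> chart_at N fields(2) Z fields(3)]
      curvature_chart[OF \<Gamma> N fields(1,2) Z]
    using p
    by (simp add: lie d lieM inner_diff_left inner_diff_right inner_add_left inner_add_right hor_inner
        linear_diff[OF linear_chr(2)] flip: X_def Y_def \<xi>_def \<eta>_def)
qed

end


section \<open>The almost complex structure on the cotangent bundle\<close>

locale skew_gcs = connection M D
  for M :: "('m, 'v::euclidean_space) charted_space" and D +
  fixes J :: "'m \<Rightarrow> 'v \<times> 'v \<Rightarrow> 'v \<times> 'v"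
  assumes skew_gcs: "skew_gen_complex_structure M J"
begin

interpretation T: smooth_atlas CM
  by (rule smooth_atlas_cotangent)

lemma linear_J: "linear (J p)" and J_J [simp]: "J p (J p z) = - z"
  using skew_gcs unfolding skew_gen_complex_structure_def by blast+

definition J_rep :: "('m, 'v) chart \<Rightarrow> 'v \<Rightarrow> 'v \<times> 'v \<Rightarrow> 'v \<times> 'v" where
  "J_rep c x w = grep c (\<lambda>q. J q (inv (gen_coord M c q) w)) x"

lemma J_rep_smooth: "c \<in> atlas M \<Longrightarrow> smooth_on (chart_img c) (\<lambda>x. J_rep c x w)"
  using skew_gcs unfolding skew_gen_complex_structure_def smooth_endo_def J_rep_def by blast

lemma linear_inv_gen_coord:
  assumes "c \<in> atlas M" "p \<in> chart_dom c"
  shows "linear (inv (gen_coord M c p))"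
  using linear_inv_bij[OF linear_gen_coord[OF assms] bij_gen_coord[OF assms]] .

lemma linear_J_rep:
  assumes c: "c \<in> atlas M" and x: "x \<in> chart_img c"
  shows "linear (J_rep c x)"
proof -
  let ?p = "chart_inv c x"
  have p: "?p \<in> chart_dom c" using x by simp
  have "J_rep c x = gen_coord M c ?p \<circ> (J ?p \<circ> inv (gen_coord M c ?p))"
    by (simp add: fun_eq_iff J_rep_def section_rep_def)
  then show ?thesis
    by (simp add: linear_compose linear_J linear_gen_coord[OF c p] linear_inv_gen_coord[OF c p])
qed

lemma J_rep_apply:
  assumes c: "c \<in> atlas M" and x: "x \<in> chart_img c"
  shows "J_rep c x (grep c a x) = grep c (\<lambda>q. J q (a q)) x"
  using bij_gen_coord[OF c, of "chart_inv c x"] x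
  by (simp add: J_rep_def section_rep_def bij_is_inj)

lemma J_gen_field:
  assumes a: "a \<in> gen_fields"
  shows "(\<lambda>q. J q (a q)) \<in> gen_fields"
proof -
  have "smooth_on (chart_img c) (grep c (\<lambda>q. J q (a q)))" if c: "c \<in> atlas M" for c
  proof (rule smooth_on_cong[OF open_image[OF c]])
    have "smooth_on (chart_img c) (grep c a)"
      using a c by (simp add: gen_fields_def smooth_section_on_def)
    from smooth_on_linear_apply[OF open_image[OF c] J_rep_smooth[OF c] linear_J_rep[OF c] this]
    show "smooth_on (chart_img c) (\<lambda>x. J_rep c x (grep c a x))" .
  qed (rule J_rep_apply[OF c])
  then show ?thesis by (simp add: gen_fields_def smooth_section_on_def)
qed

lemma acs_lift: "cotangent_acs M J D u (lift a u) = lift (\<lambda>q. J q (a q)) u"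
  by (simp add: cotangent_acs_def lift_def)

text \<open>In the chart the structure is the matrix of J conjugated by the shear (v, \<xi>) -> (v,
  \<xi> + \<open>hor (\<Gamma> x) y v\<close>), and this shows its smooth dependence on x and
  y.\<close>

lemma acs_rep:
  assumes \<Gamma>: "is_christoffel c N \<Gamma>" and c: "c \<in> atlas M" and x: "x \<in> N"
  fixes w :: "'v \<times> 'v" and y :: 'v
  defines "v \<equiv> J_rep c x (fst w, snd w - hor (\<Gamma> x) y (fst w))"
  shows "T.trep (cot_chart M c)
      (\<lambda>u. cotangent_acs M J D u (inv (tan_coord CM (cot_chart M c) u) w)) (x, y)
    = (fst v, snd v + hor (\<Gamma> x) y (fst v))"
proof -
  have xc: "x \<in> chart_img c" using \<Gamma> x by (auto simp: is_christoffel_def)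
  define p where "p = chart_inv c x"
  have p: "p \<in> chart_dom c" "chart_map c p = x" using xc by (auto simp: p_def)
  obtain \<gamma> where u: "chart_inv (cot_chart M c) (x, y) = (p, \<gamma>)" and \<gamma>: "cot_coord M c p \<gamma> = y"
    using cot_chart_inv[OF c xc, of y] c p by (auto simp: p_def)
  let ?t = "tan_coord CM (cot_chart M c) (p, \<gamma>)"
  note G = gen_lift_chart[OF \<Gamma> c p(1) x[folded p(2)], of \<gamma>]
  have bij: "bij ?t" by (rule T.bij_tan_coord) (use c p in \<open>auto intro: cot_chart_atlas\<close>)
  define z where "z = inv (gen_coord M c p) (fst w, snd w - hor (\<Gamma> x) y (fst w))"
  have z: "gen_coord M c p z = (fst w, snd w - hor (\<Gamma> x) y (fst w))"
    using bij_gen_coord[OF c p(1)] by (simp add: z_def bij_is_surj surj_f_inv_f)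
  then have "?t (gen_lift M D (p, \<gamma>) z) = w"
    using G[of z] by (simp add: gen_coord_def map_prod_def split_beta p \<gamma> prod_eq_iff)
  then have i: "inv ?t w = gen_lift M D (p, \<gamma>) z" using bij by (metis bij_is_inj inv_f_f)
  have "gen_coord M c p (J p z) = v"
    by (simp add: v_def J_rep_def section_rep_def z_def p_def)
  then have "?t (gen_lift M D (p, \<gamma>) (J p z)) = (fst v, snd v + hor (\<Gamma> x) y (fst v))"
    using G[of "J p z"] by (simp add: gen_coord_def map_prod_def split_beta p \<gamma> prod_eq_iff)
  then show ?thesis unfolding section_rep_def u by (simp add: cotangent_acs_def i)
qed

lemma almost_complex: "almost_complex_structure CM (cotangent_acs M J D)"
  unfolding almost_complex_structure_def smooth_endo_def
proof (intro conjI allI ballI)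
  fix u :: "'m \<times> 'v" and w :: "'v \<times> 'v"
  have "cotangent_acs M J D u = gen_lift M D u \<circ> (J (fst u) \<circ> inv (gen_lift M D u))"
    by (simp add: fun_eq_iff cotangent_acs_def)
  then show "linear (cotangent_acs M J D u)"
    using gen_lift_bij_linear[of u] by (simp add: linear_compose linear_J linear_inv_bij)
  show "cotangent_acs M J D u (cotangent_acs M J D u w) = - w"
    using linear_neg[OF gen_lift_bij_linear(2)] by (simp add: cotangent_acs_def)
next
  fix C :: "('m \<times> 'v, 'v \<times> 'v) chart" and w :: "'v \<times> 'v"
  assume "C \<in> atlas CM"
  then obtain c where c: "c \<in> atlas M" and C: "C = cot_chart M c" by (auto simp: cotangent_bundle_def)
  let ?f = "T.trep C (\<lambda>u. cotangent_acs M J D u (inv (tan_coord CM C u) w))"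
  have im: "chart_img C = chart_img c \<times> UNIV"
    unfolding C cot_chart_dom by (rule cot_chart_image[OF c order_refl])
  show "smooth_on (chart_img C) ?f"
  proof (rule smooth_on_local)
    fix z assume "z \<in> chart_img C"
    then obtain q y0 where z: "z = (chart_map c q, y0)" "q \<in> chart_dom c" unfolding im by auto
    obtain N \<Gamma> where N: "chart_map c q \<in> N" and \<Gamma>: "is_christoffel c N \<Gamma>"
      using christoffel_exists[OF c z(2)] .
    have oN: "open N" "N \<subseteq> chart_img c" using \<Gamma> by (auto simp: is_christoffel_def)
    let ?N = "N \<times> (UNIV :: 'v set)"
    have o: "open ?N" using oN by (auto intro: open_Times)
    have f: "smooth_on ?N (\<lambda>z. fst z)" and s: "smooth_on ?N (\<lambda>z. snd z)"
      by (intro smooth_on_fst smooth_on_snd smooth_on_ident o)+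
    define g where "g z = J_rep c (fst z) (fst w, snd w - hor (\<Gamma> (fst z)) (snd z) (fst w))" for z :: "'v \<times> 'v"
    have g: "smooth_on ?N g"
      unfolding g_def
    proof (rule smooth_on_linear_apply[OF o, where A = "\<lambda>z. J_rep c (fst z)"])
      show "smooth_on ?N (\<lambda>z. J_rep c (fst z) b)" for b
        by (rule smooth_on_compose[OF o oN(1) _ f smooth_on_subset[OF J_rep_smooth[OF c] oN(2)]]) auto
      show "linear (J_rep c (fst z))" if "z \<in> ?N" for z
        using that oN by (intro linear_J_rep c) auto
      show "smooth_on ?N (\<lambda>z. (fst w, snd w - hor (\<Gamma> (fst z)) (snd z) (fst w)))"
        by (intro smooth_on_Pair smooth_on_diff smooth_on_const hor_smooth o s christoffel_smooth_pullback[OF \<Gamma>])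
    qed
    have "smooth_on ?N (\<lambda>z. (fst (g z), snd (g z) + hor (\<Gamma> (fst z)) (snd z) (fst (g z))))"
      by (intro smooth_on_Pair smooth_on_add hor_smooth smooth_on_fst smooth_on_snd o s g
          christoffel_smooth_pullback[OF \<Gamma>])
    then have "smooth_on ?N ?f"
      by (rule smooth_on_cong[OF o]) (auto simp: acs_rep[OF \<Gamma> c] C g_def)
    then show "\<exists>U. open U \<and> z \<in> U \<and> smooth_on U ?f"
      using o N z by (intro exI[of _ ?N]) auto
  qed
qed

text \<open>The structure sends the lift of a to the lift of J a, so every bracket in the Nijenhuis
  tensor is one of lifts and the isomorphism \<open>gen_lift\<close> can be factored out.\<close>

lemma nijenhuis_lift:
  "nijenhuis CM (cotangent_acs M J D) (lift a) (lift b) u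
    = gen_lift M D u (lift_bracket (\<lambda>q. J q (a q)) (\<lambda>q. J q (b q)) u
        - J (fst u) (lift_bracket (\<lambda>q. J q (a q)) b u) - J (fst u) (lift_bracket a (\<lambda>q. J q (b q)) u)
        - lift_bracket a b u)"
  using gen_lift_bij_linear(2)[of u]
  by (simp add: nijenhuis_def acs_lift linear_diff lift_bracket_def)
    (simp add: cotangent_acs_def)

lemma integrable_iff_lift_brackets:
  "integrable_almost_complex_structure CM (cotangent_acs M J D) \<longleftrightarrow>
    (\<forall>a\<in>gen_fields. \<forall>b\<in>gen_fields. \<forall>u.
       lift_bracket (\<lambda>q. J q (a q)) (\<lambda>q. J q (b q)) u
        - J (fst u) (lift_bracket (\<lambda>q. J q (a q)) b u) - J (fst u) (lift_bracket a (\<lambda>q. J q (b q)) u)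
        - lift_bracket a b u = 0)" (is "_ \<longleftrightarrow> ?R")
proof -
  have zero: "gen_lift M D u z = 0 \<longleftrightarrow> z = 0" for u z
    using gen_lift_bij_linear[of u] linear_0[of "gen_lift M D u"] by (metis inv_gen_lift(1))
  have "(\<forall>A\<in>vector_fields CM. \<forall>B\<in>vector_fields CM. \<forall>u.
      nijenhuis CM (cotangent_acs M J D) A B u = 0) \<longleftrightarrow>
    (\<forall>a\<in>gen_fields. \<forall>b\<in>gen_fields. \<forall>u.
      nijenhuis CM (cotangent_acs M J D) (lift a) (lift b) u = 0)" (is "?A \<longleftrightarrow> ?B")
  proof
    assume ?A then show ?B using lift_vector_field by blast
  next
    assume B: ?B
    show ?A
    proof (intro ballI allI)
      fix A B u assume A: "A \<in> vector_fields CM" and B': "B \<in> vector_fields CM"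
      \<comment> \<open>Only the value at u is matched: the lift of a agrees with A at the single
        point u, which suffices by tensoriality.\<close>
      obtain a where a: "a \<in> gen_fields" "a (fst u) = inv (gen_lift M D u) (A u)"
        using gen_field_through by blast
      obtain b where b: "b \<in> gen_fields" "b (fst u) = inv (gen_lift M D u) (B u)"
        using gen_field_through by blast
      have "nijenhuis CM (cotangent_acs M J D) A B u
        = nijenhuis CM (cotangent_acs M J D) (lift a) (lift b) u"
        by (rule T.nijenhuis_tensorial[OF almost_complex A lift_vector_field[OF a(1)] B' lift_vector_field[OF b(1)]])
          (simp_all add: lift_def a b)
      then show "nijenhuis CM (cotangent_acs M J D) A B u = 0" using B a b by simp
    qed
  qed
  then show ?thesis
    unfolding integrable_almost_complex_structure_def using almost_complex
    by (simp add: nijenhuis_lift zero)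
qed

end


section \<open>Complexification\<close>

lemma Re_Im_Complex_vec [simp]: "Re_vec (Complex_vec a b) = a" "Im_vec (Complex_vec a b) = b"
  "Complex_vec (Re_vec z) (Im_vec z) = z"
  by (simp_all add: Re_vec_def Im_vec_def Complex_vec_def vec_eq_iff)

lemma Re_Im_Complex_gen [simp]: "Re_gen (Complex_gen a b) = a" "Im_gen (Complex_gen a b) = b"
  "Complex_gen (Re_gen z) (Im_gen z) = z"
  by (simp_all add: Re_gen_def Im_gen_def Complex_gen_def map_prod_def split_beta)

lemma cgen_eq_iff: "z = z' \<longleftrightarrow> Re_gen z = Re_gen z' \<and> Im_gen z = Im_gen z'"
  by (metis Re_Im_Complex_gen(3))

lemma fst_snd_Re_Im_gen: "fst (Re_gen z) = Re_vec (fst z)" "fst (Im_gen z) = Im_vec (fst z)"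
  "snd (Re_gen z) = Re_vec (snd z)" "snd (Im_gen z) = Im_vec (snd z)"
  by (simp_all add: Re_gen_def Im_gen_def map_prod_def split_beta)

lemma fst_snd_Complex_gen: "fst (Complex_gen a b) = Complex_vec (fst a) (fst b)"
  "snd (Complex_gen a b) = Complex_vec (snd a) (snd b)"
  by (simp_all add: Complex_gen_def)

lemma Re_Im_vec_arith: "Re_vec (z + z') = Re_vec z + Re_vec z'" "Im_vec (z + z') = Im_vec z + Im_vec z'"
  "Re_vec (z - z') = Re_vec z - Re_vec z'" "Im_vec (z - z') = Im_vec z - Im_vec z'"
  "Re_vec (- z) = - Re_vec z" "Im_vec (- z) = - Im_vec z"
  "Re_vec (\<i> *s z) = - Im_vec z" "Im_vec (\<i> *s z) = Re_vec z"
  "Re_vec 0 = 0" "Im_vec 0 = 0"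
  by (simp_all add: Re_vec_def Im_vec_def vec_eq_iff)

lemma Re_ceval: "Re (ceval a b) = Re_vec a \<bullet> Re_vec b - Im_vec a \<bullet> Im_vec b"
  and Im_ceval: "Im (ceval a b) = Re_vec a \<bullet> Im_vec b + Im_vec a \<bullet> Re_vec b"
  by (simp_all add: ceval_def Re_vec_def Im_vec_def inner_vec_def sum_subtractf sum.distrib)

lemma ceval_diff_right: "ceval a (b - c) = ceval a b - ceval a c"
  by (simp add: complex_eq_iff Re_ceval Im_ceval Re_Im_vec_arith inner_diff_right)

text \<open>Complex trilinear extension; the arguments are sections rather than vectors because \<open>F\<close> may
  differentiate them.\<close>

definition ctri where
  "ctri F u v w = Complex
     (F (Re_gen \<circ> u) (Re_gen \<circ> v) (Re_gen \<circ> w) - F (Re_gen \<circ> u) (Im_gen \<circ> v) (Im_gen \<circ> w)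
      - F (Im_gen \<circ> u) (Re_gen \<circ> v) (Im_gen \<circ> w) - F (Im_gen \<circ> u) (Im_gen \<circ> v) (Re_gen \<circ> w))
     (F (Im_gen \<circ> u) (Re_gen \<circ> v) (Re_gen \<circ> w) + F (Re_gen \<circ> u) (Im_gen \<circ> v) (Re_gen \<circ> w)
      + F (Re_gen \<circ> u) (Re_gen \<circ> v) (Im_gen \<circ> w) - F (Im_gen \<circ> u) (Im_gen \<circ> v) (Im_gen \<circ> w))"

text \<open>A complexified bracket paired with a third section becomes the extension of a real
  trilinear form, so that identities can be established for real fields.\<close>

lemma ceval_cbilin_gen:
  "ceval (snd (cbilin_gen B u v p)) (fst (w p)) = ctri (\<lambda>a b w. snd (B a b p) \<bullet> fst (w p)) u v w"
  by (simp add: complex_eq_iff ctri_def cbilin_gen_def Re_ceval Im_ceval fst_snd_Complex_gen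
      fst_snd_Re_Im_gen inner_diff_left inner_add_left)

lemma ceval_cbilin_vec:
  "ceval (snd (w p)) (cbilin_vec B (\<lambda>q. fst (u q)) (\<lambda>q. fst (v q)) p)
    = ctri (\<lambda>u v w. snd (w p) \<bullet> B (\<lambda>q. fst (u q)) (\<lambda>q. fst (v q)) p) u v w"
  by (simp add: complex_eq_iff ctri_def cbilin_vec_def Re_ceval Im_ceval o_def
      fst_snd_Re_Im_gen inner_diff_right inner_add_right)

text \<open>J(a + i b) = i (a + i b) means J a = - b and J b = a; by J^2 = -1 the first equation
  implies the second.\<close>

lemma holomorphic_bundle_iff:
  assumes "linear (J p)" "\<And>z. J p (J p z) = - z"
  shows "z \<in> holomorphic_bundle J p \<longleftrightarrow> J p (Re_gen z) = - Im_gen z"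
proof -
  have "z \<in> holomorphic_bundle J p \<longleftrightarrow> J p (Re_gen z) = - Im_gen z \<and> J p (Im_gen z) = Re_gen z"
    unfolding holomorphic_bundle_def mem_Collect_eq cgen_endo_def
    by (auto simp: cgen_eq_iff prod_eq_iff fst_snd_Re_Im_gen Re_Im_vec_arith)
  moreover have "J p (Im_gen z) = Re_gen z" if "J p (Re_gen z) = - Im_gen z"
    using assms(2)[of "Re_gen z"] linear_neg[OF assms(1), of "Im_gen z"] that by simp
  ultimately show ?thesis by blast
qed


context smooth_atlas
begin

section \<open>Real and complex derivatives, and smoothness of the Courant bracket\<close>

lemma gen_fields_add: "a \<in> gen_fields \<Longrightarrow> b \<in> gen_fields \<Longrightarrow> (\<lambda>q. a q + b q) \<in> gen_fields"
  by (simp add: gen_fields_iff vector_fields_add one_forms_add)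

lemma gen_fields_diff: "a \<in> gen_fields \<Longrightarrow> b \<in> gen_fields \<Longrightarrow> (\<lambda>q. a q - b q) \<in> gen_fields"
  by (simp add: gen_fields_iff vector_fields_diff one_forms_diff)

lemma smooth_fun_diff:
  assumes "smooth_fun f" "smooth_fun g"
  shows "smooth_fun (\<lambda>q. f q - g q)"
  using assms unfolding smooth_fun_iff o_def by (auto intro!: smooth_on_diff open_image)

lemma smooth_fun_add:
  assumes "smooth_fun f" "smooth_fun g"
  shows "smooth_fun (\<lambda>q. f q + g q)"
  using assms unfolding smooth_fun_iff o_def by (auto intro!: smooth_on_add open_image)

lemma dfun_diff:
  assumes "smooth_fun f" "smooth_fun g"
  shows "dfun M (\<lambda>q. f q - g q) p v = dfun M f p v - dfun M g p v"
  using has_derivative_diff[OF rep_has_derivative(3)[OF chart_at assms(1)]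
      rep_has_derivative(3)[OF chart_at assms(2)], of p]
  by (simp add: dfun_def o_def fderiv_eqI)

lemma dfun_add:
  assumes "smooth_fun f" "smooth_fun g"
  shows "dfun M (\<lambda>q. f q + g q) p v = dfun M f p v + dfun M g p v"
  using has_derivative_add[OF rep_has_derivative(3)[OF chart_at assms(1)]
      rep_has_derivative(3)[OF chart_at assms(2)], of p]
  by (simp add: dfun_def o_def fderiv_eqI)

lemma dfun_complex:
  assumes "smooth_fun (\<lambda>q. Re (f q))" "smooth_fun (\<lambda>q. Im (f q))"
  shows "dfun M f p v = Complex (dfun M (\<lambda>q. Re (f q)) p v) (dfun M (\<lambda>q. Im (f q)) p v)"
proof -
  let ?c = "chart_at M p"
  let ?x = "chart_map ?c p"
  note d = rep_has_derivative(3)[OF chart_at assms(1), of p]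
    rep_has_derivative(3)[OF chart_at assms(2), of p]
  have "((\<lambda>x. of_real (((\<lambda>q. Re (f q)) \<circ> chart_inv ?c) x) + \<i> * of_real (((\<lambda>q. Im (f q)) \<circ> chart_inv ?c) x))
      has_derivative (\<lambda>h. of_real (dfun M (\<lambda>q. Re (f q)) p h) + \<i> * of_real (dfun M (\<lambda>q. Im (f q)) p h))) (at ?x)"
    unfolding dfun_def by (intro has_derivative_add has_derivative_mult_right has_derivative_of_real d)
  moreover have "(\<lambda>x. of_real (((\<lambda>q. Re (f q)) \<circ> chart_inv ?c) x) + \<i> * of_real (((\<lambda>q. Im (f q)) \<circ> chart_inv ?c) x))
      = f \<circ> chart_inv ?c"
    by (simp add: fun_eq_iff complex_eq_iff)
  ultimately show ?thesis
    unfolding dfun_def[of M f] by (simp add: fderiv_eqI complex_eq_iff)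
qed

lemma courant_gen_field:
  assumes a: "a \<in> gen_fields" and b: "b \<in> gen_fields"
  shows "courant_bracket M a b \<in> gen_fields"
proof -
  have "(\<lambda>q. fst (a q)) \<in> VF" "(\<lambda>q. snd (a q)) \<in> one_forms M"
    "(\<lambda>q. fst (b q)) \<in> VF" "(\<lambda>q. snd (b q)) \<in> one_forms M"
    using a b by (simp_all add: gen_fields_iff)
  then show ?thesis
    unfolding gen_fields_iff courant_bracket_def Let_def fst_conv snd_conv
    by (intro conjI one_forms_add one_forms_diff one_forms_scale lie_deriv_form_smooth dform_smooth
        lie_bracket_smooth smooth_fun_diff pairing_smooth)
qed

end

lemma Re_Im_cbilin_vec:
  "Re_vec (cbilin_vec B X Y p) = B (Re_vec \<circ> X) (Re_vec \<circ> Y) p - B (Im_vec \<circ> X) (Im_vec \<circ> Y) p"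
  "Im_vec (cbilin_vec B X Y p) = B (Re_vec \<circ> X) (Im_vec \<circ> Y) p + B (Im_vec \<circ> X) (Re_vec \<circ> Y) p"
  by (simp_all add: cbilin_vec_def)

lemma Re_Im_comp_cbilin_vec:
  "Re_vec \<circ> cbilin_vec B X Y = (\<lambda>q. B (Re_vec \<circ> X) (Re_vec \<circ> Y) q - B (Im_vec \<circ> X) (Im_vec \<circ> Y) q)"
  "Im_vec \<circ> cbilin_vec B X Y = (\<lambda>q. B (Re_vec \<circ> X) (Im_vec \<circ> Y) q + B (Im_vec \<circ> X) (Re_vec \<circ> Y) q)"
  by (simp_all add: fun_eq_iff Re_Im_cbilin_vec)

lemma cbilin_vec_fst_conv:
  "Re_vec \<circ> (\<lambda>q. fst (u q)) = (\<lambda>q. fst ((Re_gen \<circ> u) q))" "Im_vec \<circ> (\<lambda>q. fst (u q)) = (\<lambda>q. fst ((Im_gen \<circ> u) q))"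
  by (simp_all add: fun_eq_iff fst_snd_Re_Im_gen)

lemma fst_cbilin_gen:
  assumes "\<And>a b. a \<in> {Re_gen \<circ> u, Im_gen \<circ> u} \<Longrightarrow> b \<in> {Re_gen \<circ> v, Im_gen \<circ> v} \<Longrightarrow>
    fst (B a b p) = C (\<lambda>q. fst (a q)) (\<lambda>q. fst (b q)) p"
  shows "fst (cbilin_gen B u v p) = cbilin_vec C (\<lambda>q. fst (u q)) (\<lambda>q. fst (v q)) p"
  unfolding cbilin_vec_def cbilin_vec_fst_conv by (simp add: cbilin_gen_def fst_snd_Complex_gen assms)


section \<open>The two integrability conditions\<close>

locale involutive_setting = skew_gcs M D J
  for M :: "('m, real ^ 'n) charted_space" and D and J +
  fixes E :: "'m \<Rightarrow> (complex ^ 'n) set" and \<alpha> :: "'m \<Rightarrow> complex ^ 'n \<Rightarrow> complex ^ 'n \<Rightarrow> complex"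
  assumes hol: "has_holomorphic_bundle M J E \<alpha>"
    and inv: "involutive M E"
    and conn_E: "\<forall>X\<in>csections M E. \<forall>Y\<in>csections M E. cbilin_vec D X Y \<in> csections M E"
    and flat: "\<forall>X\<in>csections M E. \<forall>Y\<in>csections M E. \<forall>Z\<in>csections M E. \<forall>p. ccurvature M D X Y Z p = 0"
    and torsion: "\<forall>X\<in>csections M E. \<forall>Y\<in>csections M E. \<forall>Z\<in>csections M E. \<forall>p.
           cov_deriv_two_form M D \<alpha> Z X Y p
           + \<alpha> p (ctorsion M D Z X p) (Y p) + \<alpha> p (X p) (ctorsion M D Z Y p) = 0"
begin

abbreviation L_sections :: "('m \<Rightarrow> (complex ^ 'n) \<times> (complex ^ 'n)) set" where
  "L_sections \<equiv> cgen_sections M (holomorphic_bundle J)"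

lemma mem_holomorphic_iff: "z \<in> holomorphic_bundle J p \<longleftrightarrow> J p (Re_gen z) = - Im_gen z"
  by (rule holomorphic_bundle_iff) (auto simp: linear_J)

lemma holomorphic_Re: "z \<in> holomorphic_bundle J p \<Longrightarrow> Re_gen z = J p (Im_gen z)"
  using J_J[of p "Re_gen z"] linear_neg[OF linear_J, of p "Im_gen z"] by (simp add: mem_holomorphic_iff)

lemma L_sections_iff:
  "s \<in> L_sections \<longleftrightarrow> Re_gen \<circ> s \<in> gen_fields \<and> Im_gen \<circ> s \<in> gen_fields \<and> (\<forall>p. s p \<in> holomorphic_bundle J p)"
  by (simp add: cgen_sections_def gen_fields_def)

text \<open>Up to the factor 2i this is the projection (a - i J a) / 2 of a to the
  i-eigenspace.\<close>

lemma L_section_of_field: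
  assumes "a \<in> gen_fields"
  shows "(\<lambda>q. Complex_gen (J q (a q)) (a q)) \<in> L_sections"
  using assms J_gen_field[OF assms] by (simp add: L_sections_iff o_def mem_holomorphic_iff)

lemma L_section_through:
  assumes "z \<in> holomorphic_bundle J p"
  obtains s where "s \<in> L_sections" "s p = z"
proof -
  obtain a where a: "a \<in> gen_fields" "a p = Im_gen z" using gen_field_through .
  show thesis
    using that[OF L_section_of_field[OF a(1)]] a(2) holomorphic_Re[OF assms] by (simp add: cgen_eq_iff)
qed

lemma E_eq: "E p = fst ` holomorphic_bundle J p"
  and L_eq: "holomorphic_bundle J p = L_bundle E \<alpha> p"
  and \<alpha>_skew: "X \<in> E p \<Longrightarrow> Y \<in> E p \<Longrightarrow> \<alpha> p X Y = - \<alpha> p Y X"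
proof -
  show "E p = fst ` holomorphic_bundle J p" "holomorphic_bundle J p = L_bundle E \<alpha> p"
    using hol unfolding has_holomorphic_bundle_def by blast+
  have "two_form_on_subbundle M E \<alpha>" using hol unfolding has_holomorphic_bundle_def by blast
  then show "X \<in> E p \<Longrightarrow> Y \<in> E p \<Longrightarrow> \<alpha> p X Y = - \<alpha> p Y X"
    unfolding two_form_on_subbundle_def by blast
qed

lemma E_diff:
  assumes "X \<in> E p" "Y \<in> E p"
  shows "X - Y \<in> E p"
proof -
  obtain z z' where z: "z \<in> holomorphic_bundle J p" "X = fst z" "z' \<in> holomorphic_bundle J p" "Y = fst z'"
    using assms by (auto simp: E_eq)
  have "Re_gen (z - z') = Re_gen z - Re_gen z'" "Im_gen (z - z') = Im_gen z - Im_gen z'"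
    by (simp_all add: prod_eq_iff fst_snd_Re_Im_gen Re_Im_vec_arith)
  then have "z - z' \<in> holomorphic_bundle J p"
    using z by (simp add: mem_holomorphic_iff linear_diff[OF linear_J])
  then show ?thesis using z by (auto simp: E_eq intro!: image_eqI[of _ _ "z - z'"])
qed

lemma section_E:
  assumes "s \<in> L_sections"
  shows "(\<lambda>q. fst (s q)) \<in> csections M E" and "fst (s p) \<in> E p"
  using assms unfolding csections_on_def mem_Collect_eq cbilin_vec_fst_conv L_sections_iff gen_fields_iff
  by (auto simp: E_eq vector_fields_def)

lemma \<alpha>_right: "s \<in> L_sections \<Longrightarrow> V \<in> E p \<Longrightarrow> \<alpha> p (fst (s p)) V = ceval (snd (s p)) V"
proof -
  assume s: "s \<in> L_sections" and V: "V \<in> E p"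
  have "s p \<in> L_bundle E \<alpha> p" using s unfolding L_sections_iff L_eq[symmetric] by blast
  then show ?thesis using V by (auto simp: L_bundle_def)
qed

lemma \<alpha>_left: "s \<in> L_sections \<Longrightarrow> V \<in> E p \<Longrightarrow> \<alpha> p V (fst (s p)) = - ceval (snd (s p)) V"
  using \<alpha>_right[of s V p] \<alpha>_skew[of V p "fst (s p)"] section_E(2)[of s p] by simp

text \<open>The sum on the right is twice the complexified metric. By skew-symmetry \<alpha>(fst z,
  Y) is minus the value on fst z of the covector of a section of L through Y, and every Y in E p is
  the vector part of such a section.\<close>

lemma mem_L_iff:
  assumes V: "fst z \<in> E p"
  shows "z \<in> holomorphic_bundle J p \<longleftrightarrow>
    (\<forall>w\<in>L_sections. ceval (snd z) (fst (w p)) + ceval (snd (w p)) (fst z) = 0)"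
proof -
  have "z \<in> holomorphic_bundle J p \<longleftrightarrow> (\<forall>Y\<in>E p. ceval (snd z) Y = \<alpha> p (fst z) Y)"
    using V by (simp add: L_eq L_bundle_def split_beta)
  also have "\<dots> \<longleftrightarrow> (\<forall>w\<in>L_sections. ceval (snd z) (fst (w p)) = \<alpha> p (fst z) (fst (w p)))"
  proof -
    have "V \<in> (\<lambda>w. fst (w p)) ` L_sections" if "V \<in> E p" for V
    proof -
      obtain z' where z': "z' \<in> holomorphic_bundle J p" "V = fst z'" using \<open>V \<in> E p\<close> by (auto simp: E_eq)
      obtain w where "w \<in> L_sections" "w p = z'" using L_section_through[OF z'(1)] .
      then show ?thesis using z'(2) by auto
    qed
    then have "E p = (\<lambda>w. fst (w p)) ` L_sections" using section_E(2) by blast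
    then show ?thesis by simp
  qed
  finally show ?thesis using V by (simp add: \<alpha>_left add_eq_0_iff2)
qed

text \<open>For \<open>u = (X, \<xi>)\<close>, \<open>v = (Y, \<eta>)\<close> and \<open>w = (Z, \<zeta>)\<close> the next four forms are \<open>X(\<eta>(Z))\<close>,
  \<open>\<eta>(D\<^sub>X Z)\<close>, \<open>\<zeta>([X,Y])\<close> and \<open>\<gamma>(R\<^sub>X\<^sub>,\<^sub>Y Z)\<close>.\<close>

definition deriv_form where
  "deriv_form p u v w = dfun M (\<lambda>q. snd (v q) \<bullet> fst (w q)) p (fst (u p))"

definition conn_form where
  "conn_form p u v w = snd (v p) \<bullet> D (\<lambda>q. fst (u q)) (\<lambda>q. fst (w q)) p"

definition bracket_form where
  "bracket_form p u v w = snd (w p) \<bullet> lie_bracket M (\<lambda>q. fst (u q)) (\<lambda>q. fst (v q)) p"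

definition curv_form where
  "curv_form p \<gamma> u v w = \<gamma> \<bullet> curvature (\<lambda>q. fst (u q)) (\<lambda>q. fst (v q)) (\<lambda>q. fst (w q)) p"

lemma bracket_form_swap: "bracket_form p v u w = - bracket_form p u v w"
  unfolding bracket_form_def by (subst lie_bracket_swap) simp

text \<open>Real and imaginary parts of sections of L are smooth real fields, and it is for these
  that the formulas for the brackets are available.\<close>

lemma ctri_cong:
  assumes "u \<in> L_sections" "v \<in> L_sections" "w \<in> L_sections"
    and "\<And>a b c. a \<in> gen_fields \<Longrightarrow> b \<in> gen_fields \<Longrightarrow> c \<in> gen_fields \<Longrightarrow> F a b c = G a b c"
  shows "ctri F u v w = ctri G u v w"
  using assms by (simp add: ctri_def L_sections_iff)

lemma ceval_smooth:
  assumes "v \<in> L_sections" "w \<in> L_sections"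
  shows "smooth_fun (\<lambda>q. Re (ceval (snd (v q)) (fst (w q))))"
    and "smooth_fun (\<lambda>q. Im (ceval (snd (v q)) (fst (w q))))"
  using assms unfolding Re_ceval Im_ceval fst_snd_Re_Im_gen[symmetric]
  by (auto intro!: smooth_fun_diff smooth_fun_add pairing_smooth simp: L_sections_iff gen_fields_iff)

lemma cdfun_ceval:
  assumes u: "u \<in> L_sections" and v: "v \<in> L_sections" and w: "w \<in> L_sections"
  shows "cdfun M (\<lambda>q. ceval (snd (v q)) (fst (w q))) p (fst (u p)) = ctri (deriv_form p) u v w"
proof -
  have f: "(\<lambda>q. fst ((Re_gen \<circ> w) q)) \<in> VF" "(\<lambda>q. fst ((Im_gen \<circ> w) q)) \<in> VF"
    "(\<lambda>q. snd ((Re_gen \<circ> v) q)) \<in> one_forms M" "(\<lambda>q. snd ((Im_gen \<circ> v) q)) \<in> one_forms M"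
    using v w by (simp_all add: L_sections_iff gen_fields_iff)
  have sm: "smooth_fun (\<lambda>q. snd ((Re_gen \<circ> v) q) \<bullet> fst ((Re_gen \<circ> w) q))"
    "smooth_fun (\<lambda>q. snd ((Im_gen \<circ> v) q) \<bullet> fst ((Re_gen \<circ> w) q))"
    "smooth_fun (\<lambda>q. snd ((Re_gen \<circ> v) q) \<bullet> fst ((Im_gen \<circ> w) q))"
    "smooth_fun (\<lambda>q. snd ((Im_gen \<circ> v) q) \<bullet> fst ((Im_gen \<circ> w) q))"
    by (intro pairing_smooth f)+
  have re: "(\<lambda>q. Re (ceval (snd (v q)) (fst (w q)))) = (\<lambda>q. snd ((Re_gen \<circ> v) q) \<bullet> fst ((Re_gen \<circ> w) q)
      - snd ((Im_gen \<circ> v) q) \<bullet> fst ((Im_gen \<circ> w) q))"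
    and im: "(\<lambda>q. Im (ceval (snd (v q)) (fst (w q)))) = (\<lambda>q. snd ((Re_gen \<circ> v) q) \<bullet> fst ((Im_gen \<circ> w) q)
      + snd ((Im_gen \<circ> v) q) \<bullet> fst ((Re_gen \<circ> w) q))"
    by (simp_all add: fun_eq_iff Re_ceval Im_ceval fst_snd_Re_Im_gen)
  show ?thesis
    unfolding cdfun_def dfun_complex[OF ceval_smooth[OF v w]]
    unfolding re im dfun_diff[OF sm(1,4)] dfun_add[OF sm(3,2)]
    by (simp add: complex_eq_iff ctri_def deriv_form_def fst_snd_Re_Im_gen)
qed

lemma ceval_conn: "ceval (snd (v p)) (cbilin_vec D (\<lambda>q. fst (u q)) (\<lambda>q. fst (w q)) p) = ctri (conn_form p) u v w"
  unfolding ceval_cbilin_vec conn_form_def by (simp add: ctri_def)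

lemma ceval_bracket: "ceval (snd (w p)) (clie_bracket M (\<lambda>q. fst (u q)) (\<lambda>q. fst (v q)) p) = ctri (bracket_form p) u v w"
  unfolding ceval_cbilin_vec bracket_form_def by (simp add: ctri_def)

text \<open>By additivity of \<open>D\<close> on smooth fields the complexified curvature expands
  into four real curvatures in each of its real and imaginary parts. Its vanishing on E survives the
  pairing of both parts with the real covector \<gamma>.\<close>

lemma ctri_curv_form:
  assumes u: "u \<in> L_sections" and v: "v \<in> L_sections" and w: "w \<in> L_sections"
  shows "ctri (curv_form p \<gamma>) u v w = 0"
proof -
  let ?X = "\<lambda>q. fst (u q)" and ?Y = "\<lambda>q. fst (v q)" and ?Z = "\<lambda>q. fst (w q)"
  have f: "Re_vec \<circ> ?X \<in> VF" "Im_vec \<circ> ?X \<in> VF" "Re_vec \<circ> ?Y \<in> VF"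
    "Im_vec \<circ> ?Y \<in> VF" "Re_vec \<circ> ?Z \<in> VF" "Im_vec \<circ> ?Z \<in> VF"
    using section_E(1)[OF u] section_E(1)[OF v] section_E(1)[OF w] by (simp_all add: csections_on_def vector_fields_def)
  have 0: "ccurvature M D ?X ?Y ?Z p = 0" using flat section_E(1) u v w by blast
  have re: "curvature (Re_vec \<circ> ?X) (Re_vec \<circ> ?Y) (Re_vec \<circ> ?Z) p - curvature (Re_vec \<circ> ?X) (Im_vec \<circ> ?Y) (Im_vec \<circ> ?Z) p
    - curvature (Im_vec \<circ> ?X) (Re_vec \<circ> ?Y) (Im_vec \<circ> ?Z) p - curvature (Im_vec \<circ> ?X) (Im_vec \<circ> ?Y) (Re_vec \<circ> ?Z) p
    = Re_vec (ccurvature M D ?X ?Y ?Z p)"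
    unfolding ccurvature_def Re_Im_vec_arith Re_Im_cbilin_vec Re_Im_comp_cbilin_vec curvature_def
    by (simp add: conn_diff_right conn_add_right conn_diff_left conn_add_left conn_smooth lie_bracket_smooth f)
  have im: "curvature (Im_vec \<circ> ?X) (Re_vec \<circ> ?Y) (Re_vec \<circ> ?Z) p + curvature (Re_vec \<circ> ?X) (Im_vec \<circ> ?Y) (Re_vec \<circ> ?Z) p
    + curvature (Re_vec \<circ> ?X) (Re_vec \<circ> ?Y) (Im_vec \<circ> ?Z) p - curvature (Im_vec \<circ> ?X) (Im_vec \<circ> ?Y) (Im_vec \<circ> ?Z) p
    = Im_vec (ccurvature M D ?X ?Y ?Z p)"
    unfolding ccurvature_def Re_Im_vec_arith Re_Im_cbilin_vec Re_Im_comp_cbilin_vec curvature_def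
    by (simp add: conn_diff_right conn_add_right conn_diff_left conn_add_left conn_smooth lie_bracket_smooth f)
  show ?thesis
    using arg_cong[OF re, of "inner \<gamma>"] arg_cong[OF im, of "inner \<gamma>"] unfolding 0 cbilin_vec_fst_conv
    by (simp add: ctri_def curv_form_def complex_eq_iff inner_diff_right inner_add_right Re_Im_vec_arith)
qed

text \<open>The hypothesis on \<alpha> rewritten with the covectors of sections of L. The terms with
  D_Z X and D_Z Y in the covariant derivative cancel against those in the torsion, so D_X Z and D_Y
  Z remain along with the Lie brackets.\<close>

lemma torsion_identity:
  assumes u: "u \<in> L_sections" and v: "v \<in> L_sections" and w: "w \<in> L_sections"
  shows "ctri (deriv_form p) w u v + ctri (conn_form p) u v w + ctri (bracket_form p) w u v
    - ctri (conn_form p) v u w - ctri (bracket_form p) w v u = 0"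
proof -
  let ?X = "\<lambda>q. fst (u q)" and ?Y = "\<lambda>q. fst (v q)" and ?Z = "\<lambda>q. fst (w q)"
  note sec = section_E(1)[OF u] section_E(1)[OF v] section_E(1)[OF w]
  have inE: "cbilin_vec D X Y p \<in> E p" "clie_bracket M X Y p \<in> E p"
    if "X \<in> csections M E" "Y \<in> csections M E" for X Y
    using conn_E inv that unfolding involutive_def csections_on_def by blast+
  have pair: "(\<lambda>q. \<alpha> q (?X q) (?Y q)) = (\<lambda>q. ceval (snd (u q)) (?Y q))"
    using \<alpha>_right[OF u] section_E(2)[OF v] by (simp add: fun_eq_iff)
  have T: "ctorsion M D ?Z ?X p \<in> E p" "ctorsion M D ?Z ?Y p \<in> E p"
    unfolding ctorsion_def by (intro E_diff inE sec)+
  have "cov_deriv_two_form M D \<alpha> ?Z ?X ?Y p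
      + \<alpha> p (ctorsion M D ?Z ?X p) (?Y p) + \<alpha> p (?X p) (ctorsion M D ?Z ?Y p) = 0"
    using torsion sec by blast
  then show ?thesis
    unfolding cov_deriv_two_form_def pair cdfun_ceval[OF w u v]
      \<alpha>_left[OF v inE(1)[OF sec(3,1)]] \<alpha>_right[OF u inE(1)[OF sec(3,2)]] \<alpha>_left[OF v T(1)] \<alpha>_right[OF u T(2)]
    unfolding ctorsion_def ceval_diff_right ceval_conn ceval_bracket by algebra
qed

text \<open>\<xi>(Y) + \<eta>(X) = 0 holds at every point for sections of L, and is differentiated
  here along Z.\<close>

lemma isotropy:
  assumes u: "u \<in> L_sections" and v: "v \<in> L_sections" and w: "w \<in> L_sections"
  shows "ctri (deriv_form p) w u v + ctri (deriv_form p) w v u = 0"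
proof -
  have "ceval (snd (v q)) (fst (u q)) = - ceval (snd (u q)) (fst (v q))" for q
    using \<alpha>_left[OF v section_E(2)[OF u]] \<alpha>_right[OF u section_E(2)[OF v]] by simp
  then have re: "(\<lambda>q. Re (ceval (snd (v q)) (fst (u q)))) = (\<lambda>q. 0 - Re (ceval (snd (u q)) (fst (v q))))"
    and im: "(\<lambda>q. Im (ceval (snd (v q)) (fst (u q)))) = (\<lambda>q. 0 - Im (ceval (snd (u q)) (fst (v q))))"
    by simp_all
  have "dfun M (\<lambda>q. ceval (snd (v q)) (fst (u q))) p x = - dfun M (\<lambda>q. ceval (snd (u q)) (fst (v q))) p x" for x
    unfolding dfun_complex[OF ceval_smooth[OF v u]] dfun_complex[OF ceval_smooth[OF u v]] re im
    by (simp only: dfun_diff smooth_fun_const ceval_smooth u v dfun_const) (simp add: complex_eq_iff)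
  then show ?thesis
    unfolding cdfun_ceval[OF w u v, symmetric] cdfun_ceval[OF w v u, symmetric] by (simp add: cdfun_def)
qed

text \<open>Involutivity keeps the vector part in E, so orthogonality to L decides. \<open>B\<close>
  is arbitrary apart from its vector part in order to cover the lifted bracket and the Courant
  bracket together.\<close>

lemma cbilin_mem_L_iff:
  assumes u: "u \<in> L_sections" and v: "v \<in> L_sections"
    and B: "\<And>a b. a \<in> gen_fields \<Longrightarrow> b \<in> gen_fields \<Longrightarrow>
      fst (B a b p) = lie_bracket M (\<lambda>q. fst (a q)) (\<lambda>q. fst (b q)) p"
  shows "cbilin_gen B u v p \<in> holomorphic_bundle J p \<longleftrightarrow>
    (\<forall>w\<in>L_sections. ctri (\<lambda>a b w. snd (B a b p) \<bullet> fst (w p)) u v w + ctri (bracket_form p) u v w = 0)"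
proof -
  have fst_eq: "fst (cbilin_gen B u v p) = clie_bracket M (\<lambda>q. fst (u q)) (\<lambda>q. fst (v q)) p"
    by (rule fst_cbilin_gen) (use u v B in \<open>auto simp: L_sections_iff\<close>)
  have "clie_bracket M (\<lambda>q. fst (u q)) (\<lambda>q. fst (v q)) p \<in> E p"
    using inv section_E(1)[OF u] section_E(1)[OF v] unfolding involutive_def csections_on_def by blast
  then show ?thesis
    by (subst mem_L_iff) (simp_all add: fst_eq ceval_cbilin_gen ceval_bracket)
qed

lemma snd_lift_bracket:
  assumes "a \<in> gen_fields" "b \<in> gen_fields" "w \<in> gen_fields"
  shows "snd (lift_bracket a b (p, \<gamma>)) \<bullet> fst (w p) = deriv_form p a b w - conn_form p a b w
    - deriv_form p b a w + conn_form p b a w - curv_form p \<gamma> a b w"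
  using lift_bracket(2)[OF assms(1,2), of "\<lambda>q. fst (w q)" p \<gamma>] assms(3)
  by (simp add: gen_fields_iff dual_connection_def deriv_form_def conn_form_def curv_form_def o_def)

lemma snd_courant_bracket:
  assumes "a \<in> gen_fields" "b \<in> gen_fields" "w \<in> gen_fields"
  shows "snd (courant_bracket M a b p) \<bullet> fst (w p) = deriv_form p a b w - bracket_form p a w b
    - deriv_form p b a w + bracket_form p b w a + (deriv_form p w a b - deriv_form p w b a) / 2"
proof -
  have f: "(\<lambda>q. fst (a q)) \<in> VF" "(\<lambda>q. snd (a q)) \<in> one_forms M"
    "(\<lambda>q. fst (b q)) \<in> VF" "(\<lambda>q. snd (b q)) \<in> one_forms M" "(\<lambda>q. fst (w q)) \<in> VF"
    using assms by (simp_all add: gen_fields_iff)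
  show ?thesis
    using lie_deriv_form_pairing[OF f(1,4,5), of p] lie_deriv_form_pairing[OF f(3,2,5), of p]
    by (simp add: courant_bracket_def Let_def inner_add_left inner_diff_left dform_inner smooth_fun_diff
        pairing_smooth f dfun_diff deriv_form_def bracket_form_def)
qed

text \<open>The difference of the two sides is the sum of the torsion hypothesis, the curvature hypothesis
  and the derivative of the isotropy relation of \<open>L\<close>.\<close>

lemma brackets_agree:
  assumes u: "u \<in> L_sections" and v: "v \<in> L_sections" and w: "w \<in> L_sections"
  shows "ctri (\<lambda>a b w. snd (lift_bracket a b (p, \<gamma>)) \<bullet> fst (w p)) u v w
    = ctri (\<lambda>a b w. snd (courant_bracket M a b p) \<bullet> fst (w p)) u v w"
proof -
  have 1: "ctri (\<lambda>a b w. snd (lift_bracket a b (p, \<gamma>)) \<bullet> fst (w p)) u v w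
    = ctri (deriv_form p) u v w - ctri (conn_form p) u v w - ctri (deriv_form p) v u w + ctri (conn_form p) v u w
      - ctri (curv_form p \<gamma>) u v w"
  proof -
    have "ctri (\<lambda>a b w. snd (lift_bracket a b (p, \<gamma>)) \<bullet> fst (w p)) u v w
      = ctri (\<lambda>a b w. deriv_form p a b w - conn_form p a b w
          - deriv_form p b a w + conn_form p b a w - curv_form p \<gamma> a b w) u v w"
      by (rule ctri_cong[OF u v w]) (rule snd_lift_bracket)
    then show ?thesis by (simp add: ctri_def complex_eq_iff)
  qed
  have 2: "ctri (\<lambda>a b w. snd (courant_bracket M a b p) \<bullet> fst (w p)) u v w
    = ctri (deriv_form p) u v w - ctri (bracket_form p) u w v - ctri (deriv_form p) v u w
      + ctri (bracket_form p) v w u + (ctri (deriv_form p) w u v - ctri (deriv_form p) w v u) / 2"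
  proof -
    have "ctri (\<lambda>a b w. snd (courant_bracket M a b p) \<bullet> fst (w p)) u v w
      = ctri (\<lambda>a b w. deriv_form p a b w - bracket_form p a w b - deriv_form p b a w
          + bracket_form p b w a + (deriv_form p w a b - deriv_form p w b a) / 2) u v w"
      by (rule ctri_cong[OF u v w]) (rule snd_courant_bracket)
    then show ?thesis
      by (simp add: ctri_def complex_eq_iff add_divide_distrib diff_divide_distrib)
  qed
  have 3: "ctri (bracket_form p) w u v = - ctri (bracket_form p) u w v"
    "ctri (bracket_form p) w v u = - ctri (bracket_form p) v w u"
    unfolding ctri_def by (simp_all add: complex_eq_iff bracket_form_swap[of p "_ \<circ> w"])
  \<comment> \<open>By isotropy Z(\<eta>(X)) = - Z(\<xi>(Y)), so the exact term with its factor 1/2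
    in the Courant bracket contributes the full Z(\<xi>(Y)), the derivative term of the torsion
    identity.\<close>
  have 4: "ctri (deriv_form p) w v u = - ctri (deriv_form p) w u v"
    using isotropy[OF u v w, of p] by (simp add: add_eq_0_iff)
  show ?thesis
    using torsion_identity[OF u v w, of p] unfolding 1 2 3 4 ctri_curv_form[OF u v w]
    by (simp add: algebra_simps add_eq_0_iff)
qed

text \<open>For u = J a + i a and v = J b + i b the complexified bracket has real part [J a, J b] -
  [a, b] and imaginary part [J a, b] + [a, J b]. It lies in the i-eigenbundle iff the real part is J
  of the imaginary part, which is the vanishing of the Nijenhuis expression
  \<open>?N\<close>.\<close>

lemma integrable_iff_lift_bracket_mem:
  "integrable_almost_complex_structure CM (cotangent_acs M J D) \<longleftrightarrow>
    (\<forall>u\<in>L_sections. \<forall>v\<in>L_sections. \<forall>p \<gamma>.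
      cbilin_gen (\<lambda>a b q. lift_bracket a b (q, \<gamma>)) u v p \<in> holomorphic_bundle J p)"
proof -
  let ?N = "\<lambda>a b p \<gamma>. lift_bracket (\<lambda>q. J q (a q)) (\<lambda>q. J q (b q)) (p, \<gamma>)
        - J p (lift_bracket (\<lambda>q. J q (a q)) b (p, \<gamma>)) - J p (lift_bracket a (\<lambda>q. J q (b q)) (p, \<gamma>))
        - lift_bracket a b (p, \<gamma>)"
  have mem: "cbilin_gen (\<lambda>a b q. lift_bracket a b (q, \<gamma>)) (\<lambda>q. Complex_gen (J q (a q)) (a q))
      (\<lambda>q. Complex_gen (J q (b q)) (b q)) p \<in> holomorphic_bundle J p \<longleftrightarrow> ?N a b p \<gamma> = 0" for a b p \<gamma>
  proof -
    let ?P = "lift_bracket (\<lambda>q. J q (a q)) (\<lambda>q. J q (b q)) (p, \<gamma>) - lift_bracket a b (p, \<gamma>)"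
      and ?Q = "lift_bracket (\<lambda>q. J q (a q)) b (p, \<gamma>) + lift_bracket a (\<lambda>q. J q (b q)) (p, \<gamma>)"
    have "J p z = - z' \<longleftrightarrow> z = J p z'" for z z'
    proof
      assume "J p z = - z'"
      then have "J p (J p z) = - J p z'" by (simp add: linear_neg[OF linear_J])
      then show "z = J p z'" by simp
    qed simp
    then have "J p ?P = - ?Q \<longleftrightarrow> ?P = J p ?Q" .
    also have "\<dots> \<longleftrightarrow> ?N a b p \<gamma> = 0"
      by (simp add: linear_add[OF linear_J] algebra_simps eq_diff_eq)
    finally show ?thesis
      by (simp add: mem_holomorphic_iff cbilin_gen_def o_def add.commute)
  qed
  have L: "\<exists>a\<in>gen_fields. u = (\<lambda>q. Complex_gen (J q (a q)) (a q))" if "u \<in> L_sections" for u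
    using that holomorphic_Re[of "u _"] by (intro bexI[of _ "Im_gen \<circ> u"]) (auto simp: L_sections_iff fun_eq_iff cgen_eq_iff)
  have "integrable_almost_complex_structure CM (cotangent_acs M J D) \<longleftrightarrow>
    (\<forall>a\<in>gen_fields. \<forall>b\<in>gen_fields. \<forall>p \<gamma>. ?N a b p \<gamma> = 0)"
    unfolding integrable_iff_lift_brackets split_paired_All fst_conv by (rule refl)
  also have "\<dots> \<longleftrightarrow> (\<forall>u\<in>L_sections. \<forall>v\<in>L_sections. \<forall>p \<gamma>.
      cbilin_gen (\<lambda>a b q. lift_bracket a b (q, \<gamma>)) u v p \<in> holomorphic_bundle J p)"
  proof -
    \<comment> \<open>A section of L is recovered from its imaginary part a, so quantifying over
      sections of L is quantifying over smooth real fields.\<close>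
    have "L_sections = (\<lambda>a q. Complex_gen (J q (a q)) (a q)) ` gen_fields"
      using L L_section_of_field by blast
    then show ?thesis by (simp only: ball_simps(9) mem)
  qed
  finally show ?thesis .
qed

text \<open>The Courant bracket of smooth sections is smooth, so closedness of the space of sections
  is a pointwise membership.\<close>

lemma courant_integrable_iff_mem:
  "courant_integrable M J \<longleftrightarrow> (\<forall>u\<in>L_sections. \<forall>v\<in>L_sections. \<forall>p.
      ccourant_bracket M u v p \<in> holomorphic_bundle J p)"
proof -
  have "Re_gen \<circ> ccourant_bracket M u v \<in> gen_fields \<and> Im_gen \<circ> ccourant_bracket M u v \<in> gen_fields"
    if "u \<in> L_sections" "v \<in> L_sections" for u v
    using that by (auto simp: o_def cbilin_gen_def L_sections_iff
        intro!: gen_fields_add gen_fields_diff courant_gen_field)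
  then show ?thesis by (auto simp: courant_integrable_def L_sections_iff)
qed

theorem integrable_iff_courant_integrable:
  "integrable_almost_complex_structure CM (cotangent_acs M J D) \<longleftrightarrow> courant_integrable M J"
proof -
  have "cbilin_gen (\<lambda>a b q. lift_bracket a b (q, \<gamma>)) u v p \<in> holomorphic_bundle J p \<longleftrightarrow>
      ccourant_bracket M u v p \<in> holomorphic_bundle J p"
    if u: "u \<in> L_sections" and v: "v \<in> L_sections" for u v p \<gamma>
  proof -
    have "cbilin_gen (\<lambda>a b q. lift_bracket a b (q, \<gamma>)) u v p \<in> holomorphic_bundle J p \<longleftrightarrow>
      (\<forall>w\<in>L_sections. ctri (\<lambda>a b w. snd (lift_bracket a b (p, \<gamma>)) \<bullet> fst (w p)) u v w + ctri (bracket_form p) u v w = 0)"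
      by (rule cbilin_mem_L_iff[OF u v]) (use lift_bracket(1) in \<open>simp add: o_def\<close>)
    moreover have "ccourant_bracket M u v p \<in> holomorphic_bundle J p \<longleftrightarrow>
      (\<forall>w\<in>L_sections. ctri (\<lambda>a b w. snd (courant_bracket M a b p) \<bullet> fst (w p)) u v w + ctri (bracket_form p) u v w = 0)"
      by (rule cbilin_mem_L_iff[OF u v]) (simp add: courant_bracket_def Let_def)
    ultimately show ?thesis using brackets_agree[OF u v] by simp
  qed
  then show ?thesis unfolding integrable_iff_lift_bracket_mem courant_integrable_iff_mem by blast
qed

end

theorem corollary17:
  fixes M :: "('m, real ^ 'n) charted_space"
    and J :: "'m \<Rightarrow> (real ^ 'n) \<times> (real ^ 'n) \<Rightarrow> (real ^ 'n) \<times> (real ^ 'n)"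
    and E :: "'m \<Rightarrow> (complex ^ 'n) set"
    and \<alpha> :: "'m \<Rightarrow> complex ^ 'n \<Rightarrow> complex ^ 'n \<Rightarrow> complex"
    and D :: "('m \<Rightarrow> real ^ 'n) \<Rightarrow> ('m \<Rightarrow> real ^ 'n) \<Rightarrow> 'm \<Rightarrow> real ^ 'n"
  assumes "smooth_manifold M"
    and "skew_gen_complex_structure M J"
    and "has_holomorphic_bundle M J E \<alpha>"
    and "linear_connection M D"
    and "involutive M E"
    and "\<forall>X\<in>csections M E. \<forall>Y\<in>csections M E. cbilin_vec D X Y \<in> csections M E"
    and "\<forall>X\<in>csections M E. \<forall>Y\<in>csections M E. \<forall>Z\<in>csections M E. \<forall>p. ccurvature M D X Y Z p = 0"
    and "\<forall>X\<in>csections M E. \<forall>Y\<in>csections M E. \<forall>Z\<in>csections M E. \<forall>p.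
           cov_deriv_two_form M D \<alpha> Z X Y p
           + \<alpha> p (ctorsion M D Z X p) (Y p) + \<alpha> p (X p) (ctorsion M D Z Y p) = 0"
  shows "integrable_almost_complex_structure (cotangent_bundle M) (cotangent_acs M J D)
         \<longleftrightarrow> courant_integrable M J"
proof -
  interpret involutive_setting M D J E \<alpha>
    by unfold_locales (fact assms)+
  show ?thesis by (rule integrable_iff_courant_integrable)
qed

end
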